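(* Let $N\ge1$ and let $H\in C^2(\mathbf{R}^N\times\mathbf{R}^N;\mathbf{R})$ satisfy: there exist $\kappa>0$ and $h\in C(\mathbf{R};\mathbf{R}_+)$ with $h(r)/r\to0$ as $r\to+\infty$ such that $|\nabla_\xi H(x,\xi)|\le\kappa(1+|\xi|)$, $|\nabla_x H(x,\xi)|\le h(|x|)+\kappa|\xi|$, $|\nabla^2H(x,\xi)|\le\kappa$ for all $(x,\xi)$. Let $\Phi_t=(X_t,\Xi_t)$ be its Hamiltonian flow. Let $U^{in}$ be a continuous vector field on $\mathbf{R}^N$ with $|U^{in}(y)|/|y|\to0$ as $|y|\to\infty$ and such that for every bounded open $\Omega\subset\mathbf{R}^N$ and all $k,l$, $\partial_lU^{in}_k|_\Omega\in L^{N,1}(\Omega)$. For each $t\in\mathbf{R}$ let $$A_t:=\{x\in\mathbf{R}^N:\ \mathcal{L}^N(F_t^{-1}(\{x\})\cap Z_t)>0\}.$$ (a) For each $t\in\mathbf{R}$, $A_t\subset C_t$. (b) Let $t\in\mathbf{R}$ and let $\rho^{in}$ be a probability density on $\mathbf{R}^N$ with $\rho^{in}>0$ a.e. on $Z_t$. With $\mu^{in}$ the monokinetic measure with momentum profile $U^{in}$ and density $\rho^{in}$, $\mu(t):=\Phi_t\#\mu^{in}$ and $\rho(t):=\Pi\#\mu(t)$, one has for every $x\in\mathbf{R}^N$: $\rho(t)(\{x\})>0$ if and only if $x\in A_t$. (c) For each $t\in\mathbf{R}$, the set $A_t$ is at most countable.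
   Context: $\Phi_t(x,\xi)=(X_t(x,\xi),\Xi_t(x,\xi))$ solves $\dot X=\nabla_\xi H(X,\Xi)$, $\dot\Xi=-\nabla_xH(X,\Xi)$, $\Phi_0=\mathrm{Id}$. $L^{N,1}(\Omega)$ is the Lorentz space of measurable $f$ with $\int_0^\infty(\mathcal{L}^N(\{|f|\ge\lambda\}))^{1/N}d\lambda<\infty$; then $U^{in}$ is differentiable outside the Lebesgue-null set $E$ of its non-differentiability points. $F_t(y):=X_t(y,U^{in}(y))$; for $y\notin E$, $J_t(y):=|\det DF_t(y)|$; $Z_t:=\{y\in\mathbf{R}^N\setminus E: J_t(y)=0\}$; $C_t:=\{x: F_t^{-1}(\{x\})\cap(Z_t\cup E)\ne\emptyset\}$. The monokinetic measure $\mu^{in}$ is defined by $\iint\phi\,d\mu^{in}=\int\phi(x,U^{in}(x))\rho^{in}(x)dx$ for $\phi\in C_c(\mathbf{R}^N\times\mathbf{R}^N)$. $\Pi(x,\xi):=x$ and $\#$ denotes push-forward. *)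

theory Defs
  imports "HOL-Analysis.Analysis"
begin

definition partial_deriv :: "'n::finite \<Rightarrow> (real^'n \<Rightarrow> real) \<Rightarrow> real^'n \<Rightarrow> real" where
  "partial_deriv l f y = frechet_derivative f (at y) (axis l 1)"

fun iter_partial :: "'n::finite list \<Rightarrow> (real^'n \<Rightarrow> real) \<Rightarrow> real^'n \<Rightarrow> real" where
  "iter_partial [] f = f"
| "iter_partial (l # ls) f = partial_deriv l (iter_partial ls f)"

definition smooth_fun :: "(real^'n::finite \<Rightarrow> real) \<Rightarrow> bool" where
  "smooth_fun f \<longleftrightarrow> (\<forall>ls y. iter_partial ls f differentiable (at y))"

definition test_fun :: "(real^'n::finite) set \<Rightarrow> (real^'n \<Rightarrow> real) \<Rightarrow> bool" where
  "test_fun \<Omega> \<phi> \<longleftrightarrow> smooth_fun \<phi> \<and> compact (closure {y. \<phi> y \<noteq> 0})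
      \<and> closure {y. \<phi> y \<noteq> 0} \<subseteq> \<Omega>"

definition weak_partial :: "(real^'n::finite) set \<Rightarrow> 'n \<Rightarrow> (real^'n \<Rightarrow> real) \<Rightarrow> (real^'n \<Rightarrow> real) \<Rightarrow> bool" where
  "weak_partial \<Omega> l u g \<longleftrightarrow>
     (\<forall>K. compact K \<and> K \<subseteq> \<Omega> \<longrightarrow> set_integrable lebesgue K u \<and> set_integrable lebesgue K g) \<and>
     (\<forall>\<phi>. test_fun \<Omega> \<phi> \<longrightarrow>
        (LINT y:\<Omega>|lebesgue. u y * partial_deriv l \<phi> y) = - (LINT y:\<Omega>|lebesgue. g y * \<phi> y))"

definition lorentz_N1 :: "(real^'n::finite) set \<Rightarrow> (real^'n \<Rightarrow> real) \<Rightarrow> bool" where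
  "lorentz_N1 \<Omega> f \<longleftrightarrow> f \<in> borel_measurable (restrict_space lebesgue \<Omega>) \<and>
     (\<integral>\<^sup>+ s. (let m = emeasure lebesgue {y\<in>\<Omega>. \<bar>f y\<bar> \<ge> s} in
                 if m = \<infinity> then \<infinity> else ennreal (enn2real m powr (1 / real CARD('n))))
              * indicator {0..} s \<partial>lborel) < \<infinity>"

definition Fmap :: "(real \<Rightarrow> real^'n \<Rightarrow> real^'n \<Rightarrow> real^'n) \<Rightarrow> (real^'n \<Rightarrow> real^'n) \<Rightarrow> real \<Rightarrow> real^'n \<Rightarrow> real^'n::finite" where
  "Fmap X U t y = X t y (U y)"

definition Eset :: "(real^'n \<Rightarrow> real^'n::finite) \<Rightarrow> (real^'n) set" where
  "Eset U = {y. \<not> U differentiable (at y)}"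

definition Jac :: "(real \<Rightarrow> real^'n \<Rightarrow> real^'n \<Rightarrow> real^'n) \<Rightarrow> (real^'n \<Rightarrow> real^'n) \<Rightarrow> real \<Rightarrow> real^'n \<Rightarrow> real" where
  "Jac X U t y = \<bar>det (matrix (frechet_derivative (Fmap X U t) (at y)))\<bar>"

definition Zset :: "(real \<Rightarrow> real^'n \<Rightarrow> real^'n \<Rightarrow> real^'n) \<Rightarrow> (real^'n \<Rightarrow> real^'n::finite) \<Rightarrow> real \<Rightarrow> (real^'n) set" where
  "Zset X U t = {y. y \<notin> Eset U \<and> Jac X U t y = 0}"

definition Cset :: "(real \<Rightarrow> real^'n \<Rightarrow> real^'n \<Rightarrow> real^'n) \<Rightarrow> (real^'n \<Rightarrow> real^'n::finite) \<Rightarrow> real \<Rightarrow> (real^'n) set" where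
  "Cset X U t = {x. Fmap X U t -` {x} \<inter> (Zset X U t \<union> Eset U) \<noteq> {}}"

definition Aset :: "(real \<Rightarrow> real^'n \<Rightarrow> real^'n \<Rightarrow> real^'n) \<Rightarrow> (real^'n \<Rightarrow> real^'n::finite) \<Rightarrow> real \<Rightarrow> (real^'n) set" where
  "Aset X U t = {x. emeasure lebesgue (Fmap X U t -` {x} \<inter> Zset X U t) > 0}"

definition mu_in :: "(real^'n \<Rightarrow> real^'n::finite) \<Rightarrow> (real^'n \<Rightarrow> real) \<Rightarrow> ((real^'n) \<times> (real^'n)) measure" where
  "mu_in U rho = distr (density lebesgue (\<lambda>y. ennreal (rho y))) borel (\<lambda>y. (y, U y))"

definition mu_t :: "(real \<Rightarrow> real^'n \<Rightarrow> real^'n \<Rightarrow> real^'n) \<Rightarrow> (real \<Rightarrow> real^'n \<Rightarrow> real^'n \<Rightarrow> real^'n)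
    \<Rightarrow> (real^'n \<Rightarrow> real^'n::finite) \<Rightarrow> (real^'n \<Rightarrow> real) \<Rightarrow> real \<Rightarrow> ((real^'n) \<times> (real^'n)) measure" where
  "mu_t X Xi U rho t = distr (mu_in U rho) borel (\<lambda>(x, \<xi>). (X t x \<xi>, Xi t x \<xi>))"

definition rho_t :: "(real \<Rightarrow> real^'n \<Rightarrow> real^'n \<Rightarrow> real^'n) \<Rightarrow> (real \<Rightarrow> real^'n \<Rightarrow> real^'n \<Rightarrow> real^'n)
    \<Rightarrow> (real^'n \<Rightarrow> real^'n::finite) \<Rightarrow> (real^'n \<Rightarrow> real) \<Rightarrow> real \<Rightarrow> (real^'n) measure" where
  "rho_t X Xi U rho t = distr (mu_t X Xi U rho t) borel fst"

end

theory Submission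
  imports Defs "HOL-Computational_Algebra.Polynomial"
begin

text \<open>
  A fibre \<open>K\<close> of \<open>F = Fmap X U t\<close> over \<open>x\<close> with positive measure is essentially contained in \<open>Zset\<close>: by
  Gronwall's inequality the flow is Lipschitz, so at a density point of \<open>K\<close> where \<open>U\<close> is differentiable
  the derivative of \<open>F\<close> exists and vanishes (differentiability of the flow is not needed). Hence
  \<open>Aset\<close> consists of the points with non-null fibre, which are countably many.

  That \<open>Eset\<close> is null is Stein's theorem. Dilating a bump function towards a point \<open>z\<close>, the average
  \<open>m \<tau>\<close> of \<open>f\<close> at scale \<open>\<tau>\<close> around \<open>z + \<tau> e\<close> satisfies \<open>m' \<tau> = \<integral> g \<bullet> (field of size |y - z| / \<tau>^(n+1))\<close>,
  which bounds the oscillation of \<open>f - a \<bullet> y\<close> by Riesz potentials of \<open>|g - a|\<close>. The Riesz potential of the indicator of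
  a set \<open>A\<close> is at most a constant times \<open>|A|^(1/n)\<close>, so the potential is controlled by the Lorentz seminorm on small balls,
  and a weak-type estimate makes the latter \<open>o(r)\<close> at almost every point, with \<open>a\<close> the value of \<open>g\<close> there.
\<close>

section \<open>Smooth bump functions\<close>

text \<open>The oscillation is controlled by comparing the values at x and at a nearby y with one
  common number. For z in the cube of half-side R around x, the offset e = (x - z) / R puts the
  averaging box at scale R exactly over that cube, whichever z is taken, while at scale 0 the box
  has shrunk to z. All |e_i| are at most 1, so every intermediate box stays in the cube. This is why
  the averages carry an offset instead of being centred. The function f is merely continuous and its
  derivatives are weak. The scale derivative is therefore put on the kernel and then traded for
  \<open>g\<close> by testing against a field, which must be a genuine smooth function of compact
  support; hence the explicit bump and the products of one-variable factors. The exponent 1/n of the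
  Lorentz seminorm enters twice: as the size of the Riesz potential of a level set, uniformly in the
  pole z, and as the power that makes the seminorm on a ball comparable with its radius, so that
  n-th powers can be summed over disjoint balls.\<close>

definition bump :: "nat \<Rightarrow> real poly \<Rightarrow> real \<Rightarrow> real" where
  "bump m p x = (if \<bar>x\<bar> < 1 then poly p x / (1 - x\<^sup>2) ^ m * exp (- 1 / (1 - x\<^sup>2)) else 0)"

text \<open>With t = 1 - x^2, the derivative of p / t^m * exp (-1/t) is (p' t^2 + 2 m x p t - 2 x p)
  / t^(m+2) * exp (-1/t). The family is closed under differentiation with m growing by 2, so
  smoothness becomes a recursion on polynomials; \<open>[:1, 0, -1:]\<close> is t.\<close>

definition bump_deriv :: "nat \<Rightarrow> real poly \<Rightarrow> real poly" where
  "bump_deriv m p = pderiv p * [:1, 0, -1:]\<^sup>2 + smult (2 * real m) ([:0, 1:] * p * [:1, 0, -1:])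
     - smult 2 ([:0, 1:] * p)"

text \<open>Keeping the single term (1/t)^n / n! of the series of exp (1/t) shows decay faster than
  any power of t at 0.\<close>

lemma exp_minus_inverse_le:
  fixes t :: real
  assumes "t > 0"
  shows "exp (- 1 / t) \<le> fact n * t ^ n"
proof -
  have "(1 / t) ^ n / fact n \<le> exp (1 / t)"
  proof -
    have "(\<Sum>k\<in>{n}. inverse (fact k) *\<^sub>R (1 / t) ^ k) \<le> exp (1 / t)"
      unfolding exp_def using assms
      by (intro sum_le_suminf summable_exp_generic) auto
    then show ?thesis by (simp add: field_simps)
  qed
  then have "1 / (fact n * t ^ n) \<le> exp (1 / t)"
    by (simp add: power_divide field_simps)
  then have "inverse (exp (1 / t)) \<le> inverse (1 / (fact n * t ^ n))"
    using assms by (intro le_imp_inverse_le) auto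
  then show ?thesis by (simp add: exp_minus)
qed

text \<open>Vanishing to second order at both endpoints is all that differentiability there
  requires. The exponential is bounded with the power m + 2, so that t^m cancels the denominator and
  t^2 remains, and t = (1 - |y|)(1 + |y|) is at most 2 (1 - |y|).\<close>

lemma bump_quadratic_bound:
  "\<exists>C\<ge>0. \<forall>y. \<bar>bump m p y\<bar> \<le> C * (1 - \<bar>y\<bar>)\<^sup>2"
proof -
  have "bounded (poly p ` {-1..1})"
    by (intro compact_imp_bounded compact_continuous_image continuous_intros) auto
  then obtain B where B: "B > 0" "\<And>y. y \<in> {-1..1} \<Longrightarrow> \<bar>poly p y\<bar> \<le> B"
    unfolding bounded_pos by (auto simp: real_norm_def)
  let ?C = "B * fact (m + 2) * 4"
  have "\<bar>bump m p y\<bar> \<le> ?C * (1 - \<bar>y\<bar>)\<^sup>2" for y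
  proof (cases "\<bar>y\<bar> < 1")
    case True
    define t where "t = 1 - y\<^sup>2"
    have t: "t > 0" using True by (simp add: t_def abs_square_less_1)
    have t_eq: "t = (1 - \<bar>y\<bar>) * (1 + \<bar>y\<bar>)" by (simp add: t_def algebra_simps power2_eq_square)
    have tle: "t \<le> 2 * (1 - \<bar>y\<bar>)"
      unfolding t_eq using True mult_left_mono[of "1 + \<bar>y\<bar>" 2 "1 - \<bar>y\<bar>"] by auto
    have "\<bar>bump m p y\<bar> = \<bar>poly p y\<bar> / t ^ m * exp (- 1 / t)"
      using True t by (simp add: bump_def t_def abs_mult)
    also have "\<dots> \<le> B / t ^ m * (fact (m + 2) * t ^ (m + 2))"
      using t B(1) B(2)[of y] True abs_le_iff[of y 1] by (intro mult_mono divide_right_mono exp_minus_inverse_le) auto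
    also have "\<dots> = B * fact (m + 2) * t\<^sup>2"
      using t unfolding power_add by (simp del: fact_Suc)
    also have "\<dots> \<le> B * fact (m + 2) * (2 * (1 - \<bar>y\<bar>))\<^sup>2"
      using t tle B by (intro mult_left_mono power_mono) auto
    finally show ?thesis unfolding power_mult_distrib by (simp del: fact_Suc)
  qed (use B in \<open>auto simp: bump_def\<close>)
  then show ?thesis using B by (intro exI[of _ ?C]) auto
qed

text \<open>Quotient and product rule inside the interval, the constant 0 outside; at the two
  endpoints the quadratic bound forces the derivative to be 0, which is also the value of the new
  bump there.\<close>

lemma DERIV_bump: "(bump m p has_real_derivative bump (m + 2) (bump_deriv m p) x) (at x)"
proof -
  consider "\<bar>x\<bar> < 1" | "\<bar>x\<bar> = 1" | "\<bar>x\<bar> > 1" by linarith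
  then show ?thesis
  proof cases
    case 1
    define t where "t = 1 - x\<^sup>2"
    have t: "t > 0" using 1 by (simp add: t_def abs_square_less_1)
    have "((\<lambda>x. poly p x / (1 - x\<^sup>2) ^ m * exp (- 1 / (1 - x\<^sup>2))) has_real_derivative
           ((poly (pderiv p) x * t ^ m - poly p x * (real m * t ^ (m - 1) * (- 2 * x))) / (t ^ m * t ^ m) * exp (- 1 / t)
            + poly p x / t ^ m * (exp (- 1 / t) * (- 2 * x / (t * t))))) (at x)"
    proof -
      have dt: "((\<lambda>x. 1 - x\<^sup>2) has_real_derivative - 2 * x) (at x)"
        by (auto intro!: derivative_eq_intros)
      have dp: "((\<lambda>x. (1 - x\<^sup>2) ^ m) has_real_derivative real m * t ^ (m - 1) * (- 2 * x)) (at x)"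
        using DERIV_power[OF dt, of m] by (simp add: t_def mult_ac)
      have de: "((\<lambda>x. exp (- 1 / (1 - x\<^sup>2))) has_real_derivative exp (- 1 / t) * (- 2 * x / (t * t))) (at x)"
        using DERIV_fun_exp[OF DERIV_divide[OF DERIV_const[of "-1"] dt]] t by (simp add: t_def)
      show ?thesis
        using DERIV_mult[OF DERIV_divide[OF poly_DERIV dp] de, of p] t by (simp add: t_def mult_ac add_ac)
    qed
    also have "((poly (pderiv p) x * t ^ m - poly p x * (real m * t ^ (m - 1) * (- 2 * x))) / (t ^ m * t ^ m) * exp (- 1 / t)
            + poly p x / t ^ m * (exp (- 1 / t) * (- 2 * x / (t * t))))
          = bump (m + 2) (bump_deriv m p) x"
    proof -
      have pt: "poly [:1, 0, -1:] x = t" by (simp add: t_def power2_eq_square)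
      have "poly (bump_deriv m p) x = poly (pderiv p) x * t\<^sup>2 + 2 * real m * (x * poly p x * t) - 2 * (x * poly p x)"
        unfolding bump_deriv_def by (simp only: poly_add poly_diff poly_mult poly_smult poly_power pt) simp
      then have b: "bump (m + 2) (bump_deriv m p) x
          = (poly (pderiv p) x * t\<^sup>2 + 2 * real m * (x * poly p x * t) - 2 * (x * poly p x)) / t ^ (m + 2) * exp (- 1 / t)"
        using 1 by (simp add: bump_def t_def)
      have "poly p x * (real m * t ^ (m - 1) * (- 2 * x)) / (t ^ m * t ^ m)
          = - 2 * real m * x * poly p x * t / t ^ (m + 2)"
        using t by (cases m) (auto simp: power_add power2_eq_square divide_simps algebra_simps)
      moreover have "poly (pderiv p) x * t ^ m / (t ^ m * t ^ m) = poly (pderiv p) x * t\<^sup>2 / t ^ (m + 2)"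
        using t by (simp add: power_add power2_eq_square)
      moreover have "poly p x / t ^ m * (exp (- 1 / t) * (- 2 * x / (t * t)))
          = - 2 * (x * poly p x) / t ^ (m + 2) * exp (- 1 / t)"
        using t by (simp add: power_add power2_eq_square mult_ac)
      ultimately show ?thesis unfolding b diff_divide_distrib add_divide_distrib
        by (simp add: algebra_simps)
    qed
    finally show ?thesis
      by (rule has_field_derivative_transform_within_open[where S = "{-1<..<1}"])
         (use 1 in \<open>auto simp: bump_def\<close>)
  next
    case 2
    obtain C where C: "C \<ge> 0" "\<And>y. \<bar>bump m p y\<bar> \<le> C * (1 - \<bar>y\<bar>)\<^sup>2"
      using bump_quadratic_bound by metis
    have bx: "bump k q x = 0" for k q using 2 by (simp add: bump_def)
    have "((\<lambda>y. (bump m p y - bump m p x) / (y - x)) \<longlongrightarrow> 0) (at x)"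
    proof (rule Lim_null_comparison)
      show "((\<lambda>y. C * \<bar>y - x\<bar>) \<longlongrightarrow> 0) (at x)"
        by (auto intro!: tendsto_eq_intros)
      show "\<forall>\<^sub>F y in at x. norm ((bump m p y - bump m p x) / (y - x)) \<le> C * \<bar>y - x\<bar>"
      proof (rule eventually_mono[OF eventually_at_filter[THEN iffD2]])
        fix y
        \<comment> \<open>Since |x| = 1, the left side is (|x| - |y|)^2, bounded by the reverse
          triangle inequality.\<close>
        have "(1 - \<bar>y\<bar>)\<^sup>2 \<le> \<bar>y - x\<bar>\<^sup>2"
          using 2 by (intro power2_le_iff_abs_le[THEN iffD2]) auto
        then have "\<bar>bump m p y\<bar> \<le> C * \<bar>y - x\<bar>\<^sup>2"
          using C(2)[of y] C(1) by (meson mult_left_mono order_trans)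
        then show "norm ((bump m p y - bump m p x) / (y - x)) \<le> C * \<bar>y - x\<bar>" if "y \<noteq> x"
          using that by (simp add: bx abs_divide power2_eq_square divide_simps mult_ac)
      qed (auto)
    qed
    then show ?thesis by (simp add: bx has_field_derivative_iff)
  next
    case 3
    have "((\<lambda>_. 0) has_real_derivative 0) (at x)" by simp
    then have "(bump m p has_real_derivative 0) (at x)"
      by (rule has_field_derivative_transform_within_open[where S = "- {-1..1}"])
         (use 3 in \<open>auto simp: bump_def\<close>)
    moreover have "bump (m + 2) (bump_deriv m p) x = 0" using 3 by (simp add: bump_def)
    ultimately show ?thesis by simp
  qed
qed

lemma continuous_bump: "continuous_on S (bump m p)"
  by (rule DERIV_continuous_on[OF has_field_derivative_at_within[OF DERIV_bump]])

lemma bump_outside: "\<bar>x\<bar> \<ge> 1 \<Longrightarrow> bump m p x = 0"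
  by (simp add: bump_def)

text \<open>A whole sequence of derivatives is bundled, so that the derivative of order k is
  available as \<open>d k\<close> and iterated partials of a product can be written down by counting
  occurrences of each index.\<close>

definition smooth_real :: "(real \<Rightarrow> real) \<Rightarrow> bool" where
  "smooth_real f \<longleftrightarrow> (\<exists>d. d 0 = f \<and> (\<forall>n x. (d n has_real_derivative d (Suc n) x) (at x)))"

lemma smooth_real_bump_affine: "smooth_real (\<lambda>s. bump m p (a * s + c))"
proof -
  define q where "q = rec_nat p (\<lambda>n. bump_deriv (m + 2 * n))"
  define d where "d n s = a ^ n * bump (m + 2 * n) (q n) (a * s + c)" for n s
  have q: "q 0 = p" "q (Suc n) = bump_deriv (m + 2 * n) (q n)" for n
    by (auto simp: q_def)
  have "(d n has_real_derivative d (Suc n) x) (at x)" for n x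
  proof -
    have "((\<lambda>s. a * s + c) has_real_derivative a) (at x)"
      by (auto intro!: derivative_eq_intros)
    then have "((\<lambda>s. bump (m + 2 * n) (q n) (a * s + c)) has_real_derivative
        bump (m + 2 * n + 2) (bump_deriv (m + 2 * n) (q n)) (a * x + c) * a) (at x)"
      by (rule DERIV_chain2[OF DERIV_bump])
    then have "((\<lambda>s. a ^ n * bump (m + 2 * n) (q n) (a * s + c)) has_real_derivative
        a ^ n * (bump (m + 2 * n + 2) (bump_deriv (m + 2 * n) (q n)) (a * x + c) * a)) (at x)"
      by (rule DERIV_cmult)
    then show ?thesis
      by (simp add: d_def[abs_def] q(2) mult_ac)
  qed
  then show ?thesis unfolding smooth_real_def
    by (intro exI[of _ d]) (auto simp: d_def q)
qed

section \<open>Products of one-variable functions as test functions\<close>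

lemma has_derivative_prod_coords:
  fixes y :: "real^'n::finite"
  assumes "\<And>i. (h i has_real_derivative h' i) (at (y $ i))"
  shows "((\<lambda>y. \<Prod>i\<in>UNIV. h i (y $ i)) has_derivative
     (\<lambda>v. \<Sum>i\<in>UNIV. h' i * (v $ i) * (\<Prod>j\<in>UNIV - {i}. h j (y $ j)))) (at y)"
proof (rule has_derivative_prod)
  fix i
  have "((\<lambda>y. y $ i) has_derivative (\<lambda>v. v $ i)) (at y)"
    by (simp add: bounded_linear_imp_has_derivative bounded_linear_vec_nth)
  then show "((\<lambda>y. h i (y $ i)) has_derivative (\<lambda>v. h' i * v $ i)) (at y)"
    using assms[of i] unfolding has_field_derivative_def by (rule has_derivative_compose)
qed

lemma partial_deriv_prod_coords:
  fixes y :: "real^'n::finite"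
  assumes "\<And>i. (h i has_real_derivative h' i) (at (y $ i))"
  shows "partial_deriv l (\<lambda>y. \<Prod>i\<in>UNIV. h i (y $ i)) y = h' l * (\<Prod>j\<in>UNIV - {l}. h j (y $ j))"
proof -
  have "partial_deriv l (\<lambda>y. \<Prod>i\<in>UNIV. h i (y $ i)) y
      = (\<Sum>i\<in>UNIV. h' i * (axis l 1 $ i) * (\<Prod>j\<in>UNIV - {i}. h j (y $ j)))"
    unfolding partial_deriv_def
    by (rule fun_cong[OF frechet_derivative_at[OF has_derivative_prod_coords[of h h' y, OF assms]], symmetric])
  also have "\<dots> = (\<Sum>i\<in>UNIV. if i = l then h' l * (\<Prod>j\<in>UNIV - {l}. h j (y $ j)) else 0)"
    by (intro sum.cong) (auto simp: axis_def)
  finally show ?thesis by simp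
qed

text \<open>For a product over the coordinates the order of the partial derivatives is irrelevant:
  applying \<open>ls\<close> replaces the i-th factor by its derivative of order
  \<open>count_list ls i\<close>. Every iterated partial is again such a product and hence
  differentiable.\<close>

lemma smooth_fun_prod_coords:
  fixes h :: "'n::finite \<Rightarrow> real \<Rightarrow> real"
  assumes "\<And>i. smooth_real (h i)"
  shows "smooth_fun (\<lambda>y. \<Prod>i\<in>UNIV. h i (y $ i))"
proof -
  have "\<forall>i. \<exists>d. d 0 = h i \<and> (\<forall>n x. (d n has_real_derivative d (Suc n) x) (at x))"
    using assms by (simp add: smooth_real_def)
  then obtain d where "\<forall>i. d i 0 = h i \<and> (\<forall>n x. (d i n has_real_derivative d i (Suc n) x) (at x))"
    by (rule choice[THEN exE])
  then have d0: "\<And>i. d i 0 = h i" and d: "\<And>i n x. (d i n has_real_derivative d i (Suc n) x) (at x)"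
    by auto
  have it: "iter_partial ls (\<lambda>y. \<Prod>i\<in>UNIV. h i (y $ i)) = (\<lambda>y. \<Prod>i\<in>UNIV. d i (count_list ls i) (y $ i))" for ls
  proof (induction ls)
    case (Cons l ls)
    have "partial_deriv l (\<lambda>y. \<Prod>i\<in>UNIV. d i (count_list ls i) (y $ i)) y
       = (\<Prod>i\<in>UNIV. d i (count_list (l # ls) i) (y $ i))" for y
    proof -
      have "(\<Prod>j\<in>UNIV - {l}. d j (count_list ls j) (y $ j)) = (\<Prod>j\<in>UNIV - {l}. d j (count_list (l # ls) j) (y $ j))"
        by (intro prod.cong) auto
      then show ?thesis
        by (subst partial_deriv_prod_coords[where h' = "\<lambda>i. d i (Suc (count_list ls i)) (y $ i)"])
           (auto intro: d simp: prod.remove[of UNIV l])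
    qed
    then show ?case by (simp add: Cons.IH fun_eq_iff)
  qed (simp add: d0)
  show ?thesis unfolding smooth_fun_def it
  proof (intro allI)
    fix ls and y :: "real^'n"
    show "(\<lambda>y. \<Prod>i\<in>UNIV. d i (count_list ls i) (y $ i)) differentiable at y"
      by (rule differentiableI, rule has_derivative_prod_coords, rule d)
  qed
qed

lemma test_fun_prod_coords:
  fixes h :: "'n::finite \<Rightarrow> real \<Rightarrow> real"
  assumes "\<And>i. smooth_real (h i)"
    and out: "\<And>i s. s \<notin> {a $ i..b $ i} \<Longrightarrow> h i s = 0"
    and "cbox a b \<subseteq> \<Omega>"
  shows "test_fun \<Omega> (\<lambda>y. \<Prod>i\<in>UNIV. h i (y $ i))"
proof -
  have "{y. (\<Prod>i\<in>UNIV. h i (y $ i)) \<noteq> 0} \<subseteq> cbox a b"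
  proof
    fix y assume "y \<in> {y. (\<Prod>i\<in>UNIV. h i (y $ i)) \<noteq> 0}"
    then have "y $ i \<in> {a $ i..b $ i}" for i using out[of "y $ i" i] by (metis (mono_tags) UNIV_I finite mem_Collect_eq prod_zero)
    then show "y \<in> cbox a b" by (auto simp: mem_box_cart)
  qed
  then have "closure {y. (\<Prod>i\<in>UNIV. h i (y $ i)) \<noteq> 0} \<subseteq> cbox a b"
    by (rule closure_minimal) (rule closed_cbox)
  moreover from this have "compact (closure {y. (\<Prod>i\<in>UNIV. h i (y $ i)) \<noteq> 0})"
    by (rule compact_eq_bounded_closed[THEN iffD2, OF conjI[OF bounded_subset[OF bounded_cbox] closed_closure]])
  ultimately show ?thesis unfolding test_fun_def
    using assms(1,3) smooth_fun_prod_coords[of h] by (meson subset_trans)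
qed

section \<open>Weak-type estimates and Lebesgue points\<close>

text \<open>Jensen's inequality for \<open>x ^ n\<close> with weights \<open>G\<close>; the terms with \<open>G k = 0\<close> rely on \<open>0 / 0 = 0\<close>.\<close>
lemma power_sum_le_weighted:
  fixes a G :: "'k \<Rightarrow> real"
  assumes "finite K" and a: "\<And>k. k \<in> K \<Longrightarrow> 0 \<le> a k \<and> a k \<le> G k" and n: "n > 0"
  shows "(\<Sum>k\<in>K. a k) ^ n \<le> (\<Sum>k\<in>K. G k) ^ (n - 1) * (\<Sum>k\<in>K. a k ^ n / G k ^ (n - 1))"
proof -
  \<comment> \<open>Indices with \<open>G k = 0\<close> also have \<open>a k = 0\<close>, so nothing
    changes when the sums are restricted to indices that can supply weights G k / M and evaluation
    points a k / G k.\<close>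
  define L where "L = {k\<in>K. G k > 0}"
  define M where "M = (\<Sum>k\<in>L. G k)"
  have L: "finite L" "L \<subseteq> K" using assms by (auto simp: L_def)
  have z: "a k = 0" "G k = 0" if "k \<in> K - L" for k
    using a[of k] that by (auto simp: L_def)
  have sa: "(\<Sum>k\<in>K. a k) = (\<Sum>k\<in>L. a k)" and sG: "(\<Sum>k\<in>K. G k) = M"
    unfolding M_def using L z \<open>finite K\<close> by (auto intro!: sum.mono_neutral_right)
  have sn: "(\<Sum>k\<in>K. a k ^ n / G k ^ (n - 1)) = (\<Sum>k\<in>L. a k ^ n / G k ^ (n - 1))"
    using L z \<open>finite K\<close> n by (intro sum.mono_neutral_right) auto
  show ?thesis
  proof (cases "L = {}")
    case True
    then show ?thesis unfolding sa sn using n by (simp add: zero_power)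
  next
    case False
    have M: "M > 0" unfolding M_def using False L by (intro sum_pos) (auto simp: L_def)
    have cvx: "convex_on {0..} (\<lambda>x::real. x ^ n)"
      using convex_power_even[of n] convex_power_odd[of n] convex_on_subset[of UNIV _ "{0..}"]
      by (cases "even n") auto
    have "(\<Sum>k\<in>L. (G k / M) *\<^sub>R (a k / G k)) ^ n \<le> (\<Sum>k\<in>L. (G k / M) * (a k / G k) ^ n)"
      using convex_on_sum[OF L(1) False cvx, of "\<lambda>k. G k / M" "\<lambda>k. a k / G k"] M a L
      by (auto simp: L_def M_def sum_divide_distrib[symmetric] subset_iff)
    also have "(\<Sum>k\<in>L. (G k / M) *\<^sub>R (a k / G k)) = (\<Sum>k\<in>L. a k) / M"
      unfolding sum_divide_distrib by (intro sum.cong) (auto simp: L_def)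
    also have "(\<Sum>k\<in>L. (G k / M) * (a k / G k) ^ n) = (\<Sum>k\<in>L. a k ^ n / G k ^ (n - 1)) / M"
      unfolding sum_divide_distrib using n
      by (intro sum.cong) (auto simp: L_def power_divide power_eq_if[of _ n] split: if_splits)
    finally have "(\<Sum>k\<in>L. a k) ^ n / M ^ n \<le> (\<Sum>k\<in>L. a k ^ n / G k ^ (n - 1)) / M"
      by (simp add: power_divide)
    then have "(\<Sum>k\<in>L. a k) ^ n \<le> (\<Sum>k\<in>L. a k ^ n / G k ^ (n - 1)) / M * M ^ n"
      using M by (simp add: pos_divide_le_eq)
    also have "\<dots> = M ^ (n - 1) * (\<Sum>k\<in>L. a k ^ n / G k ^ (n - 1))"
      using M n by (simp add: power_eq_if[of M n])
    finally show ?thesis unfolding sa sG sn .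
  qed
qed

text \<open>Disjointness helps with measures, not with their roots. The weighted Jensen inequality
  with weights G k = |W k|^(1/n) produces the n-th powers |B i \<inter> W k|; summed over the
  disjoint sets these give at most |W k| = G k^n. One factor G k survives the division by G k^(n-1),
  and the total is the n-th power of the sum of the G k, however many sets there are.\<close>

lemma sum_power_radius_le:
  fixes W :: "nat \<Rightarrow> 'a::euclidean_space set"
  assumes I: "finite I" and n: "n > 0" and l: "l \<ge> 0"
    and B: "\<And>i. i \<in> I \<Longrightarrow> B i \<in> lmeasurable" and W: "\<And>k. W k \<in> lmeasurable"
    and disj: "pairwise (\<lambda>i j. disjnt (B i) (B j)) I"
    and r: "\<And>i. i \<in> I \<Longrightarrow> r i \<ge> 0"
    and bad: "\<And>i. i \<in> I \<Longrightarrow> \<exists>m. l * r i \<le> (\<Sum>k<m. root n (measure lebesgue (B i \<inter> W k)))"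
    and M: "\<And>m. (\<Sum>k<m. root n (measure lebesgue (W k))) \<le> M"
  shows "l ^ n * (\<Sum>i\<in>I. r i ^ n) \<le> M ^ n"
proof -
  define a where "a i k = root n (measure lebesgue (B i \<inter> W k))" for i k
  define G where "G k = root n (measure lebesgue (W k))" for k
  have a0: "0 \<le> a i k" and G0: "0 \<le> G k" for i k by (auto simp: a_def G_def intro!: real_root_ge_zero)
  have aG: "a i k \<le> G k" if "i \<in> I" for i k
    unfolding a_def G_def using n B[OF that] W
    by (auto intro!: measure_mono_fmeasurable simp: fmeasurableD)
  obtain mm where mm: "\<And>i. i \<in> I \<Longrightarrow> l * r i \<le> (\<Sum>k<mm i. a i k)"
    using bchoice[of I "\<lambda>i m. l * r i \<le> (\<Sum>k<m. a i k)"] bad unfolding a_def[symmetric] by auto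
  \<comment> \<open>Each set comes with its own number of levels; as there are finitely many sets
    and all terms are nonnegative, one common number works.\<close>
  obtain m where m: "\<And>i. i \<in> I \<Longrightarrow> mm i \<le> m"
    using I by (intro that[of "Max (mm ` I)"]) auto
  have "l * r i \<le> (\<Sum>k<m. a i k)" if "i \<in> I" for i
  proof -
    have "(\<Sum>k<mm i. a i k) \<le> (\<Sum>k<m. a i k)"
      using m[OF that] a0 by (intro sum_mono2) auto
    then show ?thesis using mm[OF that] by linarith
  qed
  then have le: "(l * r i) ^ n \<le> (\<Sum>k<m. a i k) ^ n" if "i \<in> I" for i
    using that l r by (intro power_mono) auto
  have "(\<Sum>i\<in>I. (l * r i) ^ n) \<le> (\<Sum>i\<in>I. (\<Sum>k<m. G k) ^ (n - 1) * (\<Sum>k<m. a i k ^ n / G k ^ (n - 1)))"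
  proof (rule sum_mono)
    fix i assume i: "i \<in> I"
    have "(\<Sum>k<m. a i k) ^ n \<le> (\<Sum>k<m. G k) ^ (n - 1) * (\<Sum>k<m. a i k ^ n / G k ^ (n - 1))"
      using a0 aG[OF i] n by (intro power_sum_le_weighted) auto
    then show "(l * r i) ^ n \<le> (\<Sum>k<m. G k) ^ (n - 1) * (\<Sum>k<m. a i k ^ n / G k ^ (n - 1))"
      using le[OF i] by linarith
  qed
  also have "\<dots> = (\<Sum>k<m. G k) ^ (n - 1) * (\<Sum>k<m. (\<Sum>i\<in>I. a i k ^ n) / G k ^ (n - 1))"
    by (simp add: sum_distrib_left sum_divide_distrib sum.swap[of _ I])
  also have "\<dots> \<le> (\<Sum>k<m. G k) ^ (n - 1) * (\<Sum>k<m. G k)"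
  proof (intro mult_left_mono sum_mono)
    fix k
    have "(\<Sum>i\<in>I. a i k ^ n) = (\<Sum>i\<in>I. measure lebesgue (B i \<inter> W k))"
      using n by (simp add: a_def)
    also have "\<dots> = measure lebesgue (\<Union>i\<in>I. B i \<inter> W k)"
    proof (rule measure_UNION'[symmetric])
      show "pairwise (\<lambda>i j. disjnt (B i \<inter> W k) (B j \<inter> W k)) I"
        using disj by (rule pairwise_mono) (auto simp: disjnt_def)
    qed (use I B W in auto)
    also have "\<dots> \<le> measure lebesgue (W k)"
      using B W I by (intro measure_mono_fmeasurable) (auto simp: fmeasurableD)
    also have "\<dots> = G k ^ n" using n by (simp add: G_def)
    also have "\<dots> = G k * G k ^ (n - 1)" using n by (simp add: power_eq_if[of _ n])
    finally show "(\<Sum>i\<in>I. a i k ^ n) / G k ^ (n - 1) \<le> G k"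
      using G0[of k] n by (cases "G k = 0") (auto simp: divide_le_eq zero_power power_0_left)
  qed (auto intro!: sum_nonneg zero_le_power G0)
  also have "\<dots> = (\<Sum>k<m. G k) ^ n" using n by (simp add: power_eq_if[of _ n])
  also have "\<dots> \<le> M ^ n" using M[of m] by (intro power_mono) (auto intro!: sum_nonneg G0 simp: G_def[symmetric])
  finally show ?thesis by (simp add: power_mult_distrib sum_distrib_left)
qed

text \<open>The weak-type estimate for the maximal function of the Lorentz seminorm, discretised into level
  sets \<open>W k\<close>; a single level set yields the Lebesgue density theorem.\<close>
lemma weak_type_cover:
  fixes W :: "nat \<Rightarrow> 'a::euclidean_space set"
  defines "n \<equiv> DIM('a)"
  assumes l: "l > 0" and W: "\<And>k. W k \<in> lmeasurable"
    and bad: "\<And>x d. x \<in> D \<Longrightarrow> d > 0 \<Longrightarrow>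
        \<exists>r>0. r < d \<and> (\<exists>m. l * r \<le> (\<Sum>k<m. root n (measure lebesgue (ball x r \<inter> W k))))"
    and M: "\<And>m. (\<Sum>k<m. root n (measure lebesgue (W k))) \<le> M"
  shows "\<exists>T. D \<subseteq> T \<and> T \<in> lmeasurable \<and> measure lebesgue T \<le> unit_ball_vol n * (M / l) ^ n"
proof -
  \<comment> \<open>Bad balls are indexed by centre and radius. The covering theorem asks only that
    every point of \<open>D\<close> lie in arbitrarily small members, which balls centred at that
    point provide.\<close>
  define K where "K = {(x, r). 0 < r \<and> (\<exists>m. l * r \<le> (\<Sum>k<m. root n (measure lebesgue (ball x r \<inter> W k))))}"
  have n: "n > 0" by (simp add: n_def)
  have "\<exists>i. i \<in> K \<and> x \<in> ball (fst i) (snd i) \<and> snd i < d" if "x \<in> D" "d > 0" for x d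
  proof -
    obtain r where "r > 0" "r < d" "\<exists>m. l * r \<le> (\<Sum>k<m. root n (measure lebesgue (ball x r \<inter> W k)))"
      using bad \<open>x \<in> D\<close> \<open>d > 0\<close> by blast
    then show ?thesis by (intro exI[of _ "(x, r)"]) (auto simp: K_def)
  qed
  then obtain C where C: "countable C" "C \<subseteq> K"
     "pairwise (\<lambda>i j. disjnt (ball (fst i) (snd i)) (ball (fst j) (snd j))) C"
     "negligible (D - (\<Union>i \<in> C. ball (fst i) (snd i)))"
    by (rule Vitali_covering_theorem_balls[where a = fst and r = snd and S = D and K = K])
  let ?V = "\<Union>i\<in>C. ball (fst i) (snd i)"
  have bnd: "measure lebesgue (\<Union>i\<in>I. ball (fst i) (snd i)) \<le> unit_ball_vol n * (M / l) ^ n"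
    if I: "I \<subseteq> C" "finite I" for I
  proof -
    have IK: "I \<subseteq> K" using I C by auto
    have "l ^ n * (\<Sum>i\<in>I. snd i ^ n) \<le> M ^ n"
    proof (rule sum_power_radius_le[where B = "\<lambda>i. ball (fst i) (snd i)" and W = W])
      show "pairwise (\<lambda>i j. disjnt (ball (fst i) (snd i)) (ball (fst j) (snd j))) I"
        using C(3) I by (meson pairwise_subset)
    qed (use I IK n l W M in \<open>auto simp: K_def\<close>)
    then have s: "(\<Sum>i\<in>I. snd i ^ n) \<le> (M / l) ^ n"
      using l by (simp add: power_divide field_simps)
    have "measure lebesgue (\<Union>i\<in>I. ball (fst i) (snd i)) \<le> (\<Sum>i\<in>I. measure lebesgue (ball (fst i) (snd i)))"
      using I by (intro measure_UNION_le) auto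
    also have "\<dots> = unit_ball_vol n * (\<Sum>i\<in>I. snd i ^ n)"
      unfolding sum_distrib_left
      using IK by (intro sum.cong) (auto simp: K_def content_ball n_def)
    also have "\<dots> \<le> unit_ball_vol n * (M / l) ^ n"
      using s by (intro mult_left_mono) auto
    finally show ?thesis .
  qed
  \<comment> \<open>Every finite subfamily obeys the same bound, so it passes to the countable
    union.\<close>
  have V: "?V \<in> lmeasurable" "measure lebesgue ?V \<le> unit_ball_vol n * (M / l) ^ n"
    using fmeasurable_UN_bound[OF C(1), of "\<lambda>i. ball (fst i) (snd i)" lebesgue "unit_ball_vol n * (M / l) ^ n"]
      measure_UN_bound[OF C(1), of "\<lambda>i. ball (fst i) (snd i)" lebesgue "unit_ball_vol n * (M / l) ^ n"] bnd
    by auto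
  \<comment> \<open>Vitali covers \<open>D\<close> only up to a null set; the remainder is added so
    that the final set contains all of \<open>D\<close>.\<close>
  let ?N = "D - ?V"
  have "measure lebesgue (?V \<union> ?N) = measure lebesgue ?V"
    using C(4) V by (intro measure_Un_null_set) (auto simp: negligible_iff_null_sets fmeasurableD)
  moreover have "?V \<union> ?N \<in> lmeasurable"
    using V C(4) by (intro fmeasurable.Un) (auto simp: negligible_imp_measurable)
  ultimately show ?thesis using V(2) by (intro exI[of _ "?V \<union> ?N"]) auto
qed

text \<open>Inside an open V containing A, small balls satisfy ball - A = ball \<inter> (V - A), and
  V - A can be given arbitrarily small measure by outer regularity. The weak-type estimate for this
  one set, with l the n-th root of \<epsilon>, bounds the bad points by a constant times |V - A| /
  \<epsilon>.\<close>

lemma AE_density: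
  fixes A :: "'a::euclidean_space set"
  assumes A: "A \<in> sets lebesgue" and e: "\<epsilon> > 0"
  shows "negligible {x\<in>A. \<not> (\<exists>d>0. \<forall>r. 0 < r \<and> r < d \<longrightarrow>
           measure lebesgue (ball x r - A) \<le> \<epsilon> * r ^ DIM('a))}"
  (is "negligible ?D")
  unfolding negligible_outer_le
proof (intro allI impI)
  fix e :: real assume "e > 0"
  define n where "n = DIM('a)"
  have n: "n > 0" by (simp add: n_def)
  \<comment> \<open>Chosen so that the final bound
    \<open>unit_ball_vol n * (\<eta> / \<epsilon>)\<close> equals the prescribed e.\<close>
  define \<eta> where "\<eta> = e * \<epsilon> / unit_ball_vol n"
  have "\<eta> > 0" using \<open>e > 0\<close> assms by (simp add: \<eta>_def)
  from sets_lebesgue_outer_open[OF A this] obtain V where V: "open V" "A \<subseteq> V" "V - A \<in> lmeasurable"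
      "emeasure lebesgue (V - A) < ennreal \<eta>" by blast
  have mV: "measure lebesgue (V - A) \<le> \<eta>"
    using V(3,4) \<open>\<eta> > 0\<close> by (simp add: emeasure_eq_measure2 ennreal_less_iff)
  define W where "W k = (if k = 0 then V - A else {})" for k :: nat
  have "\<exists>T. ?D \<subseteq> T \<and> T \<in> lmeasurable \<and>
      measure lebesgue T \<le> unit_ball_vol n * (root n (measure lebesgue (V - A)) / root n \<epsilon>) ^ n"
    unfolding n_def
  proof (rule weak_type_cover[where W = W])
    show "0 < root DIM('a) \<epsilon>" using e by simp
    show "W k \<in> lmeasurable" for k using V by (simp add: W_def)
    show "(\<Sum>k<m. root DIM('a) (measure lebesgue (W k))) \<le> root DIM('a) (measure lebesgue (V - A))" for m
    proof -
      have "(\<Sum>k<m. root DIM('a) (measure lebesgue (W k))) = (\<Sum>k<m. if k = 0 then root DIM('a) (measure lebesgue (V - A)) else 0)"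
        by (intro sum.cong) (auto simp: W_def)
      then show ?thesis by simp
    qed
    fix x d assume x: "x \<in> ?D" and d: "(d::real) > 0"
    obtain d' where d': "d' > 0" "ball x d' \<subseteq> V" using V x openE by blast
    have "\<not> (\<forall>r. 0 < r \<and> r < min d d' \<longrightarrow> measure lebesgue (ball x r - A) \<le> \<epsilon> * r ^ DIM('a))"
      using x d d' by (auto simp del: min_less_iff_conj)
    then obtain r where r: "r > 0" "r < d" "r < d'" "measure lebesgue (ball x r - A) > \<epsilon> * r ^ DIM('a)"
      by (auto simp: not_le)
    have eq: "ball x r - A = ball x r \<inter> W 0" using d' r by (auto simp: W_def)
    have "root DIM('a) \<epsilon> * r = root DIM('a) (\<epsilon> * r ^ DIM('a))"
      using r by (simp add: real_root_mult real_root_power_cancel)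
    also have "\<dots> \<le> root DIM('a) (measure lebesgue (ball x r \<inter> W 0))"
      using r by (simp add: eq)
    also have "\<dots> = (\<Sum>k<1. root DIM('a) (measure lebesgue (ball x r \<inter> W k)))" by simp
    finally show "\<exists>r>0. r < d \<and> (\<exists>m. root DIM('a) \<epsilon> * r \<le> (\<Sum>k<m. root DIM('a) (measure lebesgue (ball x r \<inter> W k))))"
      using r by blast
  qed
  then obtain T where T: "?D \<subseteq> T" "T \<in> lmeasurable"
      "measure lebesgue T \<le> unit_ball_vol n * (root n (measure lebesgue (V - A)) / root n \<epsilon>) ^ n" by blast
  note T(3)
  also have "unit_ball_vol n * (root n (measure lebesgue (V - A)) / root n \<epsilon>) ^ n
      = unit_ball_vol n * (measure lebesgue (V - A) / \<epsilon>)"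
    using n e by (simp add: power_divide)
  also have "\<dots> \<le> unit_ball_vol n * (\<eta> / \<epsilon>)"
    using mV e by (intro mult_left_mono divide_right_mono) auto
  also have "\<dots> = e" using e unit_ball_vol_pos[of n] by (simp add: \<eta>_def less_imp_neq[symmetric] del: unit_ball_vol_pos)
  finally show "\<exists>T. ?D \<subseteq> T \<and> T \<in> lmeasurable \<and> measure lebesgue T \<le> e" using T by blast
qed

text \<open>A point is exceptional only if every starting index S \<ge> S0 fails, so the weak-type
  bound, proportional to (M S / \<epsilon>)^n with M S the tail of a convergent series, may be used
  with S as large as desired. The lower bound S0 lets the levels later dominate the value of the
  function at the point under consideration; S itself may depend on that point.\<close>

lemma AE_small_tail:
  fixes W :: "nat \<Rightarrow> 'a::euclidean_space set"
  assumes W: "\<And>k. W k \<in> lmeasurable" and e: "\<epsilon> > 0"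
    and sm: "summable (\<lambda>k. root DIM('a) (measure lebesgue (W k)))"
  shows "negligible {x. \<not> (\<exists>S\<ge>S0. \<exists>d>0. \<forall>r m. 0 < r \<and> r < d \<longrightarrow>
           (\<Sum>k<m. root DIM('a) (measure lebesgue (ball x r \<inter> W (k + S)))) \<le> \<epsilon> * r)}"
  (is "negligible ?D")
  unfolding negligible_outer_le
proof (intro allI impI)
  fix e :: real assume "e > 0"
  define n where "n = DIM('a)"
  have n: "n > 0" by (simp add: n_def)
  define M where "M S = (\<Sum>k. root n (measure lebesgue (W (k + S))))" for S
  have M0: "M \<longlonglongrightarrow> 0"
    unfolding M_def n_def using suminf_exist_split2[OF sm] by simp
  have "(\<lambda>S. unit_ball_vol n * (M S / \<epsilon>) ^ n) \<longlonglongrightarrow> unit_ball_vol n * (0 / \<epsilon>) ^ n"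
    by (intro tendsto_intros M0) (use \<open>\<epsilon> > 0\<close> in auto)
  then have "(\<lambda>S. unit_ball_vol n * (M S / \<epsilon>) ^ n) \<longlonglongrightarrow> 0" using n by (simp add: zero_power)
  then have "\<forall>\<^sub>F S in sequentially. unit_ball_vol n * (M S / \<epsilon>) ^ n < e"
    using \<open>e > 0\<close> by (rule order_tendstoD)
  then obtain S1 where "\<And>S. S \<ge> S1 \<Longrightarrow> unit_ball_vol n * (M S / \<epsilon>) ^ n < e"
    unfolding eventually_sequentially by blast
  then obtain S where S: "S \<ge> S0" "unit_ball_vol n * (M S / \<epsilon>) ^ n < e"
    by (meson max.cobounded1 max.cobounded2)
  have "\<exists>T. ?D \<subseteq> T \<and> T \<in> lmeasurable \<and> measure lebesgue T \<le> unit_ball_vol n * (M S / \<epsilon>) ^ n"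
    unfolding n_def
  proof (rule weak_type_cover[where W = "\<lambda>k. W (k + S)"])
    show "(\<Sum>k<m. root DIM('a) (measure lebesgue (W (k + S)))) \<le> M S" for m
      unfolding M_def n_def using summable_ignore_initial_segment[OF sm, of S]
      by (intro sum_le_suminf) (auto intro!: real_root_ge_zero)
    fix x d assume x: "x \<in> ?D" and d: "(d::real) > 0"
    then obtain r m where "0 < r" "r < d" "\<not> (\<Sum>k<m. root DIM('a) (measure lebesgue (ball x r \<inter> W (k + S)))) \<le> \<epsilon> * r"
      using S(1) by blast
    then have "\<epsilon> * r \<le> (\<Sum>k<m. root DIM('a) (measure lebesgue (ball x r \<inter> W (k + S))))"
      by simp
    then show "\<exists>r>0. r < d \<and> (\<exists>m. \<epsilon> * r \<le> (\<Sum>k<m. root DIM('a) (measure lebesgue (ball x r \<inter> W (k + S)))))"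
      using \<open>0 < r\<close> \<open>r < d\<close> by blast
  qed (use W e in auto)
  then obtain T where "?D \<subseteq> T" "T \<in> lmeasurable" "measure lebesgue T \<le> unit_ball_vol n * (M S / \<epsilon>) ^ n"
    by blast
  then show "\<exists>T. ?D \<subseteq> T \<and> T \<in> lmeasurable \<and> measure lebesgue T \<le> e"
    using S(2) by (meson less_imp_le order_trans)
qed

text \<open>The range is cut into countably many slabs of height \<delta>; almost every point is a
  density point of the slab it lies in, and within a slab values differ by less than \<delta>.
  Points outside \<open>\<Omega>\<close> are counted as exceptional, so the estimate speaks about
  whole balls.\<close>

lemma AE_approx_continuous:
  fixes g :: "'a::euclidean_space \<Rightarrow> real"
  assumes \<Omega>: "open \<Omega>" and g: "g \<in> borel_measurable (restrict_space lebesgue \<Omega>)"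
    and d: "\<delta> > 0" and e: "\<epsilon> > 0"
  shows "negligible {x\<in>\<Omega>. \<not> (\<exists>d>0. \<forall>r. 0 < r \<and> r < d \<longrightarrow>
           measure lebesgue {y\<in>ball x r. y \<notin> \<Omega> \<or> \<bar>g y - g x\<bar> > \<delta>} \<le> \<epsilon> * r ^ DIM('a))}"
  (is "negligible ?D")
proof -
  define A where "A i = {y\<in>\<Omega>. of_int i * \<delta> \<le> g y \<and> g y < (of_int i + 1) * \<delta>}" for i :: int
  have O: "\<Omega> \<in> sets lebesgue" using \<Omega> by auto
  have A: "A i \<in> sets lebesgue" for i
  proof -
    have "{y\<in>space (restrict_space lebesgue \<Omega>). of_int i * \<delta> \<le> g y \<and> g y < (of_int i + 1) * \<delta>} \<in> sets (restrict_space lebesgue \<Omega>)"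
      using g by measurable
    then have "A i \<in> sets (restrict_space lebesgue \<Omega>)" by (simp add: A_def space_restrict_space)
    then show ?thesis using O by (simp add: sets_restrict_space_iff)
  qed
  define N where "N i = {x\<in>A i. \<not> (\<exists>d>0. \<forall>r. 0 < r \<and> r < d \<longrightarrow>
           measure lebesgue (ball x r - A i) \<le> \<epsilon> * r ^ DIM('a))}" for i
  have "negligible (\<Union>i. N i)"
    unfolding N_def using AE_density[OF A e] by (intro negligible_countable_Union) auto
  moreover have "?D \<subseteq> (\<Union>i. N i)"
  proof
    fix x assume x: "x \<in> ?D"
    define i where "i = \<lfloor>g x / \<delta>\<rfloor>"
    have "of_int i \<le> g x / \<delta>" "g x / \<delta> < of_int i + 1" by (auto simp: i_def)
    then have xA: "x \<in> A i" using x d by (auto simp: A_def field_simps)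
    have sub: "{y\<in>ball x r. y \<notin> \<Omega> \<or> \<bar>g y - g x\<bar> > \<delta>} \<subseteq> ball x r - A i" for r
      using xA d by (auto simp: A_def algebra_simps)
    have "x \<in> N i"
    proof (rule ccontr)
      assume "x \<notin> N i"
      then obtain d where dd: "d > 0" "\<And>r. 0 < r \<and> r < d \<Longrightarrow> measure lebesgue (ball x r - A i) \<le> \<epsilon> * r ^ DIM('a)"
        using xA by (auto simp: N_def)
      have "measure lebesgue {y\<in>ball x r. y \<notin> \<Omega> \<or> \<bar>g y - g x\<bar> > \<delta>} \<le> \<epsilon> * r ^ DIM('a)"
        if "0 < r \<and> r < d" for r
      proof -
        have "measure lebesgue {y\<in>ball x r. y \<notin> \<Omega> \<or> \<bar>g y - g x\<bar> > \<delta>} \<le> measure lebesgue (ball x r - A i)"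
        proof (rule measure_mono_fmeasurable[OF sub])
          have "{y\<in>space (restrict_space lebesgue \<Omega>). \<bar>g y - g x\<bar> \<le> \<delta>} \<in> sets (restrict_space lebesgue \<Omega>)"
            using g by measurable
          then have "{y\<in>\<Omega>. \<bar>g y - g x\<bar> \<le> \<delta>} \<in> sets lebesgue"
            using O by (simp add: sets_restrict_space_iff space_restrict_space)
          moreover have "{y\<in>ball x r. y \<notin> \<Omega> \<or> \<bar>g y - g x\<bar> > \<delta>} = ball x r - {y\<in>\<Omega>. \<bar>g y - g x\<bar> \<le> \<delta>}" by auto
          ultimately show "{y\<in>ball x r. y \<notin> \<Omega> \<or> \<bar>g y - g x\<bar> > \<delta>} \<in> sets lebesgue" by auto
          show "ball x r - A i \<in> lmeasurable" using A by (intro fmeasurable_Diff) auto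
        qed
        then show ?thesis using dd(2)[OF that] by linarith
      qed
      then show False using x dd(1) by blast
    qed
    then show "x \<in> (\<Union>i. N i)" by blast
  qed
  ultimately show ?thesis by (rule negligible_subset)
qed

section \<open>Riesz potentials and the Lorentz seminorm\<close>

text \<open>The kernel |y - z|^(1-n) of the Riesz potential of order one. At y = z division by zero
  gives 0 for n > 1, and 1 / 0^0 = 1 for n = 1.\<close>

definition riesz_kernel :: "'a::euclidean_space \<Rightarrow> 'a \<Rightarrow> real" where
  "riesz_kernel z y = 1 / norm (y - z) ^ (DIM('a) - 1)"

lemma riesz_kernel_nonneg [simp]: "riesz_kernel z y \<ge> 0"
  by (simp add: riesz_kernel_def)

lemma riesz_kernel_measurable [measurable]: "riesz_kernel z \<in> borel_measurable borel"
  unfolding riesz_kernel_def[abs_def] by measurable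

lemma emeasure_lborel_ball:
  fixes z :: "'a::euclidean_space"
  assumes "r \<ge> 0"
  shows "emeasure lborel (ball z r) = ennreal (unit_ball_vol DIM('a) * r ^ DIM('a))"
  using assms by (rule emeasure_ball)

text \<open>On the dyadic shell between \<rho> / 2^(k+1) and \<rho> / 2^k the kernel is at most
  \<open>c k\<close>. Enlarging shells to balls costs only a constant: the k-th term is proportional
  to 2^(-k), so the series is geometric with sum proportional to \<rho>.\<close>

lemma nn_integral_riesz_kernel_ball:
  fixes z :: "'a::euclidean_space"
  assumes \<rho>: "\<rho> > 0"
  shows "(\<integral>\<^sup>+ y. ennreal (riesz_kernel z y) * indicator (ball z \<rho>) y \<partial>lborel)
           \<le> ennreal (unit_ball_vol DIM('a) * 2 ^ DIM('a) * \<rho>)"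
proof -
  define n where "n = DIM('a)"
  have n: "n > 0" by (simp add: n_def)
  have nS: "Suc (n - 1) = n" using n by simp
  define c where "c k = (2 ^ Suc k / \<rho>) ^ (n - 1)" for k :: nat
  have c0: "c k \<ge> 0" for k using \<rho> by (simp add: c_def)
  have pw: "ennreal (riesz_kernel z y) * indicator (ball z \<rho>) y
      \<le> (\<Sum>k. ennreal (c k) * indicator (ball z (\<rho> / 2 ^ k)) y)" for y
  proof (cases "y \<in> ball z \<rho>")
    case False then show ?thesis by simp
  next
    case True
    have "\<exists>k. riesz_kernel z y \<le> c k \<and> y \<in> ball z (\<rho> / 2 ^ k)"
    proof (cases "y = z")
      case True
      have "riesz_kernel z y \<le> c 0"
        using True \<rho> by (cases "n = 1") (auto simp: riesz_kernel_def c_def n_def power_0_left)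
      then show ?thesis using True \<rho> by (intro exI[of _ 0]) auto
    next
      case False
      define t where "t = norm (y - z)"
      have t: "t > 0" "t < \<rho>" using False True by (auto simp: t_def dist_norm norm_minus_commute)
      have "(\<lambda>k. \<rho> * (1 / 2) ^ k) \<longlonglongrightarrow> \<rho> * 0"
        by (intro tendsto_intros LIMSEQ_realpow_zero) auto
      then have "\<forall>\<^sub>F k in sequentially. \<rho> * (1 / 2) ^ k < t"
        using t by (intro order_tendstoD) auto
      then obtain k0 where "\<rho> * (1 / 2) ^ k0 < t"
        by (auto simp: eventually_sequentially)
      then have k0: "\<rho> / 2 ^ k0 \<le> t" by (simp add: power_one_over)
      \<comment> \<open>The first dyadic radius not exceeding t gives the kernel bound; its
        predecessor exceeds t and so gives the ball that contains y.\<close>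
      define k where "k = (LEAST k. \<rho> / 2 ^ k \<le> t)"
      have k: "\<rho> / 2 ^ k \<le> t" unfolding k_def using k0 by (rule LeastI)
      have "k \<noteq> 0" using k t by (cases k) auto
      then obtain j where j: "k = Suc j" by (cases k) auto
      have "\<not> \<rho> / 2 ^ j \<le> t" using not_less_Least[of j "\<lambda>k. \<rho> / 2 ^ k \<le> t"] j by (simp add: k_def)
      then have "y \<in> ball z (\<rho> / 2 ^ j)"
        by (simp add: t_def dist_norm norm_minus_commute)
      moreover have "1 / t \<le> 2 ^ Suc j / \<rho>"
        using k t \<rho> unfolding j by (simp add: field_simps)
      then have "(1 / t) ^ (n - 1) \<le> c j"
        unfolding c_def using t by (intro power_mono) auto
      then have "riesz_kernel z y \<le> c j"
        by (simp add: riesz_kernel_def n_def t_def power_one_over)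
      ultimately show ?thesis by blast
    qed
    then obtain k where k: "riesz_kernel z y \<le> c k" "y \<in> ball z (\<rho> / 2 ^ k)" by blast
    have "ennreal (riesz_kernel z y) * indicator (ball z \<rho>) y
       \<le> ennreal (c k) * indicator (ball z (\<rho> / 2 ^ k)) y"
      using k True by (simp add: ennreal_leI)
    also have "\<dots> \<le> (\<Sum>k. ennreal (c k) * indicator (ball z (\<rho> / 2 ^ k)) y)"
    proof -
      have "(\<Sum>i\<in>{k}. F i) \<le> suminf F" for F :: "nat \<Rightarrow> ennreal"
        by (rule sum_le_suminf) auto
      then show ?thesis by (simp del: sum_mult_indicator)
    qed
    finally show ?thesis .
  qed
  have term_eq: "c k * (unit_ball_vol n * (\<rho> / 2 ^ k) ^ n) = unit_ball_vol n * \<rho> * 2 ^ (n - 1) * (1 / 2) ^ k" for k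
  proof -
    have "(\<rho> / 2 ^ k) ^ n = (\<rho> / 2 ^ k) ^ (n - 1) * (\<rho> / 2 ^ k)"
      using power_Suc2[of "\<rho> / 2 ^ k" "n - 1"] nS by simp
    then have "c k * (unit_ball_vol n * (\<rho> / 2 ^ k) ^ n)
        = unit_ball_vol n * (c k * (\<rho> / 2 ^ k) ^ (n - 1)) * (\<rho> / 2 ^ k)"
      by (simp only: mult_ac)
    also have "c k * (\<rho> / 2 ^ k) ^ (n - 1) = 2 ^ (n - 1)"
      using \<rho> by (simp add: c_def power_mult_distrib[symmetric])
    finally show ?thesis by (simp add: power_one_over)
  qed
  have "(\<integral>\<^sup>+ y. ennreal (riesz_kernel z y) * indicator (ball z \<rho>) y \<partial>lborel)
      \<le> (\<integral>\<^sup>+ y. (\<Sum>k. ennreal (c k) * indicator (ball z (\<rho> / 2 ^ k)) y) \<partial>lborel)"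
    by (intro nn_integral_mono pw)
  also have "\<dots> = (\<Sum>k. \<integral>\<^sup>+ y. ennreal (c k) * indicator (ball z (\<rho> / 2 ^ k)) y \<partial>lborel)"
    by (intro nn_integral_suminf borel_measurable_times_ennreal borel_measurable_const borel_measurable_indicator) auto
  also have "\<dots> = (\<Sum>k. ennreal (unit_ball_vol n * \<rho> * 2 ^ (n - 1) * (1 / 2) ^ k))"
  proof (rule suminf_cong)
    fix k
    have "(\<integral>\<^sup>+ y. ennreal (c k) * indicator (ball z (\<rho> / 2 ^ k)) y \<partial>lborel)
       = ennreal (c k) * ennreal (unit_ball_vol n * (\<rho> / 2 ^ k) ^ n)"
      using \<rho> by (simp add: nn_integral_cmult_indicator emeasure_lborel_ball n_def)
    also have "\<dots> = ennreal (unit_ball_vol n * \<rho> * 2 ^ (n - 1) * (1 / 2) ^ k)"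
      using c0 \<rho> by (simp add: ennreal_mult'[symmetric] term_eq)
    finally show "(\<integral>\<^sup>+ y. ennreal (c k) * indicator (ball z (\<rho> / 2 ^ k)) y \<partial>lborel) = \<dots>" .
  qed
  also have "\<dots> = ennreal (unit_ball_vol n * \<rho> * 2 ^ (n - 1) * 2)"
  proof (rule suminf_ennreal_eq)
    show "(\<lambda>k. unit_ball_vol n * \<rho> * 2 ^ (n - 1) * (1 / 2) ^ k) sums (unit_ball_vol n * \<rho> * 2 ^ (n - 1) * 2)"
      using geometric_sums[of "1 / 2 :: real"] by (intro sums_mult) simp
  qed (use \<rho> in auto)
  also have "unit_ball_vol n * \<rho> * 2 ^ (n - 1) * 2 = unit_ball_vol n * 2 ^ n * \<rho>"
    using power_Suc2[of "2::real" "n - 1"] nS by simp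
  finally show ?thesis by (simp add: n_def)
qed

text \<open>Split at the radius \<rho> with \<rho>^n = |A|: the near part is at most the integral
  over the ball, the far part at most \<rho>^(1-n) |A| = \<rho>, whence the summand 1 in the
  constant. A null set is treated apart because \<rho> would be 0.\<close>

lemma nn_integral_riesz_kernel_le:
  fixes z :: "'a::euclidean_space"
  assumes A: "A \<in> lmeasurable"
  shows "(\<integral>\<^sup>+ y. ennreal (riesz_kernel z y) * indicator A y \<partial>lebesgue)
           \<le> ennreal ((unit_ball_vol DIM('a) * 2 ^ DIM('a) + 1) * root DIM('a) (measure lebesgue A))"
proof (cases "measure lebesgue A = 0")
  case True
  then have "A \<in> null_sets lebesgue" using A by (auto intro!: null_setsI simp: emeasure_eq_measure2 fmeasurableD)
  then have ae: "AE y in lebesgue. y \<notin> A" by (rule AE_not_in)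
  have "(\<integral>\<^sup>+ y. ennreal (riesz_kernel z y) * indicator A y \<partial>lebesgue) = (\<integral>\<^sup>+ (y::'a). 0 \<partial>lebesgue)"
    by (rule nn_integral_cong_AE) (use ae in eventually_elim, simp)
  then show ?thesis by simp
next
  case False
  define n where "n = DIM('a)"
  have n: "n > 0" by (simp add: n_def)
  define m where "m = measure lebesgue A"
  have m: "m > 0" using False by (simp add: m_def zero_less_measure_iff)
  define \<rho> where "\<rho> = root n m"
  have \<rho>: "\<rho> > 0" using m n by (simp add: \<rho>_def)
  have \<rho>n: "\<rho> ^ n = m" using m n by (simp add: \<rho>_def)
  have "(\<integral>\<^sup>+ y. ennreal (riesz_kernel z y) * indicator A y \<partial>lebesgue)
     \<le> (\<integral>\<^sup>+ y. ennreal (riesz_kernel z y) * indicator (ball z \<rho>) y + ennreal (1 / \<rho> ^ (n - 1)) * indicator A y \<partial>lebesgue)"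
  proof (rule nn_integral_mono)
    fix y
    show "ennreal (riesz_kernel z y) * indicator A y \<le>
        ennreal (riesz_kernel z y) * indicator (ball z \<rho>) y + ennreal (1 / \<rho> ^ (n - 1)) * indicator A y"
    proof (cases "y \<in> ball z \<rho>")
      case False
      then have "norm (y - z) \<ge> \<rho>" by (simp add: dist_norm norm_minus_commute)
      then have "riesz_kernel z y \<le> 1 / \<rho> ^ (n - 1)"
        unfolding riesz_kernel_def n_def using \<rho>
        by (intro divide_left_mono power_mono mult_pos_pos zero_less_power) auto
      then show ?thesis using False by (auto simp: indicator_def ennreal_leI)
    qed (auto simp: indicator_def)
  qed
  also have "\<dots> = (\<integral>\<^sup>+ y. ennreal (riesz_kernel z y) * indicator (ball z \<rho>) y \<partial>lebesgue)
      + (\<integral>\<^sup>+ y. ennreal (1 / \<rho> ^ (n - 1)) * indicator A y \<partial>lebesgue)"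
  proof (intro nn_integral_add borel_measurable_times_ennreal borel_measurable_const borel_measurable_indicator)
    show "(\<lambda>y. ennreal (riesz_kernel z y)) \<in> borel_measurable lebesgue"
      by (rule measurable_completion) measurable
  qed (use A in \<open>auto simp: fmeasurableD\<close>)
  also have "(\<integral>\<^sup>+ y. ennreal (1 / \<rho> ^ (n - 1)) * indicator A y \<partial>lebesgue) = ennreal (1 / \<rho> ^ (n - 1)) * ennreal m"
    using A by (simp add: nn_integral_cmult_indicator fmeasurableD emeasure_eq_measure2 m_def)
  also have "\<dots> = ennreal \<rho>"
  proof -
    have "\<rho> ^ n = \<rho> ^ (n - 1) * \<rho>" using power_Suc2[of \<rho> "n - 1"] n by simp
    then have "1 / \<rho> ^ (n - 1) * m = \<rho>" using \<rho>n \<rho> by (simp add: field_simps)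
    then show ?thesis using m \<rho> by (simp add: ennreal_mult'[symmetric])
  qed
  also have "(\<integral>\<^sup>+ y. ennreal (riesz_kernel z y) * indicator (ball z \<rho>) y \<partial>lebesgue)
      \<le> ennreal (unit_ball_vol n * 2 ^ n * \<rho>)"
    unfolding nn_integral_completion n_def by (rule nn_integral_riesz_kernel_ball[OF \<rho>])
  finally have "(\<integral>\<^sup>+ y. ennreal (riesz_kernel z y) * indicator A y \<partial>lebesgue)
      \<le> ennreal (unit_ball_vol n * 2 ^ n * \<rho>) + ennreal \<rho>"
    by (simp add: add_right_mono)
  also have "\<dots> = ennreal ((unit_ball_vol n * 2 ^ n + 1) * \<rho>)"
    using \<rho> by (simp add: ennreal_plus[symmetric] distrib_right del: ennreal_plus)
  finally show ?thesis by (simp add: n_def \<rho>_def m_def)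
qed

text \<open>The primitive is -(t / n) s^(-n), evaluated from t / b to infinity. This is where the
  power t^(1-n) of the Riesz kernel arises from an integral over scales.\<close>

lemma nn_integral_scale_kernel:
  fixes t b :: real
  assumes t: "t > 0" and b: "b > 0" and n: "n > 0"
  shows "(\<integral>\<^sup>+ s. ennreal (t / s ^ Suc n) * indicator {t / b..} s \<partial>lborel)
      = ennreal (b ^ n / real n * (1 / t ^ (n - 1)))"
proof -
  have c: "t / b > 0" using t b by simp
  define F where "F s = - (t / real n) * inverse (s ^ n)" for s :: real
  have "(\<integral>\<^sup>+ s. ennreal (t / s ^ Suc n) * indicator {t / b..} s \<partial>lborel) = ennreal (0 - F (t / b))"
  proof (rule nn_integral_FTC_atLeast)
    show "(\<lambda>s. t / s ^ Suc n) \<in> borel_measurable borel" by measurable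
    show "DERIV F s :> t / s ^ Suc n" if "t / b \<le> s" for s
    proof -
      have s: "s > 0" using that c by linarith
      have "((\<lambda>s. inverse (s ^ n)) has_real_derivative - (real n * s ^ (n - 1)) / (s ^ n)\<^sup>2) (at s)"
        using s by (auto intro!: derivative_eq_intros simp: power2_eq_square field_simps)
      then have "DERIV F s :> - (t / real n) * (- (real n * s ^ (n - 1)) / (s ^ n)\<^sup>2)"
        unfolding F_def[abs_def] by (rule DERIV_cmult)
      also have "- (t / real n) * (- (real n * s ^ (n - 1)) / (s ^ n)\<^sup>2) = t / s ^ Suc n"
      proof -
        obtain k where k: "n = Suc k" using n by (cases n) auto
        have "- (t / real n) * (- (real n * s ^ (n - 1)) / (s ^ n)\<^sup>2) = t * (s ^ k / (s ^ Suc k)\<^sup>2)"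
          using n by (simp add: k del: of_nat_Suc)
        also have "\<dots> = t / s ^ Suc n" using s by (simp add: k power2_eq_square)
        finally show ?thesis .
      qed
      finally show ?thesis .
    qed
    show "0 \<le> t / s ^ Suc n" if "t / b \<le> s" for s
      using that c t by (intro divide_nonneg_nonneg zero_le_power) auto
    have "((\<lambda>s. inverse (s ^ n) :: real) \<longlongrightarrow> 0) at_top"
      using n by (intro tendsto_inverse_0_at_top filterlim_pow_at_top filterlim_ident) auto
    then show "(F \<longlongrightarrow> 0) at_top" unfolding F_def[abs_def] by (rule tendsto_mult_right_zero)
  qed
  also have "0 - F (t / b) = b ^ n / real n * (1 / t ^ (n - 1))"
  proof -
    obtain k where k: "n = Suc k" using n by (cases n) auto
    show ?thesis using t b by (simp add: F_def k power_divide del: of_nat_Suc)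
  qed
  finally show ?thesis .
qed

text \<open>Tonelli: for fixed y the condition |y - z| \<le> b s says s \<ge> |y - z| / b, so the
  integral over scales is explicit. At y = z the factor \<open>norm (y - z)\<close> makes the
  integrand 0.\<close>

lemma nn_integral_scales_le_riesz:
  fixes z :: "'a::euclidean_space" and \<gamma> :: "'a \<Rightarrow> ennreal"
  assumes \<gamma>: "\<gamma> \<in> borel_measurable lebesgue" and b: "b > 0"
  shows "(\<integral>\<^sup>+ s. (\<integral>\<^sup>+ y. \<gamma> y * ennreal (norm (y - z) / s ^ Suc DIM('a)) * indicator {y. norm (y - z) \<le> b * s} y \<partial>lebesgue)
             * indicator {0<..} s \<partial>lborel)
       \<le> ennreal (b ^ DIM('a) / DIM('a)) * (\<integral>\<^sup>+ y. \<gamma> y * ennreal (riesz_kernel z y) \<partial>lebesgue)"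
proof -
  define n where "n = DIM('a)"
  have n: "n > 0" by (simp add: n_def)
  \<comment> \<open>\<open>\<gamma>\<close> is only Lebesgue measurable, while the integrals are
    interchanged on \<open>lborel\<close>; a Borel function that agrees with it almost everywhere
    stands in.\<close>
  obtain \<gamma>' where \<gamma>'[measurable]: "\<gamma>' \<in> borel_measurable lborel" and ae: "AE y in lborel. \<gamma> y = \<gamma>' y"
    using completion_ex_borel_measurable[OF \<gamma>] by blast
  let ?k = "\<lambda>s y. ennreal (norm (y - z) / s ^ Suc n) * indicator {y. norm (y - z) \<le> b * s} y"
  have "(\<integral>\<^sup>+ s. (\<integral>\<^sup>+ y. \<gamma> y * ennreal (norm (y - z) / s ^ Suc n) * indicator {y. norm (y - z) \<le> b * s} y \<partial>lebesgue)
             * indicator {0<..} s \<partial>lborel)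
      = (\<integral>\<^sup>+ s. (\<integral>\<^sup>+ y. \<gamma>' y * ?k s y * indicator {0<..} s \<partial>lborel) \<partial>lborel)"
  proof (rule nn_integral_cong)
    fix s :: real
    have "(\<integral>\<^sup>+ y. \<gamma> y * ennreal (norm (y - z) / s ^ Suc n) * indicator {y. norm (y - z) \<le> b * s} y \<partial>lebesgue)
        = (\<integral>\<^sup>+ y. \<gamma>' y * ?k s y \<partial>lborel)"
      unfolding nn_integral_completion
      by (rule nn_integral_cong_AE) (use ae in eventually_elim, simp add: mult_ac)
    then show "(\<integral>\<^sup>+ y. \<gamma> y * ennreal (norm (y - z) / s ^ Suc n) * indicator {y. norm (y - z) \<le> b * s} y \<partial>lebesgue)
         * indicator {0<..} s = (\<integral>\<^sup>+ y. \<gamma>' y * ?k s y * indicator {0<..} s \<partial>lborel)"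
      by (simp add: nn_integral_multc)
  qed
  also have "\<dots> = (\<integral>\<^sup>+ y. (\<integral>\<^sup>+ s. \<gamma>' y * ?k s y * indicator {0<..} s \<partial>lborel) \<partial>lborel)"
    by (rule lborel_pair.Fubini') measurable
  also have "\<dots> \<le> (\<integral>\<^sup>+ y. ennreal (b ^ n / n) * (\<gamma> y * ennreal (riesz_kernel z y)) \<partial>lborel)"
  proof (rule nn_integral_mono_AE, use ae in eventually_elim)
    fix y assume y: "\<gamma> y = \<gamma>' y"
    show "(\<integral>\<^sup>+ s. \<gamma>' y * ?k s y * indicator {0<..} s \<partial>lborel) \<le> ennreal (b ^ n / n) * (\<gamma> y * ennreal (riesz_kernel z y))"
    proof (cases "y = z")
      case True then show ?thesis by simp
    next
      case False
      then have t: "norm (y - z) > 0" by simp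
      have "(\<integral>\<^sup>+ s. \<gamma>' y * ?k s y * indicator {0<..} s \<partial>lborel)
         \<le> (\<integral>\<^sup>+ s. \<gamma> y * (ennreal (norm (y - z) / s ^ Suc n) * indicator {norm (y - z) / b..} s) \<partial>lborel)"
        unfolding y using b
        by (intro nn_integral_mono) (auto simp: indicator_def field_simps mult_ac)
      also have "\<dots> = \<gamma> y * ennreal (b ^ n / real n * (1 / norm (y - z) ^ (n - 1)))"
      proof -
        have "(\<lambda>s. ennreal (norm (y - z) / s ^ Suc n) * indicator {norm (y - z) / b..} s) \<in> borel_measurable lborel"
          by measurable
        from nn_integral_cmult[OF this] show ?thesis by (simp only: nn_integral_scale_kernel[OF t b n])
      qed
      also have "\<dots> = ennreal (b ^ n / n) * (\<gamma> y * ennreal (riesz_kernel z y))"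
        using b by (subst ennreal_mult) (auto simp: riesz_kernel_def n_def mult_ac)
      finally show ?thesis .
    qed
  qed
  also have "\<dots> = (\<integral>\<^sup>+ y. ennreal (b ^ n / n) * (\<gamma> y * ennreal (riesz_kernel z y)) \<partial>lebesgue)"
    by (simp add: nn_integral_completion)
  also have "\<dots> = ennreal (b ^ n / n) * (\<integral>\<^sup>+ y. \<gamma> y * ennreal (riesz_kernel z y) \<partial>lebesgue)"
  proof (rule nn_integral_cmult)
    have "(\<lambda>y. ennreal (riesz_kernel z y)) \<in> borel_measurable lebesgue"
      by (rule measurable_completion) measurable
    with \<gamma> show "(\<lambda>y. \<gamma> y * ennreal (riesz_kernel z y)) \<in> borel_measurable lebesgue"
      by (rule borel_measurable_times_ennreal)
  qed
  finally show ?thesis by (simp add: n_def)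
qed

text \<open>The distribution function is nonincreasing, so on (k/2, (k+1)/2] the Lorentz integrand
  is at least its value at (k+1)/2, and half the sum over the levels beyond 0 is bounded by the
  integral. Level 0 is finite because \<open>\<Omega>\<close> has finite measure. The spacing 1/2
  will absorb the shift from \<open>g\<close> to \<open>g - a\<close>.\<close>

lemma lorentz_N1_summable:
  fixes f :: "real^'n::finite \<Rightarrow> real"
  assumes f: "lorentz_N1 \<Omega> f" and \<Omega>: "\<Omega> \<in> lmeasurable"
  shows "{y\<in>\<Omega>. \<bar>f y\<bar> \<ge> s} \<in> lmeasurable"
    and "summable (\<lambda>k. root CARD('n) (measure lebesgue {y\<in>\<Omega>. \<bar>f y\<bar> \<ge> real k / 2}))"
proof -
  let ?A = "\<lambda>s. {y\<in>\<Omega>. \<bar>f y\<bar> \<ge> s}"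
  have fm: "f \<in> borel_measurable (restrict_space lebesgue \<Omega>)" using f by (simp add: lorentz_N1_def)
  have A: "?A s \<in> lmeasurable" for s
  proof -
    have "{y\<in>space (restrict_space lebesgue \<Omega>). \<bar>f y\<bar> \<ge> s} \<in> sets (restrict_space lebesgue \<Omega>)"
      using fm by measurable
    then have "?A s \<in> sets lebesgue"
      using \<Omega> by (simp add: sets_restrict_space_iff space_restrict_space fmeasurableD)
    then show ?thesis using \<Omega> by (rule fmeasurableI2[rotated 2]) auto
  qed
  then show "?A s \<in> lmeasurable" .
  define v where "v s = ennreal (root CARD('n) (measure lebesgue (?A s)))" for s
  have v: "(let m = emeasure lebesgue (?A s) in
                 if m = \<infinity> then \<infinity> else ennreal (enn2real m powr (1 / real CARD('n)))) = v s" for s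
  proof -
    have "measure lebesgue (?A s) powr (1 / real CARD('n)) = root CARD('n) (measure lebesgue (?A s))"
      by (cases "measure lebesgue (?A s) = 0") (auto simp: root_powr_inverse less_le)
    then show ?thesis using A[of s] by (simp add: v_def Let_def emeasure_eq_measure2)
  qed
  define I where "I = (\<integral>\<^sup>+ s. v s * indicator {0..} s \<partial>lborel)"
  have I: "I < \<infinity>" using f unfolding lorentz_N1_def v I_def by simp
  define c where "c k = root CARD('n) (measure lebesgue (?A (real k / 2)))" for k
  have c0: "c k \<ge> 0" for k by (simp add: c_def)
  define J where "J k = {real k / 2<..real (Suc k) / 2}" for k
  have part: "(\<Sum>k<m. c (Suc k)) \<le> 2 * enn2real I" for m
  proof -
    have dis: "disjoint_family_on J {..<m}"
      unfolding disjoint_family_on_def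
    proof (intro ballI impI)
      fix i j :: nat assume "i \<noteq> j"
      then consider "Suc i \<le> j" | "Suc j \<le> i" by linarith
      then show "J i \<inter> J j = {}"
        by cases (auto simp: J_def)
    qed
    have "ennreal (\<Sum>k<m. c (Suc k) / 2) = (\<Sum>k<m. ennreal (c (Suc k)) * emeasure lborel (J k))"
    proof -
      have eJ: "emeasure lborel (J k) = ennreal (1 / 2)" for k
        by (simp add: J_def add_divide_distrib)
      have "ennreal (c (Suc k) / 2) = ennreal (c (Suc k)) * ennreal (1 / 2)" for k
        using c0 by (subst ennreal_mult[symmetric]) auto
      then show ?thesis unfolding eJ using c0
        by (simp only: sum_ennreal[symmetric] divide_nonneg_nonneg zero_le_numeral)
    qed
    also have "\<dots> = (\<integral>\<^sup>+ s. (\<Sum>k<m. ennreal (c (Suc k)) * indicator (J k) s) \<partial>lborel)"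
      by (subst nn_integral_sum) (auto simp: J_def nn_integral_cmult_indicator)
    also have "\<dots> \<le> (\<integral>\<^sup>+ s. v s * indicator {0..} s \<partial>lborel)"
    proof (rule nn_integral_mono)
      fix s
      have "(\<Sum>k<m. ennreal (c (Suc k)) * indicator (J k) s) \<le> (\<Sum>k<m. v s * indicator (J k) s)"
      proof (rule sum_mono)
        fix k
        have "c (Suc k) \<le> root CARD('n) (measure lebesgue (?A s))" if "s \<in> J k"
        proof -
          have "measure lebesgue (?A (real (Suc k) / 2)) \<le> measure lebesgue (?A s)"
            by (rule measure_mono_fmeasurable[OF _ fmeasurableD[OF A] A]) (use that in \<open>auto simp: J_def\<close>)
          then show ?thesis unfolding c_def by (intro real_root_le_mono) auto
        qed
        then show "ennreal (c (Suc k)) * indicator (J k) s \<le> v s * indicator (J k) s"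
          by (auto simp: indicator_def v_def ennreal_leI)
      qed
      also have "\<dots> = v s * indicator (\<Union>k<m. J k) s"
        using dis by (simp add: sum_distrib_left[symmetric] indicator_UN_disjoint)
      also have "\<dots> \<le> v s * indicator {0..} s"
        by (intro mult_left_mono) (auto simp: indicator_def J_def)
      finally show "(\<Sum>k<m. ennreal (c (Suc k)) * indicator (J k) s) \<le> v s * indicator {0..} s" .
    qed
    finally have "ennreal (\<Sum>k<m. c (Suc k) / 2) \<le> I" by (simp add: I_def)
    then have "(\<Sum>k<m. c (Suc k) / 2) \<le> enn2real I"
    proof -
      have "I = ennreal (enn2real I)" using I by simp
      then have "ennreal (\<Sum>k<m. c (Suc k) / 2) \<le> ennreal (enn2real I)"
        using \<open>ennreal (\<Sum>k<m. c (Suc k) / 2) \<le> I\<close> by simp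
      then show ?thesis by (subst (asm) ennreal_le_iff) auto
    qed
    then show ?thesis by (simp add: sum_divide_distrib[symmetric])
  qed
  have "summable (\<lambda>k. c (Suc k))"
    using part c0 by (intro summableI_nonneg_bounded[where x = "2 * enn2real I"]) auto
  then show "summable (\<lambda>k. root CARD('n) (measure lebesgue (?A (real k / 2))))"
    unfolding c_def[symmetric] by (subst (asm) summable_Suc_iff)
qed

section \<open>Averages at variable scale\<close>

text \<open>A one-dimensional kernel centred at z + \<tau> e with half-width \<tau>. Its mass is not
  normalised to 1; the mass of the n-dimensional product is carried along as a constant
  instead.\<close>

definition mol :: "real \<Rightarrow> real \<Rightarrow> real \<Rightarrow> real \<Rightarrow> real" where
  "mol \<tau> z e s = bump 0 1 ((s - z) / \<tau> - e) / \<tau>"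

text \<open>\<open>fld\<close> is chosen such that the \<open>s\<close>-derivative \<open>dfld\<close> of \<open>fld\<close> is minus the \<open>\<tau>\<close>-derivative of \<open>mol\<close>;
  this turns the scale derivative of an average into a divergence.\<close>
definition fld :: "real \<Rightarrow> real \<Rightarrow> real \<Rightarrow> real \<Rightarrow> real" where
  "fld \<tau> z e s = (s - z) / \<tau> * mol \<tau> z e s"

definition dfld :: "real \<Rightarrow> real \<Rightarrow> real \<Rightarrow> real \<Rightarrow> real" where
  "dfld \<tau> z e s = bump 0 1 ((s - z) / \<tau> - e) / \<tau>\<^sup>2
     + (s - z) * bump 2 (bump_deriv 0 1) ((s - z) / \<tau> - e) / \<tau> ^ 3"

lemma DERIV_bump_one: "(bump 0 1 has_real_derivative bump 2 (bump_deriv 0 1) x) (at x)"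
  using DERIV_bump[of 0 1 x] by (simp add: numeral_2_eq_2)

lemma bump_one_nonneg: "0 \<le> bump 0 1 x" and bump_one_le: "bump 0 1 x \<le> 1"
  by (auto simp: bump_def abs_square_less_1 less_imp_le)

lemma smooth_mol: "smooth_real (mol \<tau> z e)"
proof -
  have eq: "1 / \<tau> * s + (- z / \<tau> - e) = (s - z) / \<tau> - e" for s
    by (simp add: diff_divide_distrib)
  have "mol \<tau> z e = (\<lambda>s. bump 0 [:1 / \<tau>:] (1 / \<tau> * s + (- z / \<tau> - e)))"
    unfolding eq by (simp add: mol_def bump_def fun_eq_iff)
  then show ?thesis by (simp only: smooth_real_bump_affine)
qed

text \<open>In the variable x = (s - z) / \<tau> - e of the bump, the prefactor (s - z) / \<tau>^2
  is the polynomial (x + e) / \<tau>, which puts the field back into the bump family.\<close>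

lemma smooth_fld: "smooth_real (fld \<tau> z e)"
proof -
  have eq: "1 / \<tau> * s + (- z / \<tau> - e) = (s - z) / \<tau> - e" for s
    by (simp add: diff_divide_distrib)
  have "poly [:e / \<tau>, 1 / \<tau>:] ((s - z) / \<tau> - e) = (s - z) / \<tau> / \<tau>" for s
    by (simp add: diff_divide_distrib)
  then have "fld \<tau> z e = (\<lambda>s. bump 0 [:e / \<tau>, 1 / \<tau>:] (1 / \<tau> * s + (- z / \<tau> - e)))"
    unfolding eq by (simp add: fld_def mol_def bump_def fun_eq_iff del: poly_pCons)
  then show ?thesis by (simp only: smooth_real_bump_affine)
qed

lemma DERIV_fld:
  assumes "\<tau> > 0" shows "(fld \<tau> z e has_real_derivative dfld \<tau> z e s) (at s)"
proof -
  have "((\<lambda>s. (s - z) / \<tau> - e) has_real_derivative 1 / \<tau>) (at s)"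
    using assms by (auto intro!: derivative_eq_intros)
  then have b: "((\<lambda>s. bump 0 1 ((s - z) / \<tau> - e)) has_real_derivative
      bump 2 (bump_deriv 0 1) ((s - z) / \<tau> - e) * (1 / \<tau>)) (at s)"
    by (rule DERIV_chain2[OF DERIV_bump_one])
  have "((\<lambda>s. (s - z) / \<tau>) has_real_derivative 1 / \<tau>) (at s)"
    using assms by (auto intro!: derivative_eq_intros)
  from DERIV_mult[OF this DERIV_cdivide[OF b, of \<tau>]] assms show ?thesis
    by (simp add: fld_def[abs_def] mol_def dfld_def power2_eq_square power3_eq_cube mult_ac add_ac)
qed

lemma DERIV_mol:
  assumes "\<tau> > 0" shows "((\<lambda>\<tau>. mol \<tau> z e s) has_real_derivative - dfld \<tau> z e s) (at \<tau>)"
proof -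
  have "((\<lambda>\<tau>. (s - z) / \<tau> - e) has_real_derivative - (s - z) / \<tau>\<^sup>2) (at \<tau>)"
    using assms by (auto intro!: derivative_eq_intros simp: power2_eq_square)
  then have b: "((\<lambda>\<tau>. bump 0 1 ((s - z) / \<tau> - e)) has_real_derivative
      bump 2 (bump_deriv 0 1) ((s - z) / \<tau> - e) * (- (s - z) / \<tau>\<^sup>2)) (at \<tau>)"
    by (rule DERIV_chain2[OF DERIV_bump_one])
  have "((\<lambda>\<tau>. bump 0 1 ((s - z) / \<tau> - e) / \<tau>) has_real_derivative - dfld \<tau> z e s) (at \<tau>)"
    by (rule DERIV_cong[OF DERIV_divide[OF b DERIV_ident]])
      (use assms in \<open>simp_all add: dfld_def power2_eq_square power3_eq_cube add_divide_distrib diff_divide_distrib left_diff_distrib right_diff_distrib mult_ac\<close>)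
  then show ?thesis by (simp add: mol_def)
qed

lemma mol_outside: "\<bar>(s - z) / \<tau> - e\<bar> \<ge> 1 \<Longrightarrow> mol \<tau> z e s = 0"
  by (simp add: mol_def bump_outside)

lemma mol_nonneg: "\<tau> > 0 \<Longrightarrow> 0 \<le> mol \<tau> z e s" and mol_le: "\<tau> > 0 \<Longrightarrow> mol \<tau> z e s \<le> 1 / \<tau>"
  by (auto simp: mol_def bump_one_nonneg bump_one_le divide_right_mono)

section \<open>Kernels and vector fields in n dimensions\<close>

definition moll :: "real \<Rightarrow> real^'n \<Rightarrow> real^'n \<Rightarrow> real^'n::finite \<Rightarrow> real" where
  "moll \<tau> z e y = (\<Prod>i\<in>UNIV. mol \<tau> (z $ i) (e $ i) (y $ i))"

text \<open>The l-th component of the vector field \<open>moll\<close> times (y - z) / \<tau>,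
  written as a product over coordinates so that it falls under the test functions of product
  form.\<close>

definition mfield :: "'n \<Rightarrow> real \<Rightarrow> real^'n \<Rightarrow> real^'n \<Rightarrow> real^'n::finite \<Rightarrow> real" where
  "mfield l \<tau> z e y = (\<Prod>i\<in>UNIV. (if i = l then fld else mol) \<tau> (z $ i) (e $ i) (y $ i))"

definition dmfield :: "'n \<Rightarrow> real \<Rightarrow> real^'n \<Rightarrow> real^'n \<Rightarrow> real^'n::finite \<Rightarrow> real" where
  "dmfield l \<tau> z e y = dfld \<tau> (z $ l) (e $ l) (y $ l) * (\<Prod>j\<in>UNIV - {l}. mol \<tau> (z $ j) (e $ j) (y $ j))"

lemma mfield_eq: "mfield l \<tau> z e y = (y $ l - z $ l) / \<tau> * moll \<tau> z e y"
proof -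
  have "mfield l \<tau> z e y = fld \<tau> (z $ l) (e $ l) (y $ l) * (\<Prod>j\<in>UNIV - {l}. mol \<tau> (z $ j) (e $ j) (y $ j))"
    unfolding mfield_def by (subst prod.remove[of _ l]) (auto intro!: prod.cong)
  also have "\<dots> = (y $ l - z $ l) / \<tau> * moll \<tau> z e y"
    unfolding moll_def by (subst prod.remove[of UNIV l]) (auto simp: fld_def)
  finally show ?thesis .
qed

lemma partial_deriv_mfield:
  assumes "\<tau> > 0"
  shows "partial_deriv l (mfield l \<tau> z e) y = dmfield l \<tau> z e y"
proof -
  define h where "h i = (if i = l then fld else mol) \<tau> (z $ i) (e $ i)" for i
  have "\<exists>d. (h i has_real_derivative d) (at (y $ i))" for i
  proof -
    have "smooth_real (h i)"
      by (simp add: h_def smooth_mol smooth_fld)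
    then obtain D where D: "D 0 = h i" "\<And>n x. (D n has_real_derivative D (Suc n) x) (at x)"
      unfolding smooth_real_def by blast
    show ?thesis using D(2)[of 0 "y $ i"] unfolding D(1) by (rule exI)
  qed
  then obtain d where d: "\<And>i. (h i has_real_derivative d i) (at (y $ i))" by metis
  have "(fld \<tau> (z $ l) (e $ l) has_real_derivative d l) (at (y $ l))"
    using d[of l] by (simp add: h_def)
  then have dl: "d l = dfld \<tau> (z $ l) (e $ l) (y $ l)"
    using DERIV_fld[OF assms] by (rule DERIV_unique)
  have "mfield l \<tau> z e = (\<lambda>y. \<Prod>i\<in>UNIV. h i (y $ i))"
    by (simp add: mfield_def[abs_def] h_def)
  then have "partial_deriv l (mfield l \<tau> z e) y = d l * (\<Prod>j\<in>UNIV - {l}. h j (y $ j))"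
    using partial_deriv_prod_coords[of h d y l, OF d] by simp
  also have "\<dots> = dmfield l \<tau> z e y"
    unfolding dmfield_def dl h_def by (intro arg_cong2[where f = times] prod.cong) auto
  finally show ?thesis .
qed

text \<open>A continuity equation: as \<tau> grows, the kernel is carried along by the dilation
  about z, whose velocity at y is (y - z) / \<tau>, so its \<tau>-derivative is minus the divergence
  of kernel times velocity.\<close>

lemma DERIV_moll:
  fixes y :: "real^'n::finite"
  assumes "\<tau> > 0"
  shows "((\<lambda>\<tau>. moll \<tau> z e y) has_real_derivative - (\<Sum>l\<in>UNIV. dmfield l \<tau> z e y)) (at \<tau>)"
proof -
  have "((\<lambda>\<tau>. moll \<tau> z e y) has_real_derivative
     (\<Sum>i\<in>UNIV. - dfld \<tau> (z $ i) (e $ i) (y $ i) * (\<Prod>j\<in>UNIV - {i}. mol \<tau> (z $ j) (e $ j) (y $ j)))) (at \<tau>)"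
    unfolding moll_def by (rule has_field_derivative_prod) (rule DERIV_mol[OF assms])
  then show ?thesis by (simp add: dmfield_def sum_negf)
qed

lemma moll_outside:
  assumes "\<tau> > 0" "\<tau> \<le> R" "y \<notin> cbox (z + \<tau> *\<^sub>R (e - 1)) (z + \<tau> *\<^sub>R (e + 1))"
  shows "moll \<tau> z e y = 0" 
proof -
  obtain i where "y $ i < z $ i + \<tau> * (e $ i - 1) \<or> y $ i > z $ i + \<tau> * (e $ i + 1)"
    using assms by (auto simp: mem_box_cart not_le)
  then have "\<bar>(y $ i - z $ i) / \<tau> - e $ i\<bar> \<ge> 1"
    using assms by (auto simp: field_simps abs_if)
  then have "mol \<tau> (z $ i) (e $ i) (y $ i) = 0" by (rule mol_outside)
  then show ?thesis by (auto simp: moll_def)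
qed

text \<open>The boxes are dilations about z of one box, and |e_i| \<le> 1 means that this box, taken
  relative to z, contains the origin; dilations of such a box are nested.\<close>

lemma scaled_box_subset:
  fixes e :: "real^'n::finite"
  assumes "\<tau> > 0" "\<tau> \<le> R" "\<And>i. \<bar>e $ i\<bar> \<le> 1"
  shows "cbox (z + \<tau> *\<^sub>R (e - 1)) (z + \<tau> *\<^sub>R (e + 1)) \<subseteq> cbox (z + R *\<^sub>R (e - 1)) (z + R *\<^sub>R (e + 1))"
proof
  fix y assume y: "y \<in> cbox (z + \<tau> *\<^sub>R (e - 1)) (z + \<tau> *\<^sub>R (e + 1))"
  have "R * (e $ i - 1) \<le> \<tau> * (e $ i - 1)" for i
    by (rule mult_right_mono_neg) (use assms(2) assms(3)[of i] in linarith)+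
  moreover have "\<tau> * (e $ i + 1) \<le> R * (e $ i + 1)" for i
    by (rule mult_right_mono) (use assms(2) assms(3)[of i] in linarith)+
  moreover have "z $ i + \<tau> * (e $ i - 1) \<le> y $ i \<and> y $ i \<le> z $ i + \<tau> * (e $ i + 1)" for i
    using y by (simp add: mem_box_cart)
  ultimately have "z $ i + R * (e $ i - 1) \<le> y $ i \<and> y $ i \<le> z $ i + R * (e $ i + 1)" for i
    by (meson add_left_mono order_trans)
  then show "y \<in> cbox (z + R *\<^sub>R (e - 1)) (z + R *\<^sub>R (e + 1))"
    by (simp add: mem_box_cart)
qed

section \<open>Averages in rescaled variables\<close>

definition base_moll :: "real^'n::finite \<Rightarrow> real" where
  "base_moll w = (\<Prod>i\<in>UNIV. bump 0 1 (w $ i))"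

lemma continuous_base_moll: "continuous_on S base_moll"
  unfolding base_moll_def[abs_def]
  by (intro continuous_on_prod continuous_on_compose2[OF continuous_bump[of UNIV]] continuous_intros) auto

text \<open>The oscillation estimate is finally divided by this constant. The integrand is
  continuous, nonnegative and positive at 0.\<close>

lemma integral_base_moll_pos: "integral (cbox (- 1) (1::real^'n::finite)) base_moll > 0"
proof -
  have nn: "base_moll w \<ge> 0" for w :: "real^'n"
    by (auto simp: base_moll_def intro!: prod_nonneg bump_one_nonneg)
  have int: "base_moll integrable_on cbox (- 1) (1::real^'n)"
    by (intro integrable_continuous continuous_base_moll)
  have "integral (cbox (- 1) (1::real^'n)) base_moll \<noteq> 0"
  proof
    assume "integral (cbox (- 1) (1::real^'n)) base_moll = 0"
    with int have "(base_moll has_integral 0) (cbox (- 1) (1::real^'n))"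
      by (simp add: has_integral_iff)
    then have "base_moll (0::real^'n) = 0"
      by (rule has_integral_0_cbox_imp_0[OF continuous_base_moll nn])
         (auto simp: interval_ne_empty_cart mem_box_cart)
    then show False by (simp add: base_moll_def bump_def)
  qed
  moreover have "integral (cbox (- 1) (1::real^'n)) base_moll \<ge> 0"
    using int nn by (intro integral_nonneg) auto
  ultimately show ?thesis by simp
qed

text \<open>Substitution y = z + \<tau> (e + w). The left side has \<tau> in the kernel, suited to
  differentiation when F is only continuous; the right side has it in F and still makes sense at
  \<tau> = 0.\<close>

lemma integral_moll_eq:
  fixes F :: "real^'n::finite \<Rightarrow> real"
  assumes "\<tau> > 0" "\<tau> \<le> R" "\<And>i. \<bar>e $ i\<bar> \<le> 1" and F: "continuous_on UNIV F"
  shows "integral (cbox (z + R *\<^sub>R (e - 1)) (z + R *\<^sub>R (e + 1))) (\<lambda>y. F y * moll \<tau> z e y)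
       = integral (cbox (- 1) 1) (\<lambda>w. F (z + \<tau> *\<^sub>R (e + w)) * base_moll w)"
proof -
  let ?Q = "cbox (z + \<tau> *\<^sub>R (e - 1)) (z + \<tau> *\<^sub>R (e + 1))"
  define c where "c = z + \<tau> *\<^sub>R e"
  have "continuous_on (cbox (- 1) 1) (\<lambda>w. F (\<tau> *\<^sub>R w + c) * base_moll w)"
    by (intro continuous_intros continuous_on_compose2[OF F] continuous_base_moll) auto
  then have int: "((\<lambda>w. F (\<tau> *\<^sub>R w + c) * base_moll w) has_integral
      integral (cbox (- 1) 1) (\<lambda>w. F (\<tau> *\<^sub>R w + c) * base_moll w)) (cbox (- 1) 1)"
    by (intro integrable_integral integrable_continuous)
  define J where "J = integral (cbox (- 1) 1) (\<lambda>w. F (\<tau> *\<^sub>R w + c) * base_moll w)"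
  \<comment> \<open>The factor \<tau>^n collects the divisions by \<tau> in the n factors of
    \<open>moll\<close> and is cancelled by the Jacobian of the substitution.\<close>
  define G where "G y = \<tau> ^ CARD('n) * (F y * moll \<tau> z e y)" for y
  have FG: "F (\<tau> *\<^sub>R w + c) * base_moll w = G (\<tau> *\<^sub>R w + c)" for w
  proof -
    have "mol \<tau> (z $ i) (e $ i) ((\<tau> *\<^sub>R w + c) $ i) = bump 0 1 (w $ i) / \<tau>" for i
      using assms(1) by (simp add: mol_def c_def add_divide_distrib)
    then have "base_moll w = \<tau> ^ CARD('n) * moll \<tau> z e (\<tau> *\<^sub>R w + c)"
      using assms(1) by (simp add: moll_def base_moll_def prod_dividef)
    then show ?thesis by (simp add: G_def)
  qed
  have box: "((z + \<tau> *\<^sub>R (e - 1)) - c) /\<^sub>R \<tau> = - 1" "((z + \<tau> *\<^sub>R (e + 1)) - c) /\<^sub>R \<tau> = 1"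
    using assms(1) by (simp_all add: c_def scaleR_diff_right scaleR_add_right)
  have J: "(J * \<tau> ^ CARD('n)) /\<^sub>R \<tau> ^ DIM(real^'n) = J" using assms(1) by simp
  have "((\<lambda>w. G (\<tau> *\<^sub>R w + c)) has_integral (J * \<tau> ^ CARD('n)) /\<^sub>R \<tau> ^ DIM(real^'n))
      (cbox (((z + \<tau> *\<^sub>R (e - 1)) - c) /\<^sub>R \<tau>) (((z + \<tau> *\<^sub>R (e + 1)) - c) /\<^sub>R \<tau>))"
    unfolding box J using int unfolding J_def[symmetric] unfolding FG .
  then have "(G has_integral J * \<tau> ^ CARD('n)) ?Q"
    by (subst (asm) has_integral_affinity_iff[OF assms(1)])
  then have "((\<lambda>y. G y / \<tau> ^ CARD('n)) has_integral J * \<tau> ^ CARD('n) / \<tau> ^ CARD('n)) ?Q"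
    by (rule has_integral_divide)
  then have "((\<lambda>y. F y * moll \<tau> z e y) has_integral J) ?Q"
    using assms(1) by (simp add: G_def)
  then have "((\<lambda>y. F y * moll \<tau> z e y) has_integral J) (cbox (z + R *\<^sub>R (e - 1)) (z + R *\<^sub>R (e + 1)))"
    by (rule has_integral_on_superset[OF _ _ scaled_box_subset[OF assms(1-3)]])
       (use moll_outside[OF assms(1,2)] in auto)
  then show ?thesis by (simp add: integral_unique J_def c_def algebra_simps)
qed

lemma continuous_on_bump_compose: "continuous_on S f \<Longrightarrow> continuous_on S (\<lambda>x. bump m p (f x))"
  by (rule continuous_on_compose2[OF continuous_bump[of UNIV]]) auto

lemma continuous_on_mol:
  assumes "continuous_on S a" "continuous_on S b" "\<And>x. x \<in> S \<Longrightarrow> a x > 0"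
  shows "continuous_on S (\<lambda>x. mol (a x) z e (b x))"
  unfolding mol_def using assms
  by (intro continuous_intros continuous_on_bump_compose) (auto simp: less_imp_neq[symmetric])

lemma continuous_on_dfld:
  assumes "continuous_on S a" "continuous_on S b" "\<And>x. x \<in> S \<Longrightarrow> a x > 0"
  shows "continuous_on S (\<lambda>x. dfld (a x) z e (b x))"
  unfolding dfld_def using assms
  by (intro continuous_intros continuous_on_bump_compose) (auto simp: less_imp_neq[symmetric])

lemma continuous_on_moll:
  fixes b :: "'a::topological_space \<Rightarrow> real^'n::finite"
  assumes "continuous_on S a" "continuous_on S b" "\<And>x. x \<in> S \<Longrightarrow> a x > 0"
  shows "continuous_on S (\<lambda>x. moll (a x) z e (b x))"
  unfolding moll_def using assms
  by (intro continuous_on_prod continuous_on_mol continuous_intros) auto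

lemma continuous_on_dmfield:
  fixes b :: "'a::topological_space \<Rightarrow> real^'n::finite"
  assumes "continuous_on S a" "continuous_on S b" "\<And>x. x \<in> S \<Longrightarrow> a x > 0"
  shows "continuous_on S (\<lambda>x. dmfield l (a x) z e (b x))"
  unfolding dmfield_def using assms
  by (intro continuous_on_prod continuous_on_mol continuous_on_dfld continuous_intros) auto

section \<open>The scale derivative of averages and its integral over scales\<close>

context
  fixes z e :: "real^'n::finite" and R :: real and Q :: "(real^'n) set"
  assumes e: "\<And>i. \<bar>e $ i\<bar> \<le> 1" and R: "R > 0"
  defines "Q \<equiv> cbox (z + R *\<^sub>R (e - 1)) (z + R *\<^sub>R (e + 1))"
begin

lemma mol_outside_box:
  assumes "0 < \<tau>" "\<tau> \<le> R" "s \<notin> {(z + R *\<^sub>R (e - 1)) $ i..(z + R *\<^sub>R (e + 1)) $ i}"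
  shows "\<bar>(s - z $ i) / \<tau> - e $ i\<bar> \<ge> 1"
proof (rule ccontr)
  assume "\<not> 1 \<le> \<bar>(s - z $ i) / \<tau> - e $ i\<bar>"
  then have "e $ i - 1 < (s - z $ i) / \<tau>" "(s - z $ i) / \<tau> < e $ i + 1" by auto
  then have "\<tau> * (e $ i - 1) < s - z $ i" "s - z $ i < \<tau> * (e $ i + 1)"
    using assms(1) by (auto simp: field_simps)
  moreover have "R * (e $ i - 1) \<le> \<tau> * (e $ i - 1)"
    by (rule mult_right_mono_neg) (use assms(2) e[of i] in linarith)+
  moreover have "\<tau> * (e $ i + 1) \<le> R * (e $ i + 1)"
    by (rule mult_right_mono) (use assms(2) e[of i] in linarith)+
  ultimately show False using assms(3) by auto
qed

lemma test_fun_mfield: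
  assumes "0 < \<tau>" "\<tau> \<le> R" "Q \<subseteq> \<Omega>"
  shows "test_fun \<Omega> (mfield l \<tau> z e)"
  unfolding mfield_def[abs_def]
proof (rule test_fun_prod_coords[where a = "z + R *\<^sub>R (e - 1)" and b = "z + R *\<^sub>R (e + 1)"])
  show "smooth_real ((if i = l then fld else mol) \<tau> (z $ i) (e $ i))" for i
    by (simp add: smooth_mol smooth_fld)
  show "(if i = l then fld else mol) \<tau> (z $ i) (e $ i) s = 0"
    if "s \<notin> {(z + R *\<^sub>R (e - 1)) $ i..(z + R *\<^sub>R (e + 1)) $ i}" for i s
    using mol_outside[OF mol_outside_box[OF assms(1,2) that]] by (cases "i = l") (auto simp: fld_def)
qed (use assms(3) in \<open>simp add: Q_def\<close>)

lemma outside_Q: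
  assumes "0 < \<tau>" "\<tau> \<le> R" "y \<notin> Q"
  shows "moll \<tau> z e y = 0" "mfield l \<tau> z e y = 0" "dmfield l \<tau> z e y = 0"
proof -
  obtain i where "y $ i \<notin> {(z + R *\<^sub>R (e - 1)) $ i..(z + R *\<^sub>R (e + 1)) $ i}"
    using assms(3) unfolding Q_def mem_box_cart atLeastAtMost_iff by blast
  then have o: "1 \<le> \<bar>(y $ i - z $ i) / \<tau> - e $ i\<bar>" by (rule mol_outside_box[OF assms(1,2)])
  then have m: "mol \<tau> (z $ i) (e $ i) (y $ i) = 0" by (rule mol_outside)
  then show "moll \<tau> z e y = 0" by (auto simp: moll_def)
  then show "mfield l \<tau> z e y = 0" by (simp add: mfield_eq)
  show "dmfield l \<tau> z e y = 0"
  proof (cases "i = l")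
    case True
    then show ?thesis using o by (auto simp: dmfield_def dfld_def bump_outside)
  next
    case False
    then show ?thesis using m by (auto simp: dmfield_def)
  qed
qed

text \<open>Where the kernel is nonzero, each |y_i - z_i| is at most 2 \<tau> (half-width 1 plus
  offset at most 1), so |y - z| \<le> 2 n \<tau>; the kernel itself is at most \<tau>^(-n). The
  factor |y - z| is kept rather than estimated by \<tau>, since the integral of s^(-n) over large
  scales diverges for n = 1.\<close>

lemma mfield_bound:
  assumes "0 < \<tau>"
  shows "\<bar>mfield l \<tau> z e y\<bar> \<le> norm (y - z) / \<tau> ^ Suc CARD('n) * indicator {y. norm (y - z) \<le> 2 * real CARD('n) * \<tau>} y"
proof (cases "moll \<tau> z e y = 0")
  case True
  then show ?thesis using assms by (simp add: mfield_eq)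
next
  case False
  have "\<bar>(y - z) $ i\<bar> \<le> 2 * \<tau>" for i
  proof -
    have "\<not> 1 \<le> \<bar>(y $ i - z $ i) / \<tau> - e $ i\<bar>"
      using False mol_outside[of "y $ i" "z $ i" \<tau> "e $ i"] by (auto simp: moll_def)
    then have "\<bar>(y $ i - z $ i) / \<tau>\<bar> \<le> 2" using e[of i] by linarith
    then show ?thesis using assms by (simp add: abs_divide divide_le_eq)
  qed
  then have "norm (y - z) \<le> (\<Sum>i\<in>(UNIV::'n set). 2 * \<tau>)"
    by (intro order_trans[OF norm_le_l1_cart] sum_mono) auto
  then have n: "norm (y - z) \<le> 2 * real CARD('n) * \<tau>" by simp
  have "moll \<tau> z e y \<le> (\<Prod>i\<in>(UNIV::'n set). 1 / \<tau>)"
    unfolding moll_def by (intro prod_mono) (use assms in \<open>auto intro: mol_nonneg mol_le\<close>)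
  then have "moll \<tau> z e y \<le> (1 / \<tau>) ^ CARD('n)" by simp
  moreover have "moll \<tau> z e y \<ge> 0"
    unfolding moll_def by (intro prod_nonneg) (use assms in \<open>auto intro: mol_nonneg\<close>)
  ultimately have "\<bar>mfield l \<tau> z e y\<bar> \<le> norm (y - z) / \<tau> * (1 / \<tau>) ^ CARD('n)"
    unfolding mfield_eq abs_mult abs_divide
    using assms component_le_norm_cart[of "y - z" l] 
    by (intro mult_mono) (auto simp: divide_right_mono)
  then show ?thesis using n assms by (simp add: power_one_over)
qed

lemma continuous_mfield: "0 < \<tau> \<Longrightarrow> continuous_on S (mfield l \<tau> z e)"
  unfolding mfield_eq[abs_def] by (intro continuous_intros continuous_on_moll) auto

lemma set_integrable_mult_mfield:
  assumes "set_integrable lebesgue Q g" "0 < \<tau>"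
  shows "set_integrable lebesgue Q (\<lambda>y. g y * mfield l \<tau> z e y)"
proof -
  have "compact (mfield l \<tau> z e ` Q)"
    unfolding Q_def by (intro compact_continuous_image continuous_mfield assms) auto
  then have "bounded (mfield l \<tau> z e ` Q)" by (rule compact_imp_bounded)
  then obtain B where "\<forall>y\<in>Q. \<bar>mfield l \<tau> z e y\<bar> \<le> B" by (auto simp: bounded_iff)
  then have B: "\<And>y. y \<in> Q \<Longrightarrow> \<bar>mfield l \<tau> z e y\<bar> \<le> B" by blast
  have B0: "B \<ge> 0" 
  proof -
    have "z + R *\<^sub>R e \<in> Q" using R by (simp add: Q_def mem_box_cart)
    from B[OF this] show ?thesis by linarith
  qed
  have gi: "integrable lebesgue (\<lambda>y. indicator Q y *\<^sub>R g y)"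
    using assms(1) by (simp add: set_integrable_def)
  have "integrable lebesgue (\<lambda>y. (indicator Q y *\<^sub>R g y) * mfield l \<tau> z e y)"
  proof (rule Bochner_Integration.integrable_bound)
    show "integrable lebesgue (\<lambda>y. B * (indicator Q y *\<^sub>R g y))" using gi by (rule integrable_mult_right)
    have "mfield l \<tau> z e \<in> borel_measurable borel"
      using continuous_mfield[OF assms(2)] by (rule borel_measurable_continuous_onI)
    then have "mfield l \<tau> z e \<in> borel_measurable lebesgue" by (simp add: measurable_completion)
    then show "(\<lambda>y. (indicator Q y *\<^sub>R g y) * mfield l \<tau> z e y) \<in> borel_measurable lebesgue"
      using gi by (intro borel_measurable_times) auto
    show "AE y in lebesgue. norm ((indicator Q y *\<^sub>R g y) * mfield l \<tau> z e y) \<le> norm (B * (indicator Q y *\<^sub>R g y))"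
    proof (rule AE_I2)
      fix y
      show "norm ((indicator Q y *\<^sub>R g y) * mfield l \<tau> z e y) \<le> norm (B * (indicator Q y *\<^sub>R g y))"
        using B[of y] B0 by (cases "y \<in> Q") (auto simp: abs_mult mult.commute[of _ "\<bar>g y\<bar>"] intro!: mult_left_mono)
    qed
  qed
  then show ?thesis by (simp add: set_integrable_def mult.assoc)
qed

text \<open>The identity defining the weak derivative is tested with \<open>mfield\<close>. Both
  integrals over \<open>\<Omega>\<close> shrink to \<open>Q\<close>, outside which
  \<open>mfield\<close> and \<open>dmfield\<close> vanish; the side with the continuous f becomes a
  gauge integral, to match the derivative of the average.\<close>

lemma weak_partial_mfield:
  assumes wp: "weak_partial \<Omega> l f g" and f: "continuous_on UNIV f" and \<tau>: "0 < \<tau>" "\<tau> \<le> R" and Q: "Q \<subseteq> \<Omega>"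
  shows "set_integrable lebesgue Q g"
    and "integral Q (\<lambda>y. f y * dmfield l \<tau> z e y) = - (LINT y:Q|lebesgue. g y * mfield l \<tau> z e y)"
proof -
  show "set_integrable lebesgue Q g" using wp Q by (simp add: weak_partial_def Q_def)
  have "(LINT y:\<Omega>|lebesgue. f y * partial_deriv l (mfield l \<tau> z e) y)
      = - (LINT y:\<Omega>|lebesgue. g y * mfield l \<tau> z e y)"
    using wp test_fun_mfield[OF \<tau> Q] by (simp add: weak_partial_def)
  also have "(LINT y:\<Omega>|lebesgue. g y * mfield l \<tau> z e y) = (LINT y:Q|lebesgue. g y * mfield l \<tau> z e y)"
    unfolding set_lebesgue_integral_def
    using Q outside_Q(2)[OF \<tau>] by (intro Bochner_Integration.integral_cong) (auto simp: indicator_def)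
  also have "(LINT y:\<Omega>|lebesgue. f y * partial_deriv l (mfield l \<tau> z e) y)
      = (LINT y:Q|lebesgue. f y * dmfield l \<tau> z e y)"
    unfolding set_lebesgue_integral_def partial_deriv_mfield[OF \<tau>(1)]
    using Q outside_Q(3)[OF \<tau>] by (intro Bochner_Integration.integral_cong) (auto simp: indicator_def)
  also have "\<dots> = integral Q (\<lambda>y. f y * dmfield l \<tau> z e y)"
  proof (rule set_lebesgue_integral_eq_integral)
    have "continuous_on Q (\<lambda>y. f y * dmfield l \<tau> z e y)"
      using \<tau> by (intro continuous_intros continuous_on_dmfield continuous_on_subset[OF f]) auto
    then have "set_integrable lborel Q (\<lambda>y. f y * dmfield l \<tau> z e y)"
      unfolding Q_def set_integrable_def by (intro borel_integrable_compact) auto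
    then show "set_integrable lebesgue Q (\<lambda>y. f y * dmfield l \<tau> z e y)"
      unfolding set_integrable_def by (simp add: integrable_completion)
  qed
  finally show "integral Q (\<lambda>y. f y * dmfield l \<tau> z e y) = - (LINT y:Q|lebesgue. g y * mfield l \<tau> z e y)" .
qed

text \<open>The rescaled variable makes \<tau> = 0 yield the point value times the mass of
  \<open>base_moll\<close>, and \<tau> = R a number that depends on z and e only through z + R
  e.\<close>

definition avg :: "(real^'n \<Rightarrow> real) \<Rightarrow> real \<Rightarrow> real" where
  "avg F \<tau> = integral (cbox (- 1) 1) (\<lambda>w. F (z + \<tau> *\<^sub>R (e + w)) * base_moll w)"

lemma continuous_on_avg:
  assumes F: "continuous_on UNIV F"
  shows "continuous_on S (avg F)"
  unfolding avg_def[abs_def]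
  by (rule integral_continuous_on_param)
     (auto simp: split_beta intro!: continuous_intros continuous_on_compose2[OF F] continuous_on_compose2[OF continuous_base_moll[of UNIV]])

text \<open>Differentiating the rescaled form would require a derivative of F. In the original
  variables the domain is the fixed box \<open>Q\<close> and only the kernel depends on \<tau>. The
  derivative is taken within {\<epsilon>..R} because the two forms are identified for 0 < \<tau>
  \<le> R.\<close>

lemma avg_has_derivative:
  assumes F: "continuous_on UNIV F" and \<epsilon>: "0 < \<epsilon>" and \<tau>: "\<tau> \<in> {\<epsilon>..R}"
  shows "(avg F has_real_derivative - (\<Sum>l\<in>UNIV. integral Q (\<lambda>y. F y * dmfield l \<tau> z e y))) (at \<tau> within {\<epsilon>..R})"
proof -
  have "((\<lambda>\<tau>. integral Q (\<lambda>y. F y * moll \<tau> z e y)) has_real_derivative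
      integral Q (\<lambda>y. F y * - (\<Sum>l\<in>UNIV. dmfield l \<tau> z e y))) (at \<tau> within {\<epsilon>..R})"
    unfolding Q_def
  proof (rule leibniz_rule_field_derivative)
    fix \<tau> y assume "\<tau> \<in> {\<epsilon>..R}"
    then have "0 < \<tau>" using \<epsilon> by auto
    then show "((\<lambda>\<tau>. F y * moll \<tau> z e y) has_real_derivative F y * - (\<Sum>l\<in>UNIV. dmfield l \<tau> z e y)) (at \<tau> within {\<epsilon>..R})"
      by (intro DERIV_cmult has_field_derivative_at_within[OF DERIV_moll])
  next
    fix \<tau> assume "\<tau> \<in> {\<epsilon>..R}"
    then have "0 < \<tau>" using \<epsilon> by auto
    then show "(\<lambda>y. F y * moll \<tau> z e y) integrable_on cbox (z + R *\<^sub>R (e - 1)) (z + R *\<^sub>R (e + 1))"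
      by (intro integrable_continuous continuous_intros continuous_on_moll continuous_on_subset[OF F]) auto
  next
    show "continuous_on ({\<epsilon>..R} \<times> cbox (z + R *\<^sub>R (e - 1)) (z + R *\<^sub>R (e + 1)))
        (\<lambda>(\<tau>, y). F y * - (\<Sum>l\<in>UNIV. dmfield l \<tau> z e y))"
      unfolding split_beta using \<epsilon>
      by (intro continuous_intros continuous_on_dmfield continuous_on_compose2[OF F]) auto
  qed (use \<tau> in auto)
  moreover have "integral Q (\<lambda>y. F y * - (\<Sum>l\<in>UNIV. dmfield l \<tau> z e y))
      = - (\<Sum>l\<in>UNIV. integral Q (\<lambda>y. F y * dmfield l \<tau> z e y))"
  proof -
    have "integral Q (\<lambda>y. F y * - (\<Sum>l\<in>UNIV. dmfield l \<tau> z e y))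
        = integral Q (\<lambda>y. - (\<Sum>l\<in>UNIV. F y * dmfield l \<tau> z e y))"
      by (simp add: sum_distrib_left)
    also have "\<dots> = - integral Q (\<lambda>y. (\<Sum>l\<in>UNIV. F y * dmfield l \<tau> z e y))"
      by (rule integral_neg)
    also have "integral Q (\<lambda>y. (\<Sum>l\<in>UNIV. F y * dmfield l \<tau> z e y)) = (\<Sum>l\<in>UNIV. integral Q (\<lambda>y. F y * dmfield l \<tau> z e y))"
      unfolding Q_def using \<tau> \<epsilon>
      by (intro integral_sum integrable_continuous continuous_intros continuous_on_dmfield continuous_on_subset[OF F]) auto
    finally show ?thesis .
  qed
  ultimately have "((\<lambda>\<tau>. integral Q (\<lambda>y. F y * moll \<tau> z e y)) has_real_derivative
      - (\<Sum>l\<in>UNIV. integral Q (\<lambda>y. F y * dmfield l \<tau> z e y))) (at \<tau> within {\<epsilon>..R})" by simp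
  then show ?thesis
  proof (rule has_field_derivative_transform_within[OF _ zero_less_one \<tau>])
    fix \<tau>' assume "\<tau>' \<in> {\<epsilon>..R}"
    then show "integral Q (\<lambda>y. F y * moll \<tau>' z e y) = avg F \<tau>'"
      unfolding Q_def avg_def using \<epsilon> by (intro integral_moll_eq e F) auto
  qed
qed

text \<open>For a linear function the average is affine in the scale, so its scale derivative is a
  constant that can be read off without weak derivatives.\<close>

lemma avg_linear:
  "avg (\<lambda>y. a \<bullet> y) \<tau> = (a \<bullet> z) * integral (cbox (- 1) 1) (base_moll :: real^'n \<Rightarrow> real)
     + \<tau> * (\<Sum>l\<in>UNIV. a $ l * integral (cbox (- 1) 1) (\<lambda>w. (e + w) $ l * base_moll w))"
proof -
  have "(a \<bullet> (z + \<tau> *\<^sub>R (e + w))) * base_moll w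
      = (a \<bullet> z) * base_moll w + \<tau> * (\<Sum>l\<in>UNIV. a $ l * ((e + w) $ l * base_moll w))" for w
    by (simp add: inner_vec_def algebra_simps sum_distrib_left sum_distrib_right sum.distrib)
  then have "avg (\<lambda>y. a \<bullet> y) \<tau> = integral (cbox (- 1) 1)
     (\<lambda>w. (a \<bullet> z) * base_moll w + \<tau> * (\<Sum>l\<in>UNIV. a $ l * ((e + w) $ l * base_moll w)))"
    by (simp add: avg_def)
  also have "\<dots> = integral (cbox (- 1) 1) (\<lambda>w::real^'n. (a \<bullet> z) * base_moll w)
     + integral (cbox (- 1) 1) (\<lambda>w. \<tau> * (\<Sum>l\<in>UNIV. a $ l * ((e + w) $ l * base_moll w)))"
    by (intro Henstock_Kurzweil_Integration.integral_add integrable_continuous continuous_intros continuous_base_moll)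
  also have "integral (cbox (- 1) 1) (\<lambda>w. \<tau> * (\<Sum>l\<in>UNIV. a $ l * ((e + w) $ l * base_moll w)))
     = \<tau> * (\<Sum>l\<in>UNIV. a $ l * integral (cbox (- 1) 1) (\<lambda>w. (e + w) $ l * base_moll w))"
    by (subst integral_mult_right, subst integral_sum)
       (auto intro!: integrable_continuous continuous_intros continuous_base_moll)
  finally show ?thesis by simp
qed

text \<open>Independent of \<tau>, and equal to the coefficient of a_l in the slope for linear
  functions; this match is what turns \<open>g l\<close> into \<open>g l - a $ l\<close>.\<close>

lemma integral_mfield:
  assumes "0 < \<tau>" "\<tau> \<le> R"
  shows "integral Q (mfield l \<tau> z e) = integral (cbox (- 1) 1) (\<lambda>w. (e + w) $ l * base_moll w)"
proof -
  have "integral Q (mfield l \<tau> z e) = integral Q (\<lambda>y. (y $ l - z $ l) / \<tau> * moll \<tau> z e y)"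
    by (simp add: mfield_eq[abs_def])
  also have "\<dots> = integral (cbox (- 1) 1) (\<lambda>w. ((z + \<tau> *\<^sub>R (e + w)) $ l - z $ l) / \<tau> * base_moll w)"
    unfolding Q_def using assms(1) by (intro integral_moll_eq assms e continuous_intros) auto
  also have "\<dots> = integral (cbox (- 1) 1) (\<lambda>w. (e + w) $ l * base_moll w)"
    using assms by simp
  finally show ?thesis .
qed

text \<open>The fundamental theorem of calculus on [\<epsilon>, R], the field bound and Tonelli over
  scales give a bound free of \<epsilon>; then \<epsilon> tends to 0, where the average is the point
  value up to its mass. The constant (2n)^n / n is b^n / n with b = 2n from the support of the
  fields.\<close>

lemma avg_estimate:
  assumes wp: "\<And>l. weak_partial \<Omega> l f (g l)" and f: "continuous_on UNIV f" and Q: "Q \<subseteq> \<Omega>"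
  shows "ennreal \<bar>avg (\<lambda>y. f y - a \<bullet> y) R - integral (cbox (- 1) 1) (base_moll :: real^'n \<Rightarrow> real) * (f z - a \<bullet> z)\<bar>
    \<le> ennreal ((2 * CARD('n)) ^ CARD('n) / CARD('n))
      * (\<integral>\<^sup>+ y. ennreal (\<Sum>l\<in>UNIV. \<bar>g l y - a $ l\<bar>) * indicator Q y * ennreal (riesz_kernel z y) \<partial>lebesgue)"
    (is "_ \<le> ?rhs")
proof -
  define \<phi> where "\<phi> y = f y - a \<bullet> y" for y
  have \<phi>: "continuous_on UNIV \<phi>" unfolding \<phi>_def by (intro continuous_intros f)
  define \<Gamma> where "\<Gamma> y = ennreal (\<Sum>l\<in>UNIV. \<bar>g l y - a $ l\<bar>) * indicator Q y" for y
  define K where "K = (\<Sum>l\<in>UNIV. a $ l * integral (cbox (- 1) 1) (\<lambda>w. (e + w) $ l * base_moll w))"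
  \<comment> \<open>The scale derivative of the average of \<open>\<phi>\<close>, written with f so
    that its continuity in \<tau> is plain; the form with \<open>g - a\<close> serves only for the
    bound.\<close>
  define D where "D \<tau> = - (\<Sum>l\<in>UNIV. integral Q (\<lambda>y. f y * dmfield l \<tau> z e y)) - K" for \<tau>
  define inner where "inner \<tau> = (\<integral>\<^sup>+ y. \<Gamma> y * ennreal (norm (y - z) / \<tau> ^ Suc CARD('n))
      * indicator {y. norm (y - z) \<le> (2 * real CARD('n)) * \<tau>} y \<partial>lebesgue)" for \<tau>
  have gQ: "set_integrable lebesgue Q (g l)" for l
    using weak_partial_mfield(1)[OF wp f R order_refl Q] .
  have cQ: "set_integrable lebesgue Q (\<lambda>_. c :: real)" for c
  proof -
    have "integrable lebesgue (indicator Q :: real^'n \<Rightarrow> real)"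
      using fmeasurable_cbox by (simp add: Q_def integrable_indicator_iff fmeasurable_def)
    then show ?thesis by (simp add: set_integrable_def)
  qed
  have avg_\<phi>: "avg \<phi> \<tau> = avg f \<tau> - avg (\<lambda>y. a \<bullet> y) \<tau>" for \<tau>
  proof -
    have "avg \<phi> \<tau> = integral (cbox (- 1) 1) (\<lambda>w. f (z + \<tau> *\<^sub>R (e + w)) * base_moll w
        - (a \<bullet> (z + \<tau> *\<^sub>R (e + w))) * base_moll w)"
      by (simp add: avg_def \<phi>_def left_diff_distrib)
    also have "\<dots> = avg f \<tau> - avg (\<lambda>y. a \<bullet> y) \<tau>" unfolding avg_def
      by (intro Henstock_Kurzweil_Integration.integral_diff integrable_continuous continuous_intros
          continuous_base_moll continuous_on_compose2[OF f]) auto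
    finally show ?thesis .
  qed
  have deriv: "(avg \<phi> has_real_derivative D \<tau>) (at \<tau> within {\<epsilon>..R})"
    if "0 < \<epsilon>" "\<tau> \<in> {\<epsilon>..R}" for \<epsilon> \<tau>
  proof -
    have "(avg (\<lambda>y. a \<bullet> y) has_real_derivative K) (at \<tau> within {\<epsilon>..R})"
      unfolding avg_linear[abs_def] K_def by (auto intro!: derivative_eq_intros)
    from DERIV_diff[OF avg_has_derivative[OF f that] this] show ?thesis
      by (simp add: avg_\<phi>[abs_def] D_def)
  qed
  have Dbound: "ennreal \<bar>D \<tau>\<bar> \<le> inner \<tau>" if \<tau>: "0 < \<tau>" "\<tau> \<le> R" for \<tau>
  proof -
    define u where "u y = (\<Sum>l\<in>UNIV. indicator Q y *\<^sub>R ((g l y - a $ l) * mfield l \<tau> z e y))" for y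
    have gi: "set_integrable lebesgue Q (\<lambda>y. g l y - a $ l)" for l
      using gQ cQ by (intro set_integral_diff)
    have si: "set_integrable lebesgue Q (\<lambda>y. (g l y - a $ l) * mfield l \<tau> z e y)" for l
      by (rule set_integrable_mult_mfield[OF gi \<tau>(1)])
    then have i: "integrable lebesgue (\<lambda>y. indicator Q y *\<^sub>R ((g l y - a $ l) * mfield l \<tau> z e y))" for l
      by (simp add: set_integrable_def)
    have "(LINT y:Q|lebesgue. (g l y - a $ l) * mfield l \<tau> z e y)
       = - integral Q (\<lambda>y. f y * dmfield l \<tau> z e y) - a $ l * integral Q (mfield l \<tau> z e)" for l
    proof -
      have s1: "set_integrable lebesgue Q (\<lambda>y. 1 * mfield l \<tau> z e y)"
        by (rule set_integrable_mult_mfield[OF cQ \<tau>(1)])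
      have "(LINT y:Q|lebesgue. (g l y - a $ l) * mfield l \<tau> z e y)
          = (LINT y:Q|lebesgue. g l y * mfield l \<tau> z e y - a $ l * mfield l \<tau> z e y)"
        by (simp add: left_diff_distrib)
      also have "\<dots> = (LINT y:Q|lebesgue. g l y * mfield l \<tau> z e y) - (LINT y:Q|lebesgue. a $ l * mfield l \<tau> z e y)"
        using s1 cQ by (intro set_integral_diff set_integrable_mult_mfield gQ \<tau>) auto
      also have "(LINT y:Q|lebesgue. a $ l * mfield l \<tau> z e y) = a $ l * integral Q (mfield l \<tau> z e)"
        using set_lebesgue_integral_eq_integral(2)[OF s1] by simp
      also have "(LINT y:Q|lebesgue. g l y * mfield l \<tau> z e y) = - integral Q (\<lambda>y. f y * dmfield l \<tau> z e y)"
        using weak_partial_mfield(2)[OF wp f \<tau> Q, of l] by simp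
      finally show ?thesis .
    qed
    then have "D \<tau> = (\<Sum>l\<in>UNIV. (LINT y:Q|lebesgue. (g l y - a $ l) * mfield l \<tau> z e y))"
      by (simp add: D_def K_def integral_mfield[OF \<tau>] sum_subtractf sum_negf)
    also have "\<dots> = (\<integral>y. u y \<partial>lebesgue)"
      unfolding u_def set_lebesgue_integral_def using i
      by (subst Bochner_Integration.integral_sum) auto
    finally have "ennreal \<bar>D \<tau>\<bar> = ennreal (norm (\<integral>y. u y \<partial>lebesgue))" by simp
    also have "\<dots> \<le> (\<integral>\<^sup>+ y. ennreal (norm (u y)) \<partial>lebesgue)"
      unfolding u_def using i by (intro integral_norm_bound_ennreal Bochner_Integration.integrable_sum) auto
    also have "\<dots> \<le> inner \<tau>" unfolding inner_def
    proof (rule nn_integral_mono)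
      fix y
      define k where "k = norm (y - z) / \<tau> ^ Suc CARD('n) * indicator {y. norm (y - z) \<le> 2 * real CARD('n) * \<tau>} y"
      have k0: "k \<ge> 0" using \<tau> by (simp add: k_def)
      have "norm (u y) \<le> (\<Sum>l\<in>UNIV. \<bar>g l y - a $ l\<bar> * k * indicator Q y)"
        unfolding u_def
      proof (rule order_trans[OF norm_sum sum_mono])
        fix l
        have "\<bar>mfield l \<tau> z e y\<bar> \<le> k" unfolding k_def by (rule mfield_bound[OF \<tau>(1)])
        then show "norm (indicator Q y *\<^sub>R ((g l y - a $ l) * mfield l \<tau> z e y)) \<le> \<bar>g l y - a $ l\<bar> * k * indicator Q y"
          by (auto simp: indicator_def abs_mult mult_left_mono)
      qed
      also have "\<dots> = (\<Sum>l\<in>UNIV. \<bar>g l y - a $ l\<bar>) * indicator Q y * k"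
        by (simp add: sum_distrib_left sum_distrib_right mult_ac)
      finally have "ennreal (norm (u y)) \<le> ennreal ((\<Sum>l\<in>UNIV. \<bar>g l y - a $ l\<bar>) * indicator Q y * k)"
        by (rule ennreal_leI)
      also have "\<dots> = \<Gamma> y * ennreal k"
        using k0 by (simp add: \<Gamma>_def ennreal_mult'' ennreal_mult sum_nonneg ennreal_indicator)
      also have "\<dots> = \<Gamma> y * ennreal (norm (y - z) / \<tau> ^ Suc CARD('n)) * indicator {y. norm (y - z) \<le> 2 * real CARD('n) * \<tau>} y"
        unfolding k_def using \<tau> by (subst ennreal_mult) (auto simp: ennreal_indicator mult.assoc)
      finally show "ennreal (norm (u y)) \<le> \<dots>" .
    qed
    finally show ?thesis .
  qed
  have Dcont: "continuous_on {\<epsilon>..R} D" if "0 < \<epsilon>" for \<epsilon>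
    unfolding D_def Q_def
  proof (intro continuous_intros integral_continuous_on_param)
    fix l
    show "continuous_on ({\<epsilon>..R} \<times> cbox (z + R *\<^sub>R (e - 1)) (z + R *\<^sub>R (e + 1))) (\<lambda>(\<tau>, y). f y * dmfield l \<tau> z e y)"
      unfolding split_beta using that
      by (intro continuous_intros continuous_on_dmfield continuous_on_compose2[OF f]) auto
  qed
  \<comment> \<open>\<open>g l\<close> is known to be measurable only after multiplication by the
    indicator of \<open>Q\<close>; inserting that indicator leaves \<open>\<Gamma>\<close> unchanged
    because it vanishes outside \<open>Q\<close>.\<close>
  have \<Gamma>m: "\<Gamma> \<in> borel_measurable lebesgue"
  proof -
    have "(\<lambda>y. \<Sum>l\<in>UNIV. \<bar>indicator Q y *\<^sub>R g l y - a $ l\<bar>) \<in> borel_measurable lebesgue"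
      using gQ unfolding set_integrable_def
      by (intro borel_measurable_sum borel_measurable_abs borel_measurable_diff) auto
    then have "(\<lambda>y. ennreal (\<Sum>l\<in>UNIV. \<bar>indicator Q y *\<^sub>R g l y - a $ l\<bar>) * indicator Q y) \<in> borel_measurable lebesgue"
      by (intro borel_measurable_times_ennreal borel_measurable_indicator measurable_compose[OF _ measurable_ennreal]) (auto simp: Q_def)
    moreover have "\<Gamma> = (\<lambda>y. ennreal (\<Sum>l\<in>UNIV. \<bar>indicator Q y *\<^sub>R g l y - a $ l\<bar>) * indicator Q y)"
      by (auto simp: \<Gamma>_def fun_eq_iff indicator_def)
    ultimately show ?thesis by simp
  qed
  have est: "ennreal \<bar>avg \<phi> R - avg \<phi> \<epsilon>\<bar> \<le> ?rhs" if \<epsilon>: "0 < \<epsilon>" "\<epsilon> \<le> R" for \<epsilon>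
  proof -
    have hi: "(D has_integral (avg \<phi> R - avg \<phi> \<epsilon>)) {\<epsilon>..R}"
      using deriv[OF \<epsilon>(1)] \<epsilon>(2)
      by (intro fundamental_theorem_of_calculus) (auto simp: has_real_derivative_iff_has_vector_derivative)
    have si: "set_integrable lborel {\<epsilon>..R} D"
      unfolding set_integrable_def by (rule borel_integrable_compact[OF compact_Icc Dcont[OF \<epsilon>(1)]])
    have "avg \<phi> R - avg \<phi> \<epsilon> = (LINT \<tau>:{\<epsilon>..R}|lborel. D \<tau>)"
      using set_borel_integral_eq_integral(2)[OF si] integral_unique[OF hi] by simp
    then have "ennreal \<bar>avg \<phi> R - avg \<phi> \<epsilon>\<bar> = ennreal (norm (\<integral>\<tau>. indicator {\<epsilon>..R} \<tau> *\<^sub>R D \<tau> \<partial>lborel))"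
      by (simp add: set_lebesgue_integral_def)
    also have "\<dots> \<le> (\<integral>\<^sup>+ \<tau>. ennreal (norm (indicator {\<epsilon>..R} \<tau> *\<^sub>R D \<tau>)) \<partial>lborel)"
      using si unfolding set_integrable_def by (rule integral_norm_bound_ennreal)
    also have "\<dots> \<le> (\<integral>\<^sup>+ \<tau>. inner \<tau> * indicator {0<..} \<tau> \<partial>lborel)"
      using Dbound \<epsilon> by (intro nn_integral_mono) (auto simp: indicator_def)
    also have "\<dots> \<le> ennreal ((2 * real CARD('n)) ^ DIM(real^'n) / DIM(real^'n)) * (\<integral>\<^sup>+ y. \<Gamma> y * ennreal (riesz_kernel z y) \<partial>lebesgue)"
      using nn_integral_scales_le_riesz[OF \<Gamma>m, of "2 * real CARD('n)" z] by (simp add: inner_def)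
    finally show ?thesis by (simp add: \<Gamma>_def)
  qed
  \<comment> \<open>The scales R / (n+1) stay in (0, R], where \<open>est\<close> applies, and tend
    to 0.\<close>
  have "(\<lambda>n. avg \<phi> (R / real (Suc n))) \<longlonglongrightarrow> avg \<phi> 0"
  proof -
    have "isCont (avg \<phi>) 0"
      using continuous_on_avg[OF \<phi>, of UNIV] by (simp add: continuous_on_eq_continuous_at)
    moreover have "(\<lambda>n. R / real (Suc n)) \<longlonglongrightarrow> 0"
      using LIMSEQ_Suc[OF tendsto_divide_0[OF tendsto_const[of R] filterlim_at_top_imp_at_infinity[OF filterlim_real_sequentially]]] .
    ultimately show ?thesis by (rule isCont_tendsto_compose)
  qed
  then have "(\<lambda>n. ennreal \<bar>avg \<phi> R - avg \<phi> (R / real (Suc n))\<bar>) \<longlonglongrightarrow> ennreal \<bar>avg \<phi> R - avg \<phi> 0\<bar>"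
    by (intro tendsto_intros)
  then have "ennreal \<bar>avg \<phi> R - avg \<phi> 0\<bar> \<le> ?rhs"
    by (rule LIMSEQ_le_const2) (use est R in \<open>auto intro!: exI[of _ 0] simp: divide_le_eq\<close>)
  moreover have "avg \<phi> 0 = integral (cbox (- 1) 1) (base_moll :: real^'n \<Rightarrow> real) * (f z - a \<bullet> z)"
    by (simp add: avg_def \<phi>_def mult.commute)
  ultimately show ?thesis by (simp add: \<phi>_def[abs_def])
qed

end

section \<open>Almost everywhere differentiability\<close>

text \<open>Three ranges of v = |g - a|: up to \<delta> the first term suffices, up to S the second,
  and beyond both the excess v - S is counted in unit steps. A step k with k + S \<le> v has |g|
  \<ge> v - |a| \<ge> k + S / 2, so it lies above the level (k + S) / 2; this is where S \<ge> 2 |a|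
  and the spacing 1/2 enter.\<close>

lemma abs_diff_le_levels:
  fixes g a \<delta> :: real and S :: nat
  assumes S: "real S \<ge> 2 * \<bar>a\<bar>" and \<delta>: "\<delta> \<ge> 0"
  shows "ennreal \<bar>g - a\<bar> \<le> ennreal \<delta> + (if \<bar>g - a\<bar> > \<delta> then ennreal (real S) else 0)
           + (\<Sum>k. if \<bar>g\<bar> \<ge> real (k + S) / 2 then 1 else 0)"
proof (cases "\<bar>g - a\<bar> \<le> max \<delta> (real S)")
  case True
  then have "ennreal \<bar>g - a\<bar> \<le> ennreal \<delta> + (if \<bar>g - a\<bar> > \<delta> then ennreal (real S) else 0)"
    using \<delta> by (auto simp: max_def ennreal_leI add_increasing split: if_splits)
  then show ?thesis by (rule order_trans) simp
next
  case False
  define v where "v = \<bar>g - a\<bar>"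
  \<comment> \<open>The final 1 accounts for the fractional part of v.\<close>
  define m where "m = nat \<lfloor>v\<rfloor> - S + 1"
  have v: "v > \<delta>" "v > real S" using False by (auto simp: v_def)
  have Sv: "S \<le> nat \<lfloor>v\<rfloor>" using v by linarith
  have "v \<le> real S + real m" using v Sv unfolding m_def by linarith
  then have "ennreal v \<le> ennreal (real S) + ennreal (real m)"
    by (simp add: ennreal_plus[symmetric] ennreal_leI del: ennreal_plus)
  also have "ennreal (real m) = (\<Sum>k<m. if \<bar>g\<bar> \<ge> real (k + S) / 2 then 1 else 0)"
  proof -
    have "\<bar>g\<bar> \<ge> real (k + S) / 2" if "k < m" for k
    proof -
      have "k + S \<le> nat \<lfloor>v\<rfloor>" using that Sv unfolding m_def by linarith
      then have "real (k + S) \<le> v" using v by linarith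
      moreover have "\<bar>g\<bar> \<ge> v - \<bar>a\<bar>" unfolding v_def by linarith
      ultimately show ?thesis using S by simp
    qed
    then have "(\<Sum>k<m. if \<bar>g\<bar> \<ge> real (k + S) / 2 then 1 else 0 :: ennreal) = (\<Sum>k<m. 1)"
      by (intro sum.cong) auto
    then show ?thesis by (simp add: ennreal_of_nat_eq_real_of_nat)
  qed
  also have "\<dots> \<le> (\<Sum>k. if \<bar>g\<bar> \<ge> real (k + S) / 2 then 1 else 0)"
    by (rule sum_le_suminf) auto
  finally have "ennreal v \<le> ennreal (real S) + (\<Sum>k. if \<bar>g\<bar> \<ge> real (k + S) / 2 then 1 else 0)"
    by (simp add: add_left_mono)
  then show ?thesis using v
    by (simp add: v_def[symmetric] add.assoc add_increasing)
qed

lemma measurable_abs_diff_indicator: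
  fixes g :: "real^'n::finite \<Rightarrow> real"
  assumes "g \<in> borel_measurable (restrict_space lebesgue \<Omega>)" "\<Omega> \<in> sets lebesgue" "B \<subseteq> \<Omega>" "B \<in> sets lebesgue"
  shows "(\<lambda>y. ennreal \<bar>g y - c\<bar> * indicator B y) \<in> borel_measurable lebesgue"
proof -
  have "(\<lambda>y. indicator \<Omega> y *\<^sub>R g y) \<in> borel_measurable lebesgue"
    using assms(1,2) by (simp add: borel_measurable_restrict_space_iff)
  then have "(\<lambda>y. ennreal \<bar>indicator \<Omega> y *\<^sub>R g y - c\<bar> * indicator B y) \<in> borel_measurable lebesgue"
    using assms(4) by (intro borel_measurable_times_ennreal borel_measurable_indicator measurable_compose[OF _ measurable_ennreal]
       borel_measurable_abs borel_measurable_diff) auto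
  moreover have "(\<lambda>y. ennreal \<bar>indicator \<Omega> y *\<^sub>R g y - c\<bar> * indicator B y) = (\<lambda>y. ennreal \<bar>g y - c\<bar> * indicator B y)"
    using assms(3) by (auto simp: fun_eq_iff indicator_def)
  ultimately show ?thesis by simp
qed

lemma riesz_kernel_measurable_lebesgue: "(\<lambda>y. ennreal (riesz_kernel z y)) \<in> borel_measurable lebesgue"
  by (rule measurable_completion) measurable

text \<open>The integral splits into the part with oscillation at most \<delta>, the exceptional set
  where the difference is capped at S, and the high levels; each is held to \<epsilon> r / 3. The
  size \<eta> of the exceptional set has to beat S and is therefore chosen after it, whereas S comes
  from the tail alone. All bounds are uniform in the pole z, because the kernel estimate depends
  only on measures.\<close>

lemma AE_lorentz_point:
  fixes g :: "real^'n::finite \<Rightarrow> real"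
  assumes g: "lorentz_N1 \<Omega> g" and \<Omega>: "open \<Omega>" "\<Omega> \<in> lmeasurable"
  shows "negligible {x\<in>\<Omega>. \<not> (\<forall>\<epsilon>>0. \<exists>d>0. \<forall>r z. 0 < r \<and> r < d \<longrightarrow>
      (\<integral>\<^sup>+ y. ennreal \<bar>g y - g x\<bar> * indicator (ball x r) y * ennreal (riesz_kernel z y) \<partial>lebesgue) \<le> ennreal (\<epsilon> * r))}"
    (is "negligible ?D")
proof -
  let ?N = "CARD('n)"
  define W where "W k = {y\<in>\<Omega>. \<bar>g y\<bar> \<ge> real k / 2}" for k :: nat
  have gm: "g \<in> borel_measurable (restrict_space lebesgue \<Omega>)" using g by (simp add: lorentz_N1_def)
  have W: "W k \<in> lmeasurable" for k
    unfolding W_def by (rule lorentz_N1_summable(1)[OF g \<Omega>(2)])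
  have Wsum: "summable (\<lambda>k. root DIM(real^'n) (measure lebesgue (W k)))"
    unfolding W_def using lorentz_N1_summable(2)[OF g \<Omega>(2)] by simp
  define ex where "ex x \<delta> r = {y\<in>ball x r. y \<notin> \<Omega> \<or> \<bar>g y - g x\<bar> > \<delta>}" for x \<delta> r
  \<comment> \<open>Only accuracies 1/(i+1) and integer starting indices are used, so that the union
    of all exceptional sets is countable and still null.\<close>
  define N1 where "N1 j i = {x\<in>\<Omega>. \<not> (\<exists>d>0. \<forall>r. 0 < r \<and> r < d \<longrightarrow>
           measure lebesgue (ex x (inverse (real (Suc j))) r) \<le> inverse (real (Suc i)) * r ^ DIM(real^'n))}" for i j
  define N2 where "N2 j S0 = {x. \<not> (\<exists>S\<ge>S0. \<exists>d>0. \<forall>r m. 0 < r \<and> r < d \<longrightarrow>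
           (\<Sum>k<m. root DIM(real^'n) (measure lebesgue (ball x r \<inter> W (k + S)))) \<le> inverse (real (Suc j)) * r)}" for j S0 :: nat
  have N1: "negligible (N1 j i)" for j i
    unfolding N1_def ex_def by (rule AE_approx_continuous[OF \<Omega>(1) gm]) auto
  have N2: "negligible (N2 j S0)" for j S0
    unfolding N2_def by (rule AE_small_tail[OF W _ Wsum]) auto
  have "negligible ((\<Union>p. N1 (fst p) (snd p)) \<union> (\<Union>p. N2 (fst p) (snd p)))"
    using N1 N2 by (intro negligible_Un negligible_countable_Union) auto
  moreover have "?D \<subseteq> (\<Union>p. N1 (fst p) (snd p)) \<union> (\<Union>p. N2 (fst p) (snd p))"
  proof (rule ccontr)
    assume "\<not> ?D \<subseteq> (\<Union>p. N1 (fst p) (snd p)) \<union> (\<Union>p. N2 (fst p) (snd p))"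
    then obtain x where x: "x \<in> ?D" "x \<notin> (\<Union>p. N1 (fst p) (snd p))" "x \<notin> (\<Union>p. N2 (fst p) (snd p))"
      by blast
    have x1: "x \<notin> N1 j i" and x2: "x \<notin> N2 j i" for i j
      using x(2,3) by force+
    have x\<Omega>: "x \<in> \<Omega>" using x(1) by blast
    obtain d0 where d0: "d0 > 0" "ball x d0 \<subseteq> \<Omega>" using \<Omega>(1) x\<Omega> openE by blast
    define c where "c = unit_ball_vol (real ?N) * 2 ^ ?N + 1"
    have c: "c > 0" unfolding c_def by (simp add: add_nonneg_pos)
    define \<omega> where "\<omega> = root ?N (unit_ball_vol (real ?N))"
    have \<omega>: "\<omega> \<ge> 0" by (simp add: \<omega>_def)
    have "\<exists>d>0. \<forall>r z. 0 < r \<and> r < d \<longrightarrow>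
      (\<integral>\<^sup>+ y. ennreal \<bar>g y - g x\<bar> * indicator (ball x r) y * ennreal (riesz_kernel z y) \<partial>lebesgue) \<le> ennreal (\<epsilon> * r)"
      if \<epsilon>: "\<epsilon> > 0" for \<epsilon>
    proof -
      have "\<epsilon> / 3 / (c * \<omega> + 1) > 0" using \<epsilon> c \<omega> by (simp add: add_nonneg_pos)
      then obtain j where "inverse (real (Suc j)) < \<epsilon> / 3 / (c * \<omega> + 1)" using reals_Archimedean by blast
      moreover define \<delta> where "\<delta> = inverse (real (Suc j))"
      moreover have "c * \<omega> + 1 > 0" using c \<omega> by (simp add: add_nonneg_pos)
      ultimately have "\<delta> * (c * \<omega> + 1) \<le> \<epsilon> / 3"
        using pos_less_divide_eq[of "c * \<omega> + 1" \<delta> "\<epsilon> / 3"] by linarith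
      moreover have \<delta>0: "\<delta> > 0" by (simp add: \<delta>_def)
      ultimately have b1: "\<delta> * (c * \<omega>) \<le> \<epsilon> / 3" by (simp add: distrib_left)
      have "\<epsilon> / 3 / c > 0" using \<epsilon> c by simp
      then obtain j2 where "inverse (real (Suc j2)) < \<epsilon> / 3 / c" using reals_Archimedean by blast
      then have b2: "c * inverse (real (Suc j2)) \<le> \<epsilon> / 3"
        unfolding pos_less_divide_eq[OF c] by (simp only: mult.commute[of c] less_imp_le)
      define S0 where "S0 = nat \<lceil>2 * \<bar>g x\<bar>\<rceil>"
      obtain S d2 where S: "S \<ge> S0" and d2: "d2 > 0"
        and tail: "\<And>r m. 0 < r \<Longrightarrow> r < d2 \<Longrightarrow> (\<Sum>k<m. root ?N (measure lebesgue (ball x r \<inter> W (k + S)))) \<le> inverse (real (Suc j2)) * r"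
        using x2[of j2 S0] unfolding N2_def by auto
      have Sg: "real S \<ge> 2 * \<bar>g x\<bar>" using S unfolding S0_def by linarith
      \<comment> \<open>The n-th power anticipates the root in the kernel estimate; S + 1 in place
        of S avoids dividing by 0.\<close>
      have "(\<epsilon> / 3 / (c * (real S + 1))) ^ ?N > 0" using \<epsilon> c by (intro zero_less_power divide_pos_pos) auto
      then obtain i where i: "inverse (real (Suc i)) < (\<epsilon> / 3 / (c * (real S + 1))) ^ ?N" using reals_Archimedean by blast
      define \<eta> where "\<eta> = inverse (real (Suc i))"
      have \<eta>0: "\<eta> > 0" by (simp add: \<eta>_def)
      have "root ?N \<eta> \<le> root ?N ((\<epsilon> / 3 / (c * (real S + 1))) ^ ?N)"
        using i by (simp add: \<eta>_def)
      also have "\<dots> = \<epsilon> / 3 / (c * (real S + 1))"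
        using \<epsilon> c by (intro real_root_power_cancel) auto
      finally have "root ?N \<eta> * (c * (real S + 1)) \<le> \<epsilon> / 3"
        using c by (simp add: pos_le_divide_eq)
      moreover have "root ?N \<eta> * (c * real S) \<le> root ?N \<eta> * (c * (real S + 1))"
        using c \<eta>0 by (intro mult_left_mono) auto
      ultimately have b3: "real S * (c * root ?N \<eta>) \<le> \<epsilon> / 3" by (simp add: mult_ac)
      obtain d1 where d1: "d1 > 0"
        and exm: "\<And>r. 0 < r \<Longrightarrow> r < d1 \<Longrightarrow> measure lebesgue (ex x \<delta> r) \<le> \<eta> * r ^ ?N"
        using x1[of j i] x\<Omega> unfolding N1_def \<delta>_def \<eta>_def by auto
      show ?thesis
      proof (intro exI[of _ "min d0 (min d1 d2)"] conjI allI impI)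
        show "0 < min d0 (min d1 d2)" using d0 d1 d2 by simp
        fix r and z :: "real^'n" assume "0 < r \<and> r < min d0 (min d1 d2)"
        then have r: "0 < r" "r < d0" "r < d1" "r < d2" by auto
        let ?B = "ball x r" and ?K = "\<lambda>y. ennreal (riesz_kernel z y)"
        have B\<Omega>: "?B \<subseteq> \<Omega>" using r d0 by auto
        have exset: "ex x \<delta> r \<in> lmeasurable"
        proof -
          have "{y\<in>space (restrict_space lebesgue \<Omega>). \<bar>g y - g x\<bar> > \<delta>} \<in> sets (restrict_space lebesgue \<Omega>)"
            using gm by measurable
          then have "{y\<in>\<Omega>. \<bar>g y - g x\<bar> > \<delta>} \<in> sets lebesgue"
            using \<Omega> by (simp add: sets_restrict_space_iff space_restrict_space fmeasurableD)
          moreover have "ex x \<delta> r = ?B \<inter> {y\<in>\<Omega>. \<bar>g y - g x\<bar> > \<delta>}" using B\<Omega> by (auto simp: ex_def)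
          ultimately show ?thesis by (simp add: fmeasurable_Int_fmeasurable)
        qed
        have Wset: "?B \<inter> W k \<in> lmeasurable" for k
          using W[of k] by (intro fmeasurable_Int_fmeasurable) (auto simp: fmeasurableD)
        have ker: "(\<integral>\<^sup>+ y. ?K y * indicator A y \<partial>lebesgue) \<le> ennreal (c * t)"
          if "A \<in> lmeasurable" "root ?N (measure lebesgue A) \<le> t" for A :: "(real^'n) set" and t
        proof -
          have "(\<integral>\<^sup>+ y. ?K y * indicator A y \<partial>lebesgue) \<le> ennreal (c * root ?N (measure lebesgue A))"
            using nn_integral_riesz_kernel_le[OF that(1), of z] by (simp add: c_def)
          also have "\<dots> \<le> ennreal (c * t)" using that(2) c by (intro ennreal_leI mult_left_mono) auto
          finally show ?thesis .
        qed
        have Km: "(\<lambda>y. ?K y * indicator A y) \<in> borel_measurable lebesgue" if "A \<in> lmeasurable" for A :: "(real^'n) set"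
          using that by (intro borel_measurable_times_ennreal borel_measurable_indicator riesz_kernel_measurable_lebesgue)
            (auto simp: fmeasurableD)
        have "(\<integral>\<^sup>+ y. ennreal \<bar>g y - g x\<bar> * indicator ?B y * ?K y \<partial>lebesgue)
          \<le> (\<integral>\<^sup>+ y. ennreal \<delta> * (?K y * indicator ?B y) + ennreal (real S) * (?K y * indicator (ex x \<delta> r) y)
               + (\<Sum>k. ?K y * indicator (?B \<inter> W (k + S)) y) \<partial>lebesgue)"
        proof (rule nn_integral_mono)
          fix y
          show "ennreal \<bar>g y - g x\<bar> * indicator ?B y * ?K y \<le>
             ennreal \<delta> * (?K y * indicator ?B y) + ennreal (real S) * (?K y * indicator (ex x \<delta> r) y)
               + (\<Sum>k. ?K y * indicator (?B \<inter> W (k + S)) y)"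
          proof (cases "y \<in> ?B")
            case True
            have y: "y \<in> \<Omega>" using True B\<Omega> by blast
            have iW: "indicator (?B \<inter> W (k + S)) y = (if \<bar>g y\<bar> \<ge> real (k + S) / 2 then 1 else 0 :: ennreal)" for k
              using True y by (auto simp: W_def indicator_def)
            have iE: "ennreal (real S) * (?K y * indicator (ex x \<delta> r) y) = ?K y * (if \<bar>g y - g x\<bar> > \<delta> then ennreal (real S) else 0)"
              using True y by (auto simp: ex_def indicator_def mult.commute)
            have "?K y * ennreal \<bar>g y - g x\<bar> \<le> ?K y * (ennreal \<delta> + (if \<bar>g y - g x\<bar> > \<delta> then ennreal (real S) else 0)
               + (\<Sum>k. if \<bar>g y\<bar> \<ge> real (k + S) / 2 then 1 else 0))"
              using \<delta>0 by (intro mult_left_mono abs_diff_le_levels[OF Sg]) auto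
            also have "\<dots> = ennreal \<delta> * (?K y * indicator ?B y) + ennreal (real S) * (?K y * indicator (ex x \<delta> r) y)
               + (\<Sum>k. ?K y * indicator (?B \<inter> W (k + S)) y)"
              unfolding iE iW using True by (simp only: distrib_left ennreal_suminf_cmult indicator_simps mult_1_right mult_1_left mult.commute)
            finally show ?thesis using True by (simp add: mult.commute)
          qed simp
        qed
        also have "\<dots> = (\<integral>\<^sup>+ y. ennreal \<delta> * (?K y * indicator ?B y) \<partial>lebesgue)
            + (\<integral>\<^sup>+ y. ennreal (real S) * (?K y * indicator (ex x \<delta> r) y) \<partial>lebesgue)
            + (\<integral>\<^sup>+ y. (\<Sum>k. ?K y * indicator (?B \<inter> W (k + S)) y) \<partial>lebesgue)"
        proof -
          have m1: "(\<lambda>y. ennreal \<delta> * (?K y * indicator ?B y)) \<in> borel_measurable lebesgue"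
            by (rule borel_measurable_times_ennreal[OF borel_measurable_const Km[OF lmeasurable_ball]])
          have m2: "(\<lambda>y. ennreal (real S) * (?K y * indicator (ex x \<delta> r) y)) \<in> borel_measurable lebesgue"
            by (rule borel_measurable_times_ennreal[OF borel_measurable_const Km[OF exset]])
          have m3: "(\<lambda>y. \<Sum>k. ?K y * indicator (?B \<inter> W (k + S)) y) \<in> borel_measurable lebesgue"
            by (rule borel_measurable_suminf_order[OF Km[OF Wset]])
          show ?thesis
            unfolding nn_integral_add[OF borel_measurable_add[OF m1 m2] m3] nn_integral_add[OF m1 m2] ..
        qed
        also have "\<dots> = ennreal \<delta> * (\<integral>\<^sup>+ y. ?K y * indicator ?B y \<partial>lebesgue)
            + ennreal (real S) * (\<integral>\<^sup>+ y. ?K y * indicator (ex x \<delta> r) y \<partial>lebesgue)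
            + (\<Sum>k. \<integral>\<^sup>+ y. ?K y * indicator (?B \<inter> W (k + S)) y \<partial>lebesgue)"
          unfolding nn_integral_cmult[OF Km[OF lmeasurable_ball]] nn_integral_cmult[OF Km[OF exset]]
            nn_integral_suminf[OF Km[OF Wset]] ..
        also have "\<dots> \<le> ennreal \<delta> * ennreal (c * (\<omega> * r)) + ennreal (real S) * ennreal (c * (root ?N \<eta> * r))
            + ennreal (c * (inverse (real (Suc j2)) * r))"
        proof (intro add_mono mult_left_mono)
          show "(\<integral>\<^sup>+ y. ?K y * indicator ?B y \<partial>lebesgue) \<le> ennreal (c * (\<omega> * r))"
          proof (rule ker)
            have "measure lebesgue ?B = unit_ball_vol (real ?N) * r ^ ?N"
              using content_ball[of r x] r by simp
            then show "root ?N (measure lebesgue ?B) \<le> \<omega> * r"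
              using r by (simp add: \<omega>_def real_root_mult real_root_power_cancel)
          qed simp
          show "(\<integral>\<^sup>+ y. ?K y * indicator (ex x \<delta> r) y \<partial>lebesgue) \<le> ennreal (c * (root ?N \<eta> * r))"
          proof (rule ker[OF exset])
            have "root ?N (measure lebesgue (ex x \<delta> r)) \<le> root ?N (\<eta> * r ^ ?N)"
              using exm[OF r(1,3)] by simp
            then show "root ?N (measure lebesgue (ex x \<delta> r)) \<le> root ?N \<eta> * r"
              using r by (simp add: real_root_mult real_root_power_cancel)
          qed
          show "(\<Sum>k. \<integral>\<^sup>+ y. ?K y * indicator (?B \<inter> W (k + S)) y \<partial>lebesgue) \<le> ennreal (c * (inverse (real (Suc j2)) * r))"
          proof (rule suminf_le_const)
            fix m
            have "(\<Sum>k<m. \<integral>\<^sup>+ y. ?K y * indicator (?B \<inter> W (k + S)) y \<partial>lebesgue)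
               \<le> (\<Sum>k<m. ennreal (c * root ?N (measure lebesgue (?B \<inter> W (k + S)))))"
              by (intro sum_mono ker Wset order_refl)
            also have "\<dots> = ennreal (c * (\<Sum>k<m. root ?N (measure lebesgue (?B \<inter> W (k + S)))))"
              using c by (simp add: sum_ennreal sum_distrib_left)
            also have "\<dots> \<le> ennreal (c * (inverse (real (Suc j2)) * r))"
              using tail[OF r(1,4)] c by (intro ennreal_leI mult_left_mono) auto
            finally show "(\<Sum>k<m. \<integral>\<^sup>+ y. ?K y * indicator (?B \<inter> W (k + S)) y \<partial>lebesgue) \<le> \<dots>" .
          qed simp
        qed auto
        also have "\<dots> = ennreal (\<delta> * (c * (\<omega> * r)) + real S * (c * (root ?N \<eta> * r)) + c * (inverse (real (Suc j2)) * r))"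
        proof -
          have nn: "0 \<le> c * (\<omega> * r)" "0 \<le> c * (root ?N \<eta> * r)" "0 \<le> c * (inverse (real (Suc j2)) * r)"
            using c \<omega> r \<eta>0 by auto
          have p: "0 \<le> \<delta> * (c * (\<omega> * r))" "0 \<le> real S * (c * (root ?N \<eta> * r))"
            using nn \<delta>0 by auto
          show ?thesis
            unfolding ennreal_mult[OF less_imp_le[OF \<delta>0] nn(1), symmetric] ennreal_mult[OF of_nat_0_le_iff nn(2), symmetric]
              ennreal_plus[OF p, symmetric] ennreal_plus[OF add_nonneg_nonneg[OF p] nn(3), symmetric] ..
        qed
        also have "\<dots> \<le> ennreal (\<epsilon> * r)"
        proof (rule ennreal_leI)
          have "\<delta> * (c * (\<omega> * r)) + real S * (c * (root ?N \<eta> * r)) + c * (inverse (real (Suc j2)) * r)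
             = (\<delta> * (c * \<omega>) + real S * (c * root ?N \<eta>) + c * inverse (real (Suc j2))) * r"
            by (simp add: distrib_right mult.assoc)
          also have "\<dots> \<le> \<epsilon> * r" using b1 b2 b3 r by (intro mult_right_mono) auto
          finally show "\<delta> * (c * (\<omega> * r)) + real S * (c * (root ?N \<eta> * r)) + c * (inverse (real (Suc j2)) * r) \<le> \<epsilon> * r" .
        qed
        finally show "(\<integral>\<^sup>+ y. ennreal \<bar>g y - g x\<bar> * indicator ?B y * ?K y \<partial>lebesgue) \<le> ennreal (\<epsilon> * r)" .
      qed
    qed
    then show False using x(1) by blast
  qed
  ultimately show ?thesis by (rule negligible_subset)
qed

text \<open>The derivative at a good point x is the vector of the values \<open>g l x\<close>. R is
  taken to be |y - x|, so that x and y both lie in the cube \<open>Q\<close> and are compared with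
  the same average \<open>A\<close>.\<close>

lemma stein_differentiable_AE:
  fixes f :: "real^'n::finite \<Rightarrow> real"
  assumes f: "continuous_on UNIV f" and \<Omega>: "open \<Omega>" "bounded \<Omega>"
    and wp: "\<And>l. weak_partial \<Omega> l f (g l)" and lor: "\<And>l. lorentz_N1 \<Omega> (g l)"
  shows "negligible {x\<in>\<Omega>. \<not> f differentiable (at x)}"
proof -
  let ?N = "real CARD('n)"
  define I where "I = integral (cbox (- 1) 1) (base_moll :: real^'n \<Rightarrow> real)"
  have I: "I > 0" unfolding I_def by (rule integral_base_moll_pos)
  define C where "C = (2 * ?N) ^ CARD('n) / ?N"
  have C: "C \<ge> 0" by (simp add: C_def)
  have \<Omega>m: "\<Omega> \<in> lmeasurable" using \<Omega> by (intro lmeasurable_open)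
  define good where "good l x \<longleftrightarrow> (\<forall>\<epsilon>>0. \<exists>d>0. \<forall>r z. 0 < r \<and> r < d \<longrightarrow>
      (\<integral>\<^sup>+ y. ennreal \<bar>g l y - g l x\<bar> * indicator (ball x r) y * ennreal (riesz_kernel z y) \<partial>lebesgue) \<le> ennreal (\<epsilon> * r))" for l x
  have "negligible (\<Union>l. {x\<in>\<Omega>. \<not> good l x})"
    unfolding good_def using AE_lorentz_point[OF lor \<Omega>(1) \<Omega>m] by (intro negligible_Union) auto
  moreover have "{x\<in>\<Omega>. \<not> f differentiable (at x)} \<subseteq> (\<Union>l. {x\<in>\<Omega>. \<not> good l x})"
  proof (rule ccontr)
    assume "\<not> {x\<in>\<Omega>. \<not> f differentiable (at x)} \<subseteq> (\<Union>l. {x\<in>\<Omega>. \<not> good l x})"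
    then obtain x where x: "x \<in> \<Omega>" "\<not> f differentiable (at x)" and good: "\<And>l. good l x" by auto
    obtain d0 where d0: "d0 > 0" "ball x d0 \<subseteq> \<Omega>" using \<Omega>(1) x openE by blast
    define a where "a = (\<chi> l. g l x)"
    define \<phi> where "\<phi> y = f y - a \<bullet> y" for y
    have "(f has_derivative (\<lambda>v. a \<bullet> v)) (at x)"
      unfolding has_derivative_at_alt
    proof (intro conjI allI impI)
      show "bounded_linear (\<lambda>v. a \<bullet> v)" by (rule bounded_linear_inner_right)
      fix e :: real assume e: "e > 0"
      \<comment> \<open>The two comparisons with \<open>A\<close>, the sum over n components and r =
        2 n R multiply \<epsilon> by C and by 2 n (2 n); the factor I is divided out at the
        end.\<close>
      define \<epsilon> where "\<epsilon> = e * I / (2 * C * ?N * (2 * ?N) + 1)"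
      have den: "2 * C * ?N * (2 * ?N) + 1 > 0" using C by (simp add: add_nonneg_pos)
      have \<epsilon>: "\<epsilon> > 0" using e I den by (simp add: \<epsilon>_def)
      have \<epsilon>_le: "2 * C * ?N * (2 * ?N) * \<epsilon> \<le> e * I"
      proof -
        have "(2 * C * ?N * (2 * ?N) + 1) * \<epsilon> = e * I" using den by (simp add: \<epsilon>_def)
        then show ?thesis using \<epsilon> by (simp add: distrib_right)
      qed
      have "\<forall>l. \<exists>d>0. \<forall>r z. 0 < r \<and> r < d \<longrightarrow>
        (\<integral>\<^sup>+ y. ennreal \<bar>g l y - g l x\<bar> * indicator (ball x r) y * ennreal (riesz_kernel z y) \<partial>lebesgue) \<le> ennreal (\<epsilon> * r)"
        using good \<epsilon> unfolding good_def by blast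
      then obtain d where "\<forall>l. d l > 0 \<and> (\<forall>r z. 0 < r \<and> r < d l \<longrightarrow>
        (\<integral>\<^sup>+ y. ennreal \<bar>g l y - g l x\<bar> * indicator (ball x r) y * ennreal (riesz_kernel z y) \<partial>lebesgue) \<le> ennreal (\<epsilon> * r))"
        by (rule choice[THEN exE])
      then have d: "\<And>l. d l > 0" and dl: "\<And>l r z. 0 < r \<and> r < d l \<Longrightarrow>
        (\<integral>\<^sup>+ y. ennreal \<bar>g l y - g l x\<bar> * indicator (ball x r) y * ennreal (riesz_kernel z y) \<partial>lebesgue) \<le> ennreal (\<epsilon> * r)"
        by blast+
      define d1 where "d1 = Min (insert d0 (range d))"
      have d1: "d1 > 0" "d1 \<le> d0" "d1 \<le> d l" for l
        using d d0 by (auto simp: d1_def min.coboundedI2)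
      show "\<exists>d>0. \<forall>y. norm (y - x) < d \<longrightarrow> norm (f y - f x - a \<bullet> (y - x)) \<le> e * norm (y - x)"
      proof (intro exI[of _ "d1 / (2 * ?N)"] conjI allI impI)
        show "0 < d1 / (2 * ?N)" using d1 by simp
        fix y assume y: "norm (y - x) < d1 / (2 * ?N)"
        show "norm (f y - f x - a \<bullet> (y - x)) \<le> e * norm (y - x)"
        proof (cases "y = x")
          case True then show ?thesis by simp
        next
          case False
          define R where "R = norm (y - x)"
          \<comment> \<open>A cube of half-side R lies in the closed ball of radius n R; the factor
            2 leaves room for the open ball.\<close>
          define r where "r = 2 * ?N * R"
          have R: "R > 0" using False by (simp add: R_def)
          have r: "0 < r" "r < d1" using R y by (auto simp: r_def R_def field_simps)
          define Q where "Q = cbox (x - R *\<^sub>R 1) (x + R *\<^sub>R 1)"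
          have QB: "Q \<subseteq> ball x r"
          proof
            fix w assume "w \<in> Q"
            then have "\<bar>(w - x) $ i\<bar> \<le> R" for i by (auto simp: Q_def mem_box_cart abs_le_iff algebra_simps)
            then have "norm (w - x) \<le> (\<Sum>i\<in>(UNIV::'n set). R)"
              by (intro order_trans[OF norm_le_l1_cart] sum_mono) auto
            also have "\<dots> < r" using R by (simp add: r_def)
            finally show "w \<in> ball x r" by (simp add: dist_norm norm_minus_commute)
          qed
          have B\<Omega>: "ball x r \<subseteq> \<Omega>" using r d1 d0 subset_ball[of r d0 x] by auto
          define A where "A = integral (cbox (- 1) 1) (\<lambda>w. \<phi> (x + R *\<^sub>R w) * base_moll w)"
          have est: "\<bar>A - I * \<phi> z\<bar> \<le> C * ?N * \<epsilon> * r" if z: "z \<in> Q" for z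
          proof -
            \<comment> \<open>This offset moves the centre of the averaging box at scale R from z to
              x.\<close>
            define e' where "e' = (x - z) /\<^sub>R R"
            have e': "\<bar>e' $ i\<bar> \<le> 1" for i
            proof -
              have "\<bar>(x - z) $ i\<bar> \<le> R" using z by (auto simp: Q_def mem_box_cart abs_le_iff algebra_simps)
              moreover have "e' $ i = (x - z) $ i / R" by (simp add: e'_def divide_inverse mult.commute)
              ultimately show ?thesis using R by (simp add: abs_divide divide_le_eq)
            qed
            have ze: "z + R *\<^sub>R e' = x" using R by (simp add: e'_def)
            have Qeq: "cbox (z + R *\<^sub>R (e' - 1)) (z + R *\<^sub>R (e' + 1)) = Q"
            proof -
              have "z + R *\<^sub>R (e' - 1) = (z + R *\<^sub>R e') - R *\<^sub>R 1" "z + R *\<^sub>R (e' + 1) = (z + R *\<^sub>R e') + R *\<^sub>R 1"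
                by (simp_all add: scaleR_diff_right scaleR_add_right)
              then show ?thesis unfolding Q_def ze by simp
            qed
            have Aeq: "avg z e' \<phi> R = A"
              unfolding avg_def[OF e' R] A_def scaleR_add_right add.assoc[symmetric] ze ..
            have Q\<Omega>: "Q \<subseteq> \<Omega>" using QB B\<Omega> by blast
            have \<phi>_eq: "(\<lambda>y. f y - a \<bullet> y) = \<phi>" "f z - a \<bullet> z = \<phi> z" by (auto simp: \<phi>_def)
            have "ennreal \<bar>A - I * \<phi> z\<bar> \<le> ennreal C *
                (\<integral>\<^sup>+ y. ennreal (\<Sum>l\<in>UNIV. \<bar>g l y - a $ l\<bar>) * indicator Q y * ennreal (riesz_kernel z y) \<partial>lebesgue)"
              using avg_estimate[OF e' R wp f, of z a, unfolded Qeq, OF Q\<Omega>]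
              unfolding \<phi>_eq Aeq I_def[symmetric] C_def by simp
            also have "\<dots> \<le> ennreal C * (\<integral>\<^sup>+ y. (\<Sum>l\<in>UNIV. ennreal \<bar>g l y - g l x\<bar> * indicator (ball x r) y * ennreal (riesz_kernel z y)) \<partial>lebesgue)"
            proof (intro mult_left_mono nn_integral_mono)
              fix y
              have "ennreal (\<Sum>l\<in>UNIV. \<bar>g l y - a $ l\<bar>) * indicator Q y \<le> (\<Sum>l\<in>UNIV. ennreal \<bar>g l y - g l x\<bar>) * indicator (ball x r) y"
                using QB by (intro mult_mono) (auto simp: a_def sum_ennreal indicator_def)
              then have "ennreal (\<Sum>l\<in>UNIV. \<bar>g l y - a $ l\<bar>) * indicator Q y * ennreal (riesz_kernel z y)
                  \<le> (\<Sum>l\<in>UNIV. ennreal \<bar>g l y - g l x\<bar>) * indicator (ball x r) y * ennreal (riesz_kernel z y)"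
                by (rule mult_right_mono) simp
              then show "ennreal (\<Sum>l\<in>UNIV. \<bar>g l y - a $ l\<bar>) * indicator Q y * ennreal (riesz_kernel z y)
                  \<le> (\<Sum>l\<in>UNIV. ennreal \<bar>g l y - g l x\<bar> * indicator (ball x r) y * ennreal (riesz_kernel z y))"
                by (simp only: sum_distrib_right)
            qed simp
            also have "\<dots> = ennreal C * (\<Sum>l\<in>UNIV. \<integral>\<^sup>+ y. ennreal \<bar>g l y - g l x\<bar> * indicator (ball x r) y * ennreal (riesz_kernel z y) \<partial>lebesgue)"
            proof (subst nn_integral_sum)
              fix l
              have "g l \<in> borel_measurable (restrict_space lebesgue \<Omega>)" using lor by (simp add: lorentz_N1_def)
              then show "(\<lambda>y. ennreal \<bar>g l y - g l x\<bar> * indicator (ball x r) y * ennreal (riesz_kernel z y)) \<in> borel_measurable lebesgue"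
                using \<Omega>m B\<Omega> by (intro borel_measurable_times_ennreal measurable_abs_diff_indicator riesz_kernel_measurable_lebesgue)
                  (auto simp: fmeasurableD)
            qed simp
            also have "\<dots> \<le> ennreal C * (\<Sum>l\<in>(UNIV::'n set). ennreal (\<epsilon> * r))"
            proof (intro mult_left_mono sum_mono dl)
              show "0 < r \<and> r < d l" for l using r d1(3)[of l] by linarith
            qed simp
            also have "\<dots> = ennreal (C * ?N * \<epsilon> * r)"
            proof -
              have "(\<Sum>l\<in>(UNIV::'n set). ennreal (\<epsilon> * r)) = ennreal (?N * (\<epsilon> * r))"
                using \<epsilon> r by (subst sum_ennreal) auto
              then show ?thesis using C \<epsilon> r by (simp only: ennreal_mult'[symmetric] mult.assoc)
            qed
            finally show ?thesis using C \<epsilon> r by (subst (asm) ennreal_le_iff) auto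
          qed
          have "x \<in> Q" using R by (simp add: Q_def mem_box_cart)
          moreover have "y \<in> Q"
          proof -
            have "\<bar>(y - x) $ i\<bar> \<le> R" for i unfolding R_def by (rule component_le_norm_cart)
            then have "\<bar>y $ i - x $ i\<bar> \<le> R" for i by simp
            then have "x $ i - R \<le> y $ i \<and> y $ i \<le> x $ i + R" for i
              by (simp add: abs_le_iff algebra_simps)
            then show ?thesis by (simp add: Q_def mem_box_cart)
          qed
          ultimately have "\<bar>I * \<phi> y - I * \<phi> x\<bar> \<le> 2 * (C * ?N * \<epsilon> * r)"
            using est[of x] est[of y] by linarith
          also have "\<dots> = (2 * C * ?N * (2 * ?N) * \<epsilon>) * R" by (simp add: r_def)
          also have "\<dots> \<le> e * I * R" using \<epsilon>_le R by (intro mult_right_mono) auto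
          finally have "I * \<bar>\<phi> y - \<phi> x\<bar> \<le> I * (e * R)"
            using I by (simp add: right_diff_distrib[symmetric] abs_mult mult_ac)
          then have "\<bar>\<phi> y - \<phi> x\<bar> \<le> e * R" using I by simp
          then show ?thesis by (simp add: \<phi>_def R_def inner_diff_right algebra_simps)
        qed
      qed
    qed
    then show False using x(2) unfolding differentiable_def by blast
  qed
  ultimately show ?thesis by (rule negligible_subset)
qed

section \<open>Fibres of the flow map\<close>

text \<open>Gronwall through exp (-2 \<kappa> s) |v s|^2, whose derivative is nonpositive by
  Cauchy-Schwarz; squaring avoids differentiating the norm at 0. Negative times follow by reversing
  time.\<close>

lemma norm_le_exp_growth:
  fixes u :: "real \<Rightarrow> 'a::real_inner"
  assumes u: "\<And>t. (u has_vector_derivative u' t) (at t)"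
    and bnd: "\<And>t. norm (u' t) \<le> \<kappa> * norm (u t)"
  shows "norm (u t) \<le> exp (\<kappa> * \<bar>t\<bar>) * norm (u 0)"
proof -
  have main: "norm (v t) \<le> exp (\<kappa> * t) * norm (v 0)"
    if t: "t \<ge> 0" and v: "\<And>t. (v has_vector_derivative v' t) (at t)" and b: "\<And>t. norm (v' t) \<le> \<kappa> * norm (v t)"
    for v v' :: "real \<Rightarrow> 'a" and t
  proof -
    define h where "h s = exp (- (2 * \<kappa> * s)) * (v s \<bullet> v s)" for s
    have "h t \<le> h 0"
    proof (rule DERIV_nonpos_imp_nonincreasing[OF t])
      fix s
      have "((\<lambda>s. v s \<bullet> v s) has_real_derivative 2 * (v s \<bullet> v' s)) (at s)"
      proof -
        have "((\<lambda>s. v s \<bullet> v s) has_derivative (\<lambda>k. v s \<bullet> (k *\<^sub>R v' s) + (k *\<^sub>R v' s) \<bullet> v s)) (at s)"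
          using v[of s] by (intro has_derivative_inner) (auto simp: has_vector_derivative_def)
        then show ?thesis
          by (rule has_derivative_imp_has_field_derivative) (simp add: inner_commute algebra_simps)
      qed
      moreover have "((\<lambda>s. exp (- (2 * \<kappa> * s))) has_real_derivative exp (- (2 * \<kappa> * s)) * - (2 * \<kappa>)) (at s)"
        by (auto intro!: derivative_eq_intros)
      ultimately have "(h has_real_derivative exp (- (2 * \<kappa> * s)) * - (2 * \<kappa>) * (v s \<bullet> v s) + 2 * (v s \<bullet> v' s) * exp (- (2 * \<kappa> * s))) (at s)"
        unfolding h_def by (intro DERIV_mult)
      moreover have "exp (- (2 * \<kappa> * s)) * - (2 * \<kappa>) * (v s \<bullet> v s) + 2 * (v s \<bullet> v' s) * exp (- (2 * \<kappa> * s)) \<le> 0"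
      proof -
        have "v s \<bullet> v' s \<le> norm (v s) * norm (v' s)" by (rule norm_cauchy_schwarz)
        also have "\<dots> \<le> norm (v s) * (\<kappa> * norm (v s))" using b by (intro mult_left_mono) auto
        also have "\<dots> = \<kappa> * (v s \<bullet> v s)" by (simp add: power2_norm_eq_inner[symmetric] power2_eq_square)
        finally have "exp (- (2 * \<kappa> * s)) * 2 * (v s \<bullet> v' s) \<le> exp (- (2 * \<kappa> * s)) * 2 * (\<kappa> * (v s \<bullet> v s))"
          by (intro mult_left_mono) auto
        then show ?thesis by (simp add: algebra_simps)
      qed
      ultimately show "\<exists>y. (h has_real_derivative y) (at s) \<and> y \<le> 0" by blast
    qed
    then have "(norm (v t))\<^sup>2 \<le> (exp (\<kappa> * t) * norm (v 0))\<^sup>2"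
    proof -
      have "exp (2 * \<kappa> * t) * h t \<le> exp (2 * \<kappa> * t) * h 0" using \<open>h t \<le> h 0\<close> by (intro mult_left_mono) auto
      moreover have "exp (2 * \<kappa> * t) * h t = (norm (v t))\<^sup>2"
        by (simp add: h_def power2_norm_eq_inner mult.assoc[symmetric] exp_add[symmetric])
      moreover have "exp (2 * \<kappa> * t) * h 0 = (exp (\<kappa> * t) * norm (v 0))\<^sup>2"
        by (simp add: h_def power2_norm_eq_inner power_mult_distrib exp_double[symmetric] mult_ac)
      ultimately show ?thesis by simp
    qed
    then show ?thesis by (rule power2_le_imp_le) simp
  qed
  show ?thesis
  proof (cases "t \<ge> 0")
    case True then show ?thesis using main[OF True u bnd] by simp
  next
    case False
    have "((\<lambda>s. u (- s)) has_vector_derivative - u' (- s)) (at s)" for s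
    proof -
      have "((\<lambda>s. - s) has_vector_derivative - 1) (at s)"
        by (auto intro!: derivative_eq_intros)
      from vector_diff_chain_at[OF this u[of "- s"]] show ?thesis by (simp add: o_def)
    qed
    from main[of "- t", OF _ this] False bnd show ?thesis by simp
  qed
qed

text \<open>Every point near \<open>x\<close> is close to the level set, where \<open>F\<close> is constant.\<close>
lemma zero_derivative_at_density_point:
  fixes F U :: "real^'n::finite \<Rightarrow> real^'n"
  assumes L: "L \<ge> 0" and lip: "\<And>y z. norm (F y - F z) \<le> L * (norm (y - z) + norm (U y - U z))"
    and U: "U differentiable (at x)"
    and dens: "\<And>\<epsilon>. \<epsilon> > 0 \<Longrightarrow> \<exists>d>0. \<forall>r. 0 < r \<and> r < d \<longrightarrow>
           measure lebesgue (ball x r - {y. F y = F x}) \<le> \<epsilon> * r ^ CARD('n)"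
    and meas: "{y. F y = F x} \<in> sets lebesgue"
  shows "(F has_derivative (\<lambda>_. 0)) (at x)"
  unfolding has_derivative_at_alt
proof (intro conjI allI impI)
  show "bounded_linear (\<lambda>_::real^'n. 0::real^'n)" by (rule bounded_linear_zero)
  let ?K = "{y. F y = F x}"
  let ?N = "CARD('n)"
  fix e :: real assume e: "e > 0"
  obtain U' where U': "(U has_derivative U') (at x)" using U by (auto simp: differentiable_def)
  obtain B where B: "B > 0" "\<And>v. norm (U' v) \<le> norm v * B"
    using bounded_linear.pos_bounded[OF has_derivative_bounded_linear[OF U']] by blast
  \<comment> \<open>The factor 4 + B collects one \<eta> r from |z - w|, three from linearising U at
    z and at w (which may be 2 r away from x), and B from U' (z - w).\<close>
  define \<eta> where "\<eta> = min 1 (e / (L * (4 + B) + 1))"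
  have den: "L * (4 + B) + 1 > 0" using L B by (simp add: add_nonneg_pos)
  have \<eta>: "0 < \<eta>" "\<eta> \<le> 1" using e den by (auto simp: \<eta>_def)
  have \<eta>e: "L * (4 + B) * \<eta> \<le> e"
  proof -
    have "(L * (4 + B) + 1) * \<eta> \<le> (L * (4 + B) + 1) * (e / (L * (4 + B) + 1))"
      using den by (intro mult_left_mono) (auto simp: \<eta>_def)
    also have "\<dots> = e" using den by simp
    finally show ?thesis using \<eta> by (simp add: distrib_right)
  qed
  obtain d1 where d1: "d1 > 0" "\<And>y. norm (y - x) < d1 \<Longrightarrow> norm (U y - U x - U' (y - x)) \<le> \<eta> * norm (y - x)"
    using U' \<eta>(1) unfolding has_derivative_at_alt by blast
  define \<omega> where "\<omega> = unit_ball_vol (real ?N)"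
  have \<omega>: "\<omega> > 0" by (simp add: \<omega>_def)
  \<comment> \<open>Calibrated so that \<epsilon> (2 r)^n is half the volume of a ball of radius
    \<eta> r; such a ball inside ball x (2 r) therefore cannot miss the level set.\<close>
  define \<epsilon> where "\<epsilon> = \<omega> * \<eta> ^ ?N / 2 ^ ?N / 2"
  have \<epsilon>: "\<epsilon> > 0" using \<omega> \<eta> by (simp add: \<epsilon>_def)
  obtain d2 where d2: "d2 > 0" "\<And>r. 0 < r \<Longrightarrow> r < d2 \<Longrightarrow> measure lebesgue (ball x r - ?K) \<le> \<epsilon> * r ^ ?N"
    using dens[OF \<epsilon>] by blast
  show "\<exists>d>0. \<forall>y. norm (y - x) < d \<longrightarrow> norm (F y - F x - 0) \<le> e * norm (y - x)"
  proof (intro exI[of _ "min d1 d2 / 2"] conjI allI impI)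
    show "0 < min d1 d2 / 2" using d1 d2 by simp
    fix z assume z: "norm (z - x) < min d1 d2 / 2"
    show "norm (F z - F x - 0) \<le> e * norm (z - x)"
    proof (cases "z = x")
      case True then show ?thesis by simp
    next
      case False
      define r where "r = norm (z - x)"
      have r: "r > 0" "2 * r < d1" "2 * r < d2" using False z by (auto simp: r_def)
      have "\<exists>w\<in>?K. norm (z - w) < \<eta> * r"
      proof (rule ccontr)
        assume no: "\<not> (\<exists>w\<in>?K. norm (z - w) < \<eta> * r)"
        have \<eta>r: "\<eta> * r \<le> r" using \<eta> r mult_right_mono[of \<eta> 1 r] by simp
        have sub: "ball z (\<eta> * r) \<subseteq> ball x (2 * r) - ?K"
        proof
          fix w assume w: "w \<in> ball z (\<eta> * r)"
          have "dist x w \<le> dist x z + dist z w" by (rule dist_triangle)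
          also have "\<dots> < 2 * r" using w \<eta>r by (simp add: r_def dist_norm norm_minus_commute)
          finally show "w \<in> ball x (2 * r) - ?K" using no w by (auto simp: dist_norm)
        qed
        have "measure lebesgue (ball z (\<eta> * r)) \<le> measure lebesgue (ball x (2 * r) - ?K)"
          using meas by (intro measure_mono_fmeasurable[OF sub] fmeasurable_Diff) auto
        also have "\<dots> \<le> \<epsilon> * (2 * r) ^ ?N" using d2(2)[of "2 * r"] r by simp
        also have "measure lebesgue (ball z (\<eta> * r)) = \<omega> * (\<eta> * r) ^ ?N"
          using content_ball[of "\<eta> * r" z] \<eta> r by (simp add: \<omega>_def)
        also have "\<epsilon> * (2 * r) ^ ?N = \<omega> * (\<eta> * r) ^ ?N / 2"
          by (simp add: \<epsilon>_def power_mult_distrib)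
        finally show False using \<omega> \<eta> r by (simp add: not_le mult_pos_pos)
      qed
      then obtain w where w: "F w = F x" "norm (z - w) < \<eta> * r" by blast
      have "norm (w - x) \<le> norm (z - x) + norm (z - w)" using norm_triangle_ineq4[of "z - x" "z - w"] by simp
      also have "norm (z - w) \<le> r"
      proof -
        have "\<eta> * r \<le> 1 * r" using \<eta> r by (intro mult_right_mono) auto
        then show ?thesis using w(2) by linarith
      qed
      finally have wx: "norm (w - x) \<le> 2 * r" by (simp add: r_def)
      have Uz: "norm (U z - U x - U' (z - x)) \<le> \<eta> * r" using d1(2)[of z] r(1,2) unfolding r_def by linarith
      have Uw: "norm (U w - U x - U' (w - x)) \<le> \<eta> * (2 * r)"
      proof -
        have "norm (U w - U x - U' (w - x)) \<le> \<eta> * norm (w - x)" using d1(2)[of w] r wx by linarith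
        also have "\<dots> \<le> \<eta> * (2 * r)" using wx \<eta> by (intro mult_left_mono) auto
        finally show ?thesis .
      qed
      have lin: "U' (z - x) - U' (w - x) = U' (z - w)"
        using linear_diff[OF has_derivative_linear[OF U'], of "z - x" "w - x"] by simp
      have tri: "norm (a - b + c) \<le> norm a + norm b + norm c" for a b c :: "real^'n"
        by (rule order_trans[OF norm_triangle_ineq]) (simp add: norm_triangle_ineq4)
      \<comment> \<open>Only the linearisation at x is available, so z and w are both compared with
        it; the linear part is small because |z - w| is.\<close>
      have "U z - U w = (U z - U x - U' (z - x)) - (U w - U x - U' (w - x)) + U' (z - w)"
        unfolding lin[symmetric] by simp
      then have "norm (U z - U w) \<le> norm (U z - U x - U' (z - x)) + norm (U w - U x - U' (w - x)) + norm (U' (z - w))"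
        by (simp only: tri)
      also have "\<dots> \<le> \<eta> * r + \<eta> * (2 * r) + \<eta> * r * B"
      proof -
        have "norm (U' (z - w)) \<le> norm (z - w) * B" by (rule B)
        also have "\<dots> \<le> \<eta> * r * B" using w B by (intro mult_right_mono) auto
        finally show ?thesis using Uz Uw by linarith
      qed
      finally have "norm (z - w) + norm (U z - U w) \<le> (4 + B) * (\<eta> * r)"
        using w by (simp add: algebra_simps)
      then have "L * (norm (z - w) + norm (U z - U w)) \<le> L * ((4 + B) * (\<eta> * r))"
        using L by (intro mult_left_mono)
      then have "norm (F z - F w) \<le> L * (4 + B) * \<eta> * r"
        using lip[of z w] by (simp add: mult.assoc)
      also have "\<dots> \<le> e * r" using \<eta>e r by (intro mult_right_mono) auto
      finally show ?thesis using w by (simp add: r_def)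
    qed
  qed
qed

text \<open>The theorem for scalar functions is applied to each component on balls of integer
  radius. The weak derivatives may change with the ball, which does no harm because the conclusion
  concerns U alone.\<close>

lemma Eset_negligible:
  fixes U :: "real^'n::finite \<Rightarrow> real^'n"
  assumes U: "continuous_on UNIV U"
    and lor: "\<And>\<Omega> k l. open \<Omega> \<Longrightarrow> bounded \<Omega> \<Longrightarrow> \<exists>g. weak_partial \<Omega> l (\<lambda>y. U y $ k) g \<and> lorentz_N1 \<Omega> g"
  shows "negligible (Eset U)"
proof -
  define D where "D k m = {x\<in>ball 0 (real m). \<not> (\<lambda>y. U y $ k) differentiable (at x)}" for k and m :: nat
  have "negligible (D k m)" for k m
  proof -
    have "\<forall>l. \<exists>g. weak_partial (ball 0 (real m)) l (\<lambda>y. U y $ k) g \<and> lorentz_N1 (ball 0 (real m)) g"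
      using lor[of "ball 0 (real m)"] by auto
    then obtain g where "\<forall>l. weak_partial (ball 0 (real m)) l (\<lambda>y. U y $ k) (g l) \<and> lorentz_N1 (ball 0 (real m)) (g l)"
      by (rule choice[THEN exE])
    then show ?thesis
      unfolding D_def using U
      by (intro stein_differentiable_AE[where g = g] continuous_on_component) auto
  qed
  then have "negligible (\<Union>p. D (fst p) (snd p))"
    by (intro negligible_countable_Union countable_image) auto
  moreover have "Eset U \<subseteq> (\<Union>p. D (fst p) (snd p))"
  proof
    fix x assume "x \<in> Eset U"
    then have "\<not> U differentiable (at x)" by (simp add: Eset_def)
    then obtain k where k: "\<not> (\<lambda>y. U y $ k) differentiable (at x)"
      unfolding differentiable_componentwise_within[of U x UNIV] by (auto simp: Basis_vec_def inner_axis)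
    obtain m :: nat where "norm x < real m" using reals_Archimedean2 by blast
    then have "x \<in> D k m" using k by (simp add: D_def)
    then show "x \<in> (\<Union>p. D (fst p) (snd p))" by (auto intro!: exI[of _ k] exI[of _ m])
  qed
  ultimately show ?thesis by (rule negligible_subset)
qed

lemma negligible_level_minus_Zset:
  fixes X :: "real \<Rightarrow> real^'n \<Rightarrow> real^'n \<Rightarrow> real^'n::finite"
  assumes E: "negligible (Eset U)" and L: "L \<ge> 0"
    and lip: "\<And>y z. norm (Fmap X U t y - Fmap X U t z) \<le> L * (norm (y - z) + norm (U y - U z))"
    and meas: "Fmap X U t -` {x} \<in> sets lebesgue"
  shows "negligible (Fmap X U t -` {x} - Zset X U t)"
proof -
  let ?K = "Fmap X U t -` {x}"
  define N where "N j = {y\<in>?K. \<not> (\<exists>d>0. \<forall>r. 0 < r \<and> r < d \<longrightarrow>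
           measure lebesgue (ball y r - ?K) \<le> inverse (real (Suc j)) * r ^ DIM(real^'n))}" for j
  have "negligible (N j)" for j
    unfolding N_def by (rule AE_density[OF meas]) simp
  then have "negligible (Eset U \<union> (\<Union>j. N j))"
    using E by (intro negligible_Un negligible_countable_Union) auto
  moreover have "?K - Zset X U t \<subseteq> Eset U \<union> (\<Union>j. N j)"
  proof
    fix y assume y: "y \<in> ?K - Zset X U t"
    show "y \<in> Eset U \<union> (\<Union>j. N j)"
    proof (rule ccontr)
      assume no: "y \<notin> Eset U \<union> (\<Union>j. N j)"
      have Fy: "{w. Fmap X U t w = Fmap X U t y} = ?K" using y by auto
      have "(Fmap X U t has_derivative (\<lambda>_. 0)) (at y)"
      proof (rule zero_derivative_at_density_point[OF L lip])
        show "U differentiable (at y)" using no by (auto simp: Eset_def)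
        show "{w. Fmap X U t w = Fmap X U t y} \<in> sets lebesgue" unfolding Fy by (rule meas)
        fix \<epsilon> :: real assume "\<epsilon> > 0"
        then obtain j where j: "inverse (real (Suc j)) < \<epsilon>" using reals_Archimedean by blast
        have "y \<notin> N j" using no by blast
        then obtain d where d: "d > 0" "\<And>r. 0 < r \<Longrightarrow> r < d \<Longrightarrow>
            measure lebesgue (ball y r - ?K) \<le> inverse (real (Suc j)) * r ^ DIM(real^'n)"
          using y unfolding N_def by blast
        show "\<exists>d>0. \<forall>r. 0 < r \<and> r < d \<longrightarrow>
            measure lebesgue (ball y r - {w. Fmap X U t w = Fmap X U t y}) \<le> \<epsilon> * r ^ CARD('n)"
          unfolding Fy
        proof (intro exI[of _ d] conjI allI impI)
          fix r assume r: "0 < r \<and> r < d"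
          have "measure lebesgue (ball y r - ?K) \<le> inverse (real (Suc j)) * r ^ CARD('n)"
            using d(2) r by simp
          also have "\<dots> \<le> \<epsilon> * r ^ CARD('n)" using j r by (intro mult_right_mono) auto
          finally show "measure lebesgue (ball y r - ?K) \<le> \<epsilon> * r ^ CARD('n)" .
        qed (rule d(1))
      qed
      \<comment> \<open>\<open>Jac\<close> refers to the chosen \<open>frechet_derivative\<close>,
        which is identified now that a derivative is known to exist. Its matrix is 0, so y belongs
        to \<open>Zset\<close>, against the choice of y.\<close>
      then have "frechet_derivative (Fmap X U t) (at y) = (\<lambda>_. 0)"
        by (rule frechet_derivative_at[symmetric])
      moreover have m0: "matrix (\<lambda>_::real^'n. 0::real^'n) = mat 0"
        by (simp add: matrix_def mat_def vec_eq_iff)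
      have "det (matrix (\<lambda>_::real^'n. 0::real^'n)) = 0" unfolding m0 by (rule det_0)
      ultimately have "Jac X U t y = 0" by (simp add: Jac_def)
      then show False using y no by (auto simp: Zset_def)
    qed
  qed
  ultimately show ?thesis by (rule negligible_subset)
qed

text \<open>The Hamiltonian field is the gradient with its two blocks swapped and one sign reversed,
  an isometric change, so the bound \<kappa> on the Hessian is also a Lipschitz constant of the
  field. The difference of two trajectories then satisfies the growth bound.\<close>

lemma flow_lipschitz:
  fixes gx gxi :: "real^'n::finite \<Rightarrow> real^'n \<Rightarrow> real^'n"
  assumes H_hess: "\<And>z. ((\<lambda>(x, \<xi>). (gx x \<xi>, gxi x \<xi>)) has_derivative blinfun_apply (D2 z)) (at z)"
    and bound_hess: "\<And>z. norm (D2 z) \<le> \<kappa>"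
    and flow_init: "\<And>x \<xi>. X 0 x \<xi> = x \<and> Xi 0 x \<xi> = \<xi>"
    and flow_ode: "\<And>x \<xi> t. ((\<lambda>s. (X s x \<xi>, Xi s x \<xi>)) has_vector_derivative
                      (gxi (X t x \<xi>) (Xi t x \<xi>), - gx (X t x \<xi>) (Xi t x \<xi>))) (at t)"
  shows "norm ((X t x \<xi>, Xi t x \<xi>) - (X t x' \<xi>', Xi t x' \<xi>'))
      \<le> exp (\<kappa> * \<bar>t\<bar>) * norm ((x, \<xi>) - (x', \<xi>'))"
proof -
  define V where "V p = (gxi (fst p) (snd p), - gx (fst p) (snd p))" for p
  define G where "G p = (gx (fst p) (snd p), gxi (fst p) (snd p))" for p
  have G: "(G has_derivative blinfun_apply (D2 z)) (at z)" for z
    using H_hess[of z] by (simp add: G_def[abs_def] split_beta')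
  have "norm (G p - G q) \<le> \<kappa> * norm (p - q)" for p q
    by (rule differentiable_bound[OF convex_UNIV, where f' = "\<lambda>z. blinfun_apply (D2 z)"])
       (use G bound_hess in \<open>auto simp: norm_blinfun.rep_eq[symmetric]\<close>)
  moreover have "norm (V p - V q) = norm (G p - G q)" for p q
    by (simp add: V_def G_def norm_Pair norm_minus_commute add.commute)
  ultimately have V: "norm (V p - V q) \<le> \<kappa> * norm (p - q)" for p q by simp
  define u where "u s = (X s x \<xi>, Xi s x \<xi>) - (X s x' \<xi>', Xi s x' \<xi>')" for s
  have "norm (u t) \<le> exp (\<kappa> * \<bar>t\<bar>) * norm (u 0)"
  proof (rule norm_le_exp_growth)
    fix s
    show "(u has_vector_derivative V (X s x \<xi>, Xi s x \<xi>) - V (X s x' \<xi>', Xi s x' \<xi>')) (at s)"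
      unfolding u_def[abs_def] V_def fst_conv snd_conv by (intro has_vector_derivative_diff flow_ode)
    show "norm (V (X s x \<xi>, Xi s x \<xi>) - V (X s x' \<xi>', Xi s x' \<xi>')) \<le> \<kappa> * norm (u s)"
      unfolding u_def by (rule V)
  qed
  then show ?thesis by (simp add: u_def flow_init)
qed

text \<open>The three push-forwards compose to one: \<open>fst\<close> of the flow along the graph
  of U is \<open>Fmap X U t\<close>, so the mass of a point is the \<open>rho\<close>-mass of its
  fibre.\<close>

lemma emeasure_rho_t:
  fixes X Xi :: "real \<Rightarrow> real^'n \<Rightarrow> real^'n \<Rightarrow> real^'n::finite"
  assumes U: "continuous_on UNIV U"
    and \<Phi>: "continuous_on UNIV (\<lambda>(x, \<xi>). (X t x \<xi>, Xi t x \<xi>))"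
    and rho: "rho \<in> borel_measurable lebesgue"
  shows "emeasure (rho_t X Xi U rho t) {x} = (\<integral>\<^sup>+ y. ennreal (rho y) * indicator (Fmap X U t -` {x}) y \<partial>lebesgue)"
proof -
  let ?M = "density lebesgue (\<lambda>y. ennreal (rho y))"
  have "(\<lambda>y. (y, U y)) \<in> borel_measurable borel"
    using U by (intro borel_measurable_continuous_onI continuous_intros)
  then have m1: "(\<lambda>y. (y, U y)) \<in> measurable ?M borel" by (simp add: measurable_completion)
  have m2: "(\<lambda>(x, \<xi>). (X t x \<xi>, Xi t x \<xi>)) \<in> measurable borel borel"
    using \<Phi> by (rule borel_measurable_continuous_onI)
  have m3: "fst \<in> measurable (borel :: ((real^'n) \<times> (real^'n)) measure) (borel :: (real^'n) measure)"
    by (intro borel_measurable_continuous_onI continuous_intros)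
  have F: "fst \<circ> ((\<lambda>(x, \<xi>). (X t x \<xi>, Xi t x \<xi>)) \<circ> (\<lambda>y. (y, U y))) = Fmap X U t"
    by (auto simp: fun_eq_iff Fmap_def)
  have mF: "Fmap X U t \<in> measurable ?M borel"
    unfolding F[symmetric] by (rule measurable_comp[OF measurable_comp[OF m1 m2] m3])
  have "rho_t X Xi U rho t = distr ?M borel (Fmap X U t)"
    unfolding rho_t_def mu_t_def mu_in_def
    using m1 m2 m3 measurable_comp[OF m1 m2] by (simp add: distr_distr F)
  then have "emeasure (rho_t X Xi U rho t) {x} = emeasure ?M (Fmap X U t -` {x})"
    using emeasure_distr[OF mF, of "{x}"] by simp
  also have "\<dots> = (\<integral>\<^sup>+ y. ennreal (rho y) * indicator (Fmap X U t -` {x}) y \<partial>lebesgue)"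
  proof (rule emeasure_density)
    show "Fmap X U t -` {x} \<in> sets lebesgue"
      using measurable_sets[OF mF, of "{x}"] by simp
  qed (use rho in measurable)
  finally show ?thesis .
qed

text \<open>The push-forward of a finite measure has at most countably many atoms. Lebesgue measure
  is made finite by restriction to balls of integer radius; a fibre of positive measure meets some
  ball in positive measure.\<close>

lemma countable_fibres_positive_measure:
  fixes F :: "real^'n::finite \<Rightarrow> 'b::euclidean_space"
  assumes F: "continuous_on UNIV F"
  shows "countable {x. emeasure lebesgue (F -` {x}) > 0}"
proof -
  define M where "M m = density lebesgue (indicator (ball 0 (real m)) :: real^'n \<Rightarrow> ennreal)" for m :: nat
  have "F \<in> borel_measurable borel" using F by (rule borel_measurable_continuous_onI)
  then have Fl: "F \<in> measurable lebesgue borel" by (simp add: measurable_completion)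
  then have FM: "F \<in> measurable (M m) borel" for m by (simp add: M_def)
  have sets: "F -` {x} \<in> sets lebesgue" for x
    using measurable_sets[OF Fl, of "{x}"] by simp
  have emM: "emeasure (M m) A = emeasure lebesgue (A \<inter> ball 0 (real m))" if "A \<in> sets lebesgue" for m A
  proof -
    have "emeasure (M m) A = (\<integral>\<^sup>+ y. indicator (A \<inter> ball 0 (real m)) y \<partial>lebesgue)"
      unfolding M_def using that
      by (subst emeasure_density)
        (auto intro!: borel_measurable_indicator nn_integral_cong simp: indicator_inter_arith mult.commute)
    also have "\<dots> = emeasure lebesgue (A \<inter> ball 0 (real m))"
      using that by (intro nn_integral_indicator) auto
    finally show ?thesis .
  qed
  have fin: "finite_measure (distr (M m) borel F)" for m
  proof (rule finite_measureI)
    have "emeasure (distr (M m) borel F) (space (distr (M m) borel F)) = emeasure (M m) UNIV"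
      using FM by (simp add: emeasure_distr M_def)
    also have "\<dots> = emeasure lebesgue (ball 0 (real m) :: (real^'n) set)" by (simp add: emM)
    also have "\<dots> < \<infinity>" using lmeasurable_ball[of "0::real^'n" "real m"] unfolding fmeasurable_def by blast
    finally show "emeasure (distr (M m) borel F) (space (distr (M m) borel F)) \<noteq> \<infinity>" by simp
  qed
  have "countable (\<Union>m. {x. measure (distr (M m) borel F) {x} \<noteq> 0})"
    using finite_measure.countable_support[OF fin] by auto
  moreover have "{x. emeasure lebesgue (F -` {x}) > 0} \<subseteq> (\<Union>m. {x. measure (distr (M m) borel F) {x} \<noteq> 0})"
  proof
    fix x assume "x \<in> {x. emeasure lebesgue (F -` {x}) > 0}"
    then have pos: "emeasure lebesgue (F -` {x}) > 0" by simp
    have "\<exists>m. emeasure lebesgue (F -` {x} \<inter> ball 0 (real m)) \<noteq> 0"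
    proof (rule ccontr)
      assume "\<not> (\<exists>m. emeasure lebesgue (F -` {x} \<inter> ball 0 (real m)) \<noteq> 0)"
      then have "(\<Union>m. F -` {x} \<inter> ball 0 (real m)) \<in> null_sets lebesgue"
        using sets by (intro null_sets_UN') (auto simp: null_sets_def)
      moreover have "(\<Union>m. F -` {x} \<inter> ball 0 (real m)) = F -` {x}"
        by (auto simp: reals_Archimedean2)
      ultimately show False using pos by auto
    qed
    then obtain m where m: "emeasure lebesgue (F -` {x} \<inter> ball 0 (real m)) \<noteq> 0" by blast
    have "emeasure (distr (M m) borel F) {x} = emeasure lebesgue (F -` {x} \<inter> ball 0 (real m))"
      using emeasure_distr[OF FM, of "{x}" m] sets[of x] by (simp add: emM M_def[of m, THEN arg_cong[of _ _ space]])
    then have "measure (distr (M m) borel F) {x} \<noteq> 0"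
      using m finite_measure.emeasure_eq_measure[OF fin, of m "{x}"] by auto
    then show "x \<in> (\<Union>m. {x. measure (distr (M m) borel F) {x} \<noteq> 0})" by blast
  qed
  ultimately show ?thesis by (rule countable_subset[rotated])
qed

theorem theorem2p9:
  fixes H :: "(real^'n::finite) \<times> (real^'n) \<Rightarrow> real"
    and gx gxi :: "real^'n \<Rightarrow> real^'n \<Rightarrow> real^'n"
    and D2 :: "(real^'n) \<times> (real^'n) \<Rightarrow> ((real^'n) \<times> (real^'n)) \<Rightarrow>\<^sub>L ((real^'n) \<times> (real^'n))"
    and \<kappa> :: real and h :: "real \<Rightarrow> real"
    and X Xi :: "real \<Rightarrow> real^'n \<Rightarrow> real^'n \<Rightarrow> real^'n"
    and U :: "real^'n \<Rightarrow> real^'n"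
  assumes H_grad: "\<And>x \<xi>. (H has_derivative (\<lambda>(u, v). gx x \<xi> \<bullet> u + gxi x \<xi> \<bullet> v)) (at (x, \<xi>))"
    and H_hess: "\<And>z. ((\<lambda>(x, \<xi>). (gx x \<xi>, gxi x \<xi>)) has_derivative blinfun_apply (D2 z)) (at z)"
    and H_hess_cont: "continuous_on UNIV D2"
    and kappa_pos: "\<kappa> > 0"
    and h_cont: "continuous_on UNIV h"
    and h_nonneg: "\<And>r. h r \<ge> 0"
    and h_sublin: "((\<lambda>r. h r / r) \<longlongrightarrow> 0) at_top"
    and bound_gxi: "\<And>x \<xi>. norm (gxi x \<xi>) \<le> \<kappa> * (1 + norm \<xi>)"
    and bound_gx: "\<And>x \<xi>. norm (gx x \<xi>) \<le> h (norm x) + \<kappa> * norm \<xi>"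
    and bound_hess: "\<And>z. norm (D2 z) \<le> \<kappa>"
    and flow_init: "\<And>x \<xi>. X 0 x \<xi> = x \<and> Xi 0 x \<xi> = \<xi>"
    and flow_ode: "\<And>x \<xi> t. ((\<lambda>s. (X s x \<xi>, Xi s x \<xi>)) has_vector_derivative
                      (gxi (X t x \<xi>) (Xi t x \<xi>), - gx (X t x \<xi>) (Xi t x \<xi>))) (at t)"
    and U_cont: "continuous_on UNIV U"
    and U_sublin: "((\<lambda>y. norm (U y) / norm y) \<longlongrightarrow> 0) at_infinity"
    and U_lorentz: "\<And>\<Omega> k l. open \<Omega> \<Longrightarrow> bounded \<Omega> \<Longrightarrow>
                      \<exists>g. weak_partial \<Omega> l (\<lambda>y. U y $ k) g \<and> lorentz_N1 \<Omega> g"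
  shows "(\<forall>t. Aset X U t \<subseteq> Cset X U t)
       \<and> (\<forall>t rho. rho \<in> borel_measurable lebesgue \<and> (\<forall>y. rho y \<ge> 0)
               \<and> (\<integral>\<^sup>+ y. ennreal (rho y) \<partial>lebesgue) = 1
               \<and> (AE y in lebesgue. y \<in> Zset X U t \<longrightarrow> rho y > 0)
            \<longrightarrow> (\<forall>x. emeasure (rho_t X Xi U rho t) {x} > 0 \<longleftrightarrow> x \<in> Aset X U t))
       \<and> (\<forall>t. countable (Aset X U t))"
proof -
  let ?\<Phi> = "\<lambda>t (x, \<xi>). (X t x \<xi>, Xi t x \<xi>)"
  have lip: "norm (?\<Phi> t p - ?\<Phi> t q) \<le> exp (\<kappa> * \<bar>t\<bar>) * norm (p - q)" for t p q
    using flow_lipschitz[OF H_hess bound_hess flow_init flow_ode] by (cases p, cases q) simp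
  have \<Phi>_cont: "continuous_on UNIV (?\<Phi> t)" for t
    by (rule lipschitz_on_continuous_on[of "exp (\<kappa> * \<bar>t\<bar>)"])
       (use lip in \<open>auto simp: lipschitz_on_def dist_norm\<close>)
  have F_lip: "norm (Fmap X U t y - Fmap X U t z) \<le> exp (\<kappa> * \<bar>t\<bar>) * (norm (y - z) + norm (U y - U z))" for t y z
  proof -
    have "norm (Fmap X U t y - Fmap X U t z) \<le> norm (?\<Phi> t (y, U y) - ?\<Phi> t (z, U z))"
      using norm_fst_le[of "X t y (U y) - X t z (U z)" "Xi t y (U y) - Xi t z (U z)"] by (simp add: Fmap_def)
    also have "\<dots> \<le> exp (\<kappa> * \<bar>t\<bar>) * norm ((y, U y) - (z, U z))" by (rule lip)
    also have "\<dots> \<le> exp (\<kappa> * \<bar>t\<bar>) * (norm (y - z) + norm (U y - U z))"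
      using norm_Pair_le[of "y - z" "U y - U z"] by (intro mult_left_mono) auto
    finally show ?thesis .
  qed
  have F_cont: "continuous_on UNIV (Fmap X U t)" for t
  proof -
    have "continuous_on UNIV (\<lambda>y. fst (?\<Phi> t (y, U y)))"
      by (intro continuous_on_fst continuous_on_compose2[OF \<Phi>_cont] continuous_intros U_cont) auto
    then show ?thesis by (simp add: Fmap_def[abs_def])
  qed
  have K_meas: "Fmap X U t -` {x} \<in> sets lebesgue" for t x
  proof -
    have "closed (Fmap X U t -` {x})"
      using F_cont[of t] by (intro continuous_closed_vimage) (auto simp: continuous_on_eq_continuous_at)
    then show ?thesis by simp
  qed
  have K_minus_Z: "negligible (Fmap X U t -` {x} - Zset X U t)" for t x
    by (rule negligible_level_minus_Zset[OF Eset_negligible[OF U_cont U_lorentz] _ F_lip K_meas]) auto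
  \<comment> \<open>By the null difference, \<open>Zset\<close> may be dropped from the condition
    defining \<open>Aset\<close>; the claims on atoms and on countability become claims about whole
    fibres, which are closed.\<close>
  have A_iff: "x \<in> Aset X U t \<longleftrightarrow> emeasure lebesgue (Fmap X U t -` {x}) > 0" for t x
  proof -
    let ?K = "Fmap X U t -` {x}" and ?Z = "Zset X U t"
    have null: "?K - ?Z \<in> null_sets lebesgue" using K_minus_Z by (simp add: negligible_iff_null_sets)
    have "?K \<inter> ?Z = ?K - (?K - ?Z)" by blast
    then have "emeasure lebesgue (?K \<inter> ?Z) = emeasure lebesgue ?K"
      using emeasure_Diff_null_set[OF null K_meas] by simp
    then show ?thesis by (simp add: Aset_def)
  qed
  have b: "emeasure (rho_t X Xi U rho t) {x} > 0 \<longleftrightarrow> x \<in> Aset X U t"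
    if rho: "rho \<in> borel_measurable lebesgue" and pos: "AE y in lebesgue. y \<in> Zset X U t \<longrightarrow> rho y > 0"
    for t rho x
  proof -
    let ?K = "Fmap X U t -` {x}"
    have meas: "(\<lambda>y. ennreal (rho y) * indicator ?K y) \<in> borel_measurable lebesgue"
      using rho K_meas by (intro borel_measurable_times_ennreal borel_measurable_indicator measurable_compose[OF rho measurable_ennreal])
    \<comment> \<open>Positivity of \<open>rho\<close> is assumed only on \<open>Zset\<close>, but
      the fibre exceeds \<open>Zset\<close> by a null set only; hence the integral of
      \<open>rho\<close> over the fibre vanishes exactly when the fibre is null.\<close>
    have posK: "AE y in lebesgue. y \<in> ?K \<longrightarrow> rho y > 0"
    proof -
      have "AE y in lebesgue. y \<notin> ?K - Zset X U t"
        using K_minus_Z[of t x] by (intro AE_not_in) (simp add: negligible_iff_null_sets)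
      with pos show ?thesis by eventually_elim auto
    qed
    have "emeasure (rho_t X Xi U rho t) {x} = 0 \<longleftrightarrow> (AE y in lebesgue. ennreal (rho y) * indicator ?K y = 0)"
      unfolding emeasure_rho_t[where t = t, OF U_cont \<Phi>_cont rho] by (rule nn_integral_0_iff_AE[OF meas])
    also have "\<dots> \<longleftrightarrow> (AE y in lebesgue. y \<notin> ?K)"
    proof
      assume "AE y in lebesgue. ennreal (rho y) * indicator ?K y = 0"
      with posK show "AE y in lebesgue. y \<notin> ?K"
        by eventually_elim (auto simp: ennreal_eq_0_iff split: split_indicator_asm)
    next
      assume "AE y in lebesgue. y \<notin> ?K"
      then show "AE y in lebesgue. ennreal (rho y) * indicator ?K y = 0"
        by eventually_elim simp
    qed
    also have "\<dots> \<longleftrightarrow> emeasure lebesgue ?K = 0"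
      by (intro AE_iff_measurable[OF K_meas]) auto
    finally show ?thesis unfolding A_iff by (simp add: zero_less_iff_neq_zero)
  qed
  have "Aset X U t \<subseteq> Cset X U t" for t
  proof
    fix x assume "x \<in> Aset X U t"
    \<comment> \<open>A set of positive measure is nonempty, and any of its points witnesses
      membership in \<open>Cset\<close>.\<close>
    then have "Fmap X U t -` {x} \<inter> Zset X U t \<noteq> {}" by (auto simp only: Aset_def mem_Collect_eq emeasure_empty)
    then show "x \<in> Cset X U t" by (auto simp: Cset_def)
  qed
  moreover have "countable (Aset X U t)" for t
  proof -
    have "Aset X U t = {x. emeasure lebesgue (Fmap X U t -` {x}) > 0}" using A_iff by blast
    then show ?thesis using countable_fibres_positive_measure[OF F_cont[of t]] by simp
  qed
  ultimately show ?thesis using b by blast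
qed

end
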